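(* Let $\mu\vdash n$ and suppose the conjugacy class $\mathcal{C}_\mu\subseteq S_n$ of cycle type $\mu$, with its descent map, carries a cyclic extension. Then for every cyclic extension $(\mathrm{cDes},p)$ of $\mathrm{Des}$ on $\mathcal{C}_\mu$ and every $\varnothing\subsetneq J\subsetneq[n]$, $$|\{\pi\in\mathcal{C}_\mu:\mathrm{cDes}(\pi)=J\}|=\langle\tilde s_{\tilde\alpha(n,J)},L_\mu\rangle .$$
   Context: $\mathrm{Des}(\pi)=\{1\le i\le n-1:\pi_i>\pi_{i+1}\}$ for $\pi=[\pi_1,\dots,\pi_n]$. $\mathrm{sh}:2^{[n]}\to2^{[n]}$ is induced by $i\mapsto i+1\pmod n$. A cyclic extension of $\mathrm{Des}:\mathcal{T}\to2^{[n-1]}$ is a pair $(\mathrm{cDes},p)$ with $\mathrm{cDes}:\mathcal{T}\to2^{[n]}$, $p$ a bijection of $\mathcal{T}$, such that $\mathrm{cDes}(T)\cap[n-1]=\mathrm{Des}(T)$, $\mathrm{cDes}(p(T))=\mathrm{sh}(\mathrm{cDes}(T))$, and $\varnothing\subsetneq\mathrm{cDes}(T)\subsetneq[n]$ for all $T$. Higher Lie character: let $k_i$ be the multiplicity of $i$ in $\mu$; fix $\pi\in\mathcal{C}_\mu$, whose centralizer is $C_\mu\cong\times_i Z_i\wr S_{k_i}$, where for each $i$ the base group $Z_i^{k_i}$ is generated by the $i$-cycles $(a^{(l)}_1\cdots a^{(l)}_i)$ of $\pi$ and the wreathing $S_{k_i}$ consists of the permutations $a^{(l)}_t\mapsto a^{(\tau(l))}_t$.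 Let $\omega_i$ be the linear character of $Z_i\wr S_{k_i}$ equal to $\prod_l\zeta_i(z_l)$ on the base group ($\zeta_i$ a faithful linear character of $Z_i$) and trivial on the wreathing subgroup; $\omega^\mu=\bigotimes_i\omega_i$ and $\psi^\mu=\mathrm{Ind}_{C_\mu}^{S_n}\omega^\mu$. $L_\mu=\mathrm{ch}(\psi^\mu)$ is its Frobenius characteristic, and $\langle\cdot,\cdot\rangle$ is the Hall inner product on symmetric functions. For $\varnothing\ne J=\{j_1<\dots<j_t\}\subseteq[n]$ the cyclic composition is $\tilde\alpha(n,J)=(j_2-j_1,\dots,j_t-j_{t-1},j_1+n-j_t)$, with $\tilde\alpha(n,J)=(n)$ if $t=1$. For a composition $\alpha$, $h_\alpha=\prod_i h_{\alpha_i}$ (complete homogeneous symmetric functions). The affine ribbon Schur function is $\tilde s_{\tilde\alpha(n,J)}=\sum_{\varnothing\ne I\subseteq J}(-1)^{|J\setminus I|}h_{\tilde\alpha(n,I)}$. *)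

theory Defs
  imports Complex_Main "HOL-Combinatorics.Orbits" "HOL-Library.Poly_Mapping"
begin

section \<open>Formal power series in countably many variables\<close>

text \<open>
  A monomial in the variables \<open>x\<^sub>0, x\<^sub>1, \<dots>\<close> is its exponent vector, of type
  \<^typ>\<open>nat \<Rightarrow>\<^sub>0 nat\<close>.
\<close>

typedef 'a mfps = "UNIV :: ((nat \<Rightarrow>\<^sub>0 nat) \<Rightarrow> 'a) set"
  morphisms mcoeff Abs_mfps by simp

lemma mcoeff_Abs [simp]: "mcoeff (Abs_mfps f) = f"
  by (simp add: Abs_mfps_inverse)

lemma mfps_eqI: "(\<And>m. mcoeff f m = mcoeff g m) \<Longrightarrow> f = g"
  by (metis ext mcoeff_inject)

lemma finite_monomial_splits: "finite {(a, b). a + b = (m :: nat \<Rightarrow>\<^sub>0 nat)}"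
proof -
  let ?K = "Poly_Mapping.keys m" and ?lk = "Poly_Mapping.lookup :: (nat \<Rightarrow>\<^sub>0 nat) \<Rightarrow> nat \<Rightarrow> nat"
  define F where "F = {f :: nat \<Rightarrow> nat. \<forall>x. (x \<in> ?K \<longrightarrow> f x \<in> (\<Union>y\<in>?K. {..?lk m y})) \<and> (x \<notin> ?K \<longrightarrow> f x = 0)}"
  have "finite F"
    unfolding F_def by (rule finite_set_of_finite_funs) auto
  have F: "f \<in> F" if "\<And>x. f x \<le> ?lk m x" for f
  proof -
    have "f x = 0" if "x \<notin> ?K" for x
      using that \<open>f x \<le> ?lk m x\<close> by (simp add: in_keys_iff)
    then show ?thesis
      unfolding F_def using that by blast
  qed
  have "?lk a \<in> F \<and> ?lk b \<in> F" if "a + b = m" for a b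
    using that by (auto intro!: F simp: lookup_add)
  then have "(\<lambda>(a, b). (?lk a, ?lk b)) ` {(a, b). a + b = m} \<subseteq> F \<times> F"
    by auto
  moreover have "inj_on (\<lambda>(a, b). (?lk a, ?lk b)) {(a, b). a + b = m}"
    by (rule inj_onI) (simp add: case_prod_unfold prod_eq_iff Poly_Mapping.lookup_inject)
  ultimately show ?thesis
    using \<open>finite F\<close> finite_imageD [OF finite_subset [OF _ finite_cartesian_product]] by blast
qed

instantiation mfps :: (comm_ring_1) comm_ring_1
begin

definition "0 = Abs_mfps (\<lambda>_. 0)"
definition "1 = Abs_mfps (\<lambda>m. if m = 0 then 1 else 0)"
definition "f + g = Abs_mfps (\<lambda>m. mcoeff f m + mcoeff g m)"
definition "- f = Abs_mfps (\<lambda>m. - mcoeff f m)"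
definition "f - g = Abs_mfps (\<lambda>m. mcoeff f m - mcoeff g m)"
definition "f * g = Abs_mfps (\<lambda>m. \<Sum>(a, b) | a + b = m. mcoeff f a * mcoeff g b)"

instance
proof
  fix f g h :: "'a mfps"
  show "f * g * h = f * (g * h)"
  proof (rule mfps_eqI)
    fix m
    have "mcoeff (f * g * h) m =
      (\<Sum>(d, c) | d + c = m. \<Sum>(a, b) | a + b = d. mcoeff f a * mcoeff g b * mcoeff h c)"
      by (simp add: times_mfps_def sum_distrib_right case_prod_unfold)
    also have "\<dots> = (\<Sum>(p, q)\<in>(SIGMA p:{(d, c). d + c = m}. {(a, b). a + b = fst p}).
        mcoeff f (fst q) * mcoeff g (snd q) * mcoeff h (snd p))"
      by (subst sum.Sigma [symmetric])
        (simp_all add: finite_monomial_splits [unfolded case_prod_unfold] case_prod_unfold)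
    also have "\<dots> = (\<Sum>(p, q)\<in>(SIGMA p:{(a, e). a + e = m}. {(b, c). b + c = snd p}).
        mcoeff f (fst p) * (mcoeff g (fst q) * mcoeff h (snd q)))"
      by (rule sum.reindex_bij_witness [of _ "\<lambda>((a, e), (b, c)). ((a + b, c), (a, b))"
            "\<lambda>((d, c), (a, b)). ((a, b + c), (b, c))"]) (auto simp: add.assoc mult.assoc)
    also have "\<dots> = (\<Sum>(a, e) | a + e = m. \<Sum>(b, c) | b + c = e.
        mcoeff f a * (mcoeff g b * mcoeff h c))"
      by (subst sum.Sigma [symmetric])
        (simp_all add: finite_monomial_splits [unfolded case_prod_unfold] case_prod_unfold)
    also have "\<dots> = mcoeff (f * (g * h)) m"
      by (simp add: times_mfps_def sum_distrib_left case_prod_unfold)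
    finally show "mcoeff (f * g * h) m = mcoeff (f * (g * h)) m" .
  qed
  show "f * g = g * f"
    unfolding times_mfps_def
    by (intro arg_cong [where f = Abs_mfps] ext
        sum.reindex_bij_witness [of _ prod.swap prod.swap]) (auto simp: add.commute mult.commute)
  show "1 * f = f"
  proof (rule mfps_eqI)
    fix m
    have "mcoeff (1 * f) m = (\<Sum>p | fst p + snd p = m.
        (if fst p = 0 then 1 else 0) * mcoeff f (snd p))"
      by (simp add: times_mfps_def one_mfps_def case_prod_unfold)
    also have "\<dots> = (\<Sum>p\<in>{(0 :: nat \<Rightarrow>\<^sub>0 nat, m)}. (if fst p = 0 then 1 else 0) * mcoeff f (snd p))"
    proof (rule sum.mono_neutral_right)
      show "finite {p. fst p + snd p = m}"
        using finite_monomial_splits [of m] by (simp add: case_prod_unfold)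
    qed auto
    finally show "mcoeff (1 * f) m = mcoeff f m" by simp
  qed
  show "(f + g) * h = f * h + g * h"
    by (rule mfps_eqI)
      (simp add: times_mfps_def plus_mfps_def distrib_right sum.distrib case_prod_unfold)
  show "(0 :: 'a mfps) \<noteq> 1"
  proof
    assume "(0 :: 'a mfps) = 1"
    then have "mcoeff (0 :: 'a mfps) 0 = mcoeff 1 0" by simp
    then show False by (simp add: one_mfps_def zero_mfps_def)
  qed
qed (auto simp: plus_mfps_def zero_mfps_def uminus_mfps_def minus_mfps_def add_ac mcoeff_inverse)

end

definition msmult :: "'a::comm_ring_1 \<Rightarrow> 'a mfps \<Rightarrow> 'a mfps" where
  "msmult c f = Abs_mfps (\<lambda>m. c * mcoeff f m)"


section \<open>Symmetric functions\<close>

text \<open>Integer partitions are multisets of positive parts.\<close>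

definition partition_of :: "nat \<Rightarrow> nat multiset \<Rightarrow> bool" where
  "partition_of n \<mu> \<longleftrightarrow> 0 \<notin># \<mu> \<and> sum_mset \<mu> = n"

definition hom_sym :: "nat \<Rightarrow> 'a::comm_ring_1 mfps" where
  "hom_sym k = Abs_mfps (\<lambda>m. if (\<Sum>i\<in>Poly_Mapping.keys m. Poly_Mapping.lookup m i) = k then 1 else 0)"

definition pow_sym :: "nat \<Rightarrow> 'a::comm_ring_1 mfps" where
  "pow_sym k = Abs_mfps (\<lambda>m. if \<exists>i. m = Poly_Mapping.single i k then 1 else 0)"

definition hom_sym_part :: "nat multiset \<Rightarrow> 'a::comm_ring_1 mfps" where
  "hom_sym_part \<nu> = (\<Prod>i\<in>#\<nu>. hom_sym i)"

definition pow_sym_part :: "nat multiset \<Rightarrow> 'a::comm_ring_1 mfps" where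
  "pow_sym_part \<nu> = (\<Prod>i\<in>#\<nu>. pow_sym i)"

definition mono_sym_part :: "nat multiset \<Rightarrow> 'a::comm_ring_1 mfps" where
  "mono_sym_part \<nu> =
     Abs_mfps (\<lambda>m. if image_mset (Poly_Mapping.lookup m) (mset_set (Poly_Mapping.keys m)) = \<nu> then 1 else 0)"

text \<open>
  Coordinates of \<open>f\<close> with respect to a family \<open>B\<close> indexed by partitions that is a basis
  of the space of symmetric functions.
\<close>

definition basis_coeff :: "(nat multiset \<Rightarrow> 'a::comm_ring_1 mfps) \<Rightarrow> 'a mfps \<Rightarrow> nat multiset \<Rightarrow> 'a"
  where "basis_coeff B f = (THE c. finite {\<nu>. c \<nu> \<noteq> 0} \<and> (\<forall>\<nu>. c \<nu> \<noteq> 0 \<longrightarrow> 0 \<notin># \<nu>) \<and>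
           f = (\<Sum>\<nu> | c \<nu> \<noteq> 0. msmult (c \<nu>) (B \<nu>)))"

text \<open>
  The Hall inner product: the bilinear form for which the bases \<open>h\<^sub>\<nu>\<close> and \<open>m\<^sub>\<nu>\<close> are dual
  to each other. It is meaningful for symmetric functions (of bounded degree) only.
\<close>

definition hall :: "'a::comm_ring_1 mfps \<Rightarrow> 'a mfps \<Rightarrow> 'a" where
  "hall f g = (\<Sum>\<nu> | basis_coeff hom_sym_part f \<nu> \<noteq> 0.
     basis_coeff hom_sym_part f \<nu> * basis_coeff mono_sym_part g \<nu>)"

definition cyclic_comp :: "nat \<Rightarrow> nat set \<Rightarrow> nat list" where
  "cyclic_comp n J = (let js = sorted_list_of_set J
     in map2 (-) (tl js) js @ [hd js + n - last js])"

definition affine_ribbon :: "nat \<Rightarrow> nat set \<Rightarrow> 'a::comm_ring_1 mfps" where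
  "affine_ribbon n J = (\<Sum>I | I \<noteq> {} \<and> I \<subseteq> J.
     (-1) ^ card (J - I) * (\<Prod>k\<leftarrow>cyclic_comp n I. hom_sym k))"


section \<open>Permutations, descents and cyclic extensions\<close>

text \<open>
  \<open>S\<^sub>n\<close> is the set of functions permuting \<open>{1..n}\<close>, with composition as multiplication.
\<close>

definition Sym :: "nat \<Rightarrow> (nat \<Rightarrow> nat) set" where
  "Sym n = {\<pi>. \<pi> permutes {1..n}}"

definition cycle_type :: "nat \<Rightarrow> (nat \<Rightarrow> nat) \<Rightarrow> nat multiset" where
  "cycle_type n \<pi> = image_mset card (mset_set (orbit \<pi> ` {1..n}))"

definition conj_class :: "nat \<Rightarrow> nat multiset \<Rightarrow> (nat \<Rightarrow> nat) set" where
  "conj_class n \<mu> = {\<pi> \<in> Sym n. cycle_type n \<pi> = \<mu>}"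

definition Des :: "nat \<Rightarrow> (nat \<Rightarrow> nat) \<Rightarrow> nat set" where
  "Des n \<pi> = {i \<in> {1..<n}. \<pi> i > \<pi> (Suc i)}"

definition sh :: "nat \<Rightarrow> nat set \<Rightarrow> nat set" where
  "sh n A = (\<lambda>i. i mod n + 1) ` A"

definition cyclic_extension ::
  "nat \<Rightarrow> 'a set \<Rightarrow> ('a \<Rightarrow> nat set) \<Rightarrow> ('a \<Rightarrow> nat set) \<Rightarrow> ('a \<Rightarrow> 'a) \<Rightarrow> bool" where
  "cyclic_extension n \<T> D cDes p \<longleftrightarrow>
     bij_betw p \<T> \<T> \<and>
     (\<forall>T\<in>\<T>. cDes T \<inter> {1..<n} = D T \<and>
             cDes (p T) = sh n (cDes T) \<and>
             {} \<subset> cDes T \<and> cDes T \<subset> {1..n})"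


section \<open>Higher Lie characters\<close>

definition centralizer :: "nat \<Rightarrow> (nat \<Rightarrow> nat) \<Rightarrow> (nat \<Rightarrow> nat) set" where
  "centralizer n \<pi> = {g \<in> Sym n. g \<circ> \<pi> = \<pi> \<circ> g}"

definition linear_character :: "('a \<Rightarrow> 'a) set \<Rightarrow> (('a \<Rightarrow> 'a) \<Rightarrow> complex) \<Rightarrow> bool" where
  "linear_character H \<omega> \<longleftrightarrow>
     (\<forall>g\<in>H. \<omega> g \<noteq> 0) \<and> (\<forall>g\<in>H. \<forall>h\<in>H. \<omega> (g \<circ> h) = \<omega> g * \<omega> h)"

text \<open>\<open>Z\<^sub>i\<close> is \<open>{0..<i}\<close> with addition modulo \<open>i\<close>.\<close>

definition faithful_character :: "nat \<Rightarrow> (nat \<Rightarrow> complex) \<Rightarrow> bool" where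
  "faithful_character i \<zeta> \<longleftrightarrow>
     (\<forall>s<i. \<zeta> s \<noteq> 0) \<and> (\<forall>s<i. \<forall>t<i. \<zeta> ((s + t) mod i) = \<zeta> s * \<zeta> t) \<and> inj_on \<zeta> {..<i}"

text \<open>
  \<open>a i l\<close> lists the elements of the \<open>l\<close>-th cycle of length \<open>i\<close> of \<open>\<pi>\<close>; the indices \<open>l\<close> and
  \<open>t\<close> of \<open>a i l t\<close> start at 0.
\<close>

definition cycle_labelling ::
  "nat \<Rightarrow> nat multiset \<Rightarrow> (nat \<Rightarrow> nat) \<Rightarrow> (nat \<Rightarrow> nat \<Rightarrow> nat \<Rightarrow> nat) \<Rightarrow> bool" where
  "cycle_labelling n \<mu> \<pi> a \<longleftrightarrow>
     bij_betw (\<lambda>(i, l, t). a i l t) {(i, l, t). l < count \<mu> i \<and> t < i} {1..n} \<and>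
     (\<forall>i l t. l < count \<mu> i \<and> t < i \<longrightarrow> \<pi> (a i l t) = a i l (Suc t mod i))"

text \<open>
  \<open>g\<close> is the element of the base group \<open>\<Prod>\<^sub>i Z\<^sub>i ^ k\<^sub>i\<close> that acts on the cycle
  \<open>a i l\<close> as its \<open>z i l\<close>-th power.
\<close>

definition base_element ::
  "nat \<Rightarrow> nat multiset \<Rightarrow> (nat \<Rightarrow> nat \<Rightarrow> nat \<Rightarrow> nat) \<Rightarrow> (nat \<Rightarrow> nat \<Rightarrow> nat) \<Rightarrow> (nat \<Rightarrow> nat) \<Rightarrow> bool"
  where
  "base_element n \<mu> a z g \<longleftrightarrow> g \<in> Sym n \<and>
     (\<forall>i l t. l < count \<mu> i \<and> t < i \<longrightarrow> z i l < i \<and> g (a i l t) = a i l ((t + z i l) mod i))"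

definition wreathing_element ::
  "nat \<Rightarrow> nat multiset \<Rightarrow> (nat \<Rightarrow> nat \<Rightarrow> nat \<Rightarrow> nat) \<Rightarrow> (nat \<Rightarrow> nat \<Rightarrow> nat) \<Rightarrow> (nat \<Rightarrow> nat) \<Rightarrow> bool"
  where
  "wreathing_element n \<mu> a \<tau> g \<longleftrightarrow> g \<in> Sym n \<and> (\<forall>i. \<tau> i permutes {..<count \<mu> i}) \<and>
     (\<forall>i l t. l < count \<mu> i \<and> t < i \<longrightarrow> g (a i l t) = a i (\<tau> i l) t)"

definition omega_character ::
  "nat \<Rightarrow> nat multiset \<Rightarrow> (nat \<Rightarrow> nat) \<Rightarrow> (nat \<Rightarrow> nat \<Rightarrow> nat \<Rightarrow> nat) \<Rightarrow> (nat \<Rightarrow> nat \<Rightarrow> complex) \<Rightarrow>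
   ((nat \<Rightarrow> nat) \<Rightarrow> complex) \<Rightarrow> bool" where
  "omega_character n \<mu> \<pi> a \<zeta> \<omega> \<longleftrightarrow>
     linear_character (centralizer n \<pi>) \<omega> \<and>
     (\<forall>z g. base_element n \<mu> a z g \<longrightarrow>
        \<omega> g = (\<Prod>i\<in>set_mset \<mu>. \<Prod>l<count \<mu> i. \<zeta> i (z i l))) \<and>
     (\<forall>\<tau> g. wreathing_element n \<mu> a \<tau> g \<longrightarrow> \<omega> g = 1)"

definition induced_character ::
  "('a \<Rightarrow> 'a) set \<Rightarrow> ('a \<Rightarrow> 'a) set \<Rightarrow> (('a \<Rightarrow> 'a) \<Rightarrow> complex) \<Rightarrow> ('a \<Rightarrow> 'a) \<Rightarrow> complex" where
  "induced_character G H \<omega> g =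
     (\<Sum>x | x \<in> G \<and> inv x \<circ> g \<circ> x \<in> H. \<omega> (inv x \<circ> g \<circ> x)) / of_nat (card H)"

text \<open>
  \<open>\<psi>\<close> arises as \<open>\<psi>\<^sup>\<mu>\<close> for some choice of the permutation of cycle type \<open>\<mu>\<close>, of the
  labelling of its cycles, and of the faithful characters \<open>\<zeta>\<^sub>i\<close>.
\<close>

definition higher_lie_character :: "nat \<Rightarrow> nat multiset \<Rightarrow> ((nat \<Rightarrow> nat) \<Rightarrow> complex) \<Rightarrow> bool" where
  "higher_lie_character n \<mu> \<psi> \<longleftrightarrow> (\<exists>\<pi> a \<zeta> \<omega>.
     \<pi> \<in> conj_class n \<mu> \<and> cycle_labelling n \<mu> \<pi> a \<and>
     (\<forall>i\<in>#\<mu>. faithful_character i (\<zeta> i)) \<and> omega_character n \<mu> \<pi> a \<zeta> \<omega> \<and>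
     \<psi> = induced_character (Sym n) (centralizer n \<pi>) \<omega>)"

definition frobenius_ch :: "nat \<Rightarrow> ((nat \<Rightarrow> nat) \<Rightarrow> complex) \<Rightarrow> complex mfps" where
  "frobenius_ch n \<chi> = msmult (1 / fact n) (\<Sum>w\<in>Sym n. msmult (\<chi> w) (pow_sym_part (cycle_type n w)))"


subsection \<open>Existence of the choices made in the definition of a higher Lie character\<close>

lemma cycle_labelling_exists:
  assumes "partition_of n \<mu>"
  obtains \<pi> a where "\<pi> \<in> conj_class n \<mu>" "cycle_labelling n \<mu> \<pi> a"
proof -
  define X where "X = {(i, l, t). l < count \<mu> i \<and> t < i}"
  define P where "P = {(i, l). l < count \<mu> i}"
  have X_eq: "X = (SIGMA i:set_mset \<mu>. {..<count \<mu> i} \<times> {..<i})"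
    unfolding X_def by (auto simp flip: count_greater_zero_iff)
  have P_eq: "P = (SIGMA i:set_mset \<mu>. {..<count \<mu> i})"
    unfolding P_def by (auto simp flip: count_greater_zero_iff)
  have "finite X" "finite P" by (auto simp: X_eq P_eq)
  have "card X = (\<Sum>i\<in>set_mset \<mu>. count \<mu> i * i)"
    unfolding X_eq by (subst card_SigmaI) auto
  also have "\<dots> = sum_mset \<mu>"
  proof -
    have "(\<Sum>i\<in>S. count M i * i) = sum_mset M" if "finite S" "set_mset M \<subseteq> S" for S and M :: "nat multiset"
      using that(2)
    proof (induction M)
      case (add x M)
      have "(\<Sum>i\<in>S. count (add_mset x M) i * i) =
          (\<Sum>i\<in>S. (if i = x then i else 0) + count M i * i)"
        by (intro sum.cong) auto
      also have "\<dots> = x + sum_mset M"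
        using add \<open>finite S\<close> by (simp add: sum.distrib)
      finally show ?case by simp
    qed simp
    then show ?thesis by simp
  qed
  finally have "card X = card {1..n}"
    using assms by (simp add: partition_of_def)
  then obtain e where e: "bij_betw e X {1..n}"
    using \<open>finite X\<close> finite_same_card_bij by blast
  define a where "a = (\<lambda>i l t. e (i, l, t))"
  define s where "s = (\<lambda>(i :: nat, l :: nat, t). (i, l, Suc t mod i))"
  define \<pi> where "\<pi> = (\<lambda>x. if x \<in> {1..n} then e (s (inv_into X e x)) else x)"
  have "inj_on s X"
    unfolding X_def s_def by (rule inj_onI) (auto simp: mod_Suc split: if_splits)
  moreover have "s ` X \<subseteq> X"
    unfolding X_def s_def by auto
  ultimately have s: "bij_betw s X X"
    using \<open>finite X\<close> by (simp add: bij_betw_def endo_inj_surj)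
  have \<pi>e: "\<pi> (e x) = e (s x)" if "x \<in> X" for x
  proof -
    have "e x \<in> {1..n}" using bij_betwE [OF e] that by blast
    then show ?thesis using bij_betw_inv_into_left [OF e that] by (simp add: \<pi>_def)
  qed
  have "bij_betw ((e \<circ> s) \<circ> inv_into X e) {1..n} {1..n}"
    by (intro bij_betw_trans [OF bij_betw_inv_into [OF e]] bij_betw_trans [OF s e])
  then have "bij_betw \<pi> {1..n} {1..n}"
    by (rule iffD1 [OF bij_betw_cong, rotated]) (simp add: \<pi>_def)
  then have \<pi>: "\<pi> permutes {1..n}"
    by (rule bij_imp_permutes) (auto simp: \<pi>_def)
  have lab: "cycle_labelling n \<mu> \<pi> a"
    unfolding cycle_labelling_def
  proof (intro conjI allI impI)
    show "bij_betw (\<lambda>(i, l, t). a i l t) {(i, l, t). l < count \<mu> i \<and> t < i} {1..n}"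
      using e unfolding X_def a_def by (simp add: case_prod_unfold)
    show "\<pi> (a i l t) = a i l (Suc t mod i)" if "l < count \<mu> i \<and> t < i" for i l t
      using that by (simp add: a_def \<pi>e X_def s_def)
  qed
  have pw: "(\<pi> ^^ k) (e (i, l, t)) = e (i, l, (t + k) mod i)" if "(i, l, t) \<in> X" for i l t k
  proof (induction k)
    case 0
    then show ?case using that by (simp add: X_def)
  next
    case (Suc k)
    have "(i, l, (t + k) mod i) \<in> X" using that by (auto simp: X_def)
    with Suc show ?case by (simp add: \<pi>e s_def mod_Suc_eq)
  qed
  define A where "A = (\<lambda>(i, l). (\<lambda>t. e (i, l, t)) ` {..<i})"
  have orb: "orbit \<pi> (e (i, l, t)) = A (i, l)" if X: "(i, l, t) \<in> X" for i l t
  proof -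
    have "permutation \<pi>" using \<pi> by (auto simp: permutation_permutes)
    then have "orbit \<pi> (e (i, l, t)) = {(\<pi> ^^ k) (e (i, l, t)) | k. True}"
      by (rule orbit_altdef_permutation)
    also have "\<dots> = {e (i, l, (t + k) mod i) | k. True}"
      by (simp add: pw X)
    also have "\<dots> = A (i, l)"
    proof -
      have "\<exists>k. e (i, l, r) = e (i, l, (t + k) mod i)" if "r < i" for r
      proof (rule exI [of _ "i - t + r"])
        have "(t + (i - t + r)) mod i = r"
          using that X by (simp add: X_def)
        then show "e (i, l, r) = e (i, l, (t + (i - t + r)) mod i)" by simp
      qed
      moreover have "i > 0" using X by (auto simp: X_def)
      ultimately show ?thesis by (auto simp: A_def)
    qed
    finally show ?thesis .
  qed
  have pos: "i > 0" if "(i, l) \<in> P" for i l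
    using that assms unfolding P_eq partition_of_def by (auto intro: Nat.gr0I)
  have "orbit \<pi> ` {1..n} = orbit \<pi> ` e ` X"
    using e by (simp add: bij_betw_def)
  also have "\<dots> = A ` P"
  proof
    show "orbit \<pi> ` e ` X \<subseteq> A ` P"
    proof clarify
      fix i l t assume "(i, l, t) \<in> X"
      moreover from this have "(i, l) \<in> P" by (simp add: X_def P_def)
      ultimately show "orbit \<pi> (e (i, l, t)) \<in> A ` P" by (simp add: orb)
    qed
    show "A ` P \<subseteq> orbit \<pi> ` e ` X"
    proof clarify
      fix i l assume il: "(i, l) \<in> P"
      then have "(i, l, 0) \<in> X" using pos by (auto simp: X_def P_def)
      then show "A (i, l) \<in> orbit \<pi> ` e ` X" using orb by (metis imageI)
    qed
  qed
  finally have orbs: "orbit \<pi> ` {1..n} = A ` P" .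
  have eq: "x = y" if "e x = e y" "x \<in> X" "y \<in> X" for x y
    using that e by (auto simp: bij_betw_def inj_on_def)
  have "inj_on A P"
  proof (rule inj_onI, clarify)
    fix i l i' l' assume il: "(i, l) \<in> P" "(i', l') \<in> P" "A (i, l) = A (i', l')"
    have "e (i, l, 0) \<in> A (i', l')"
      using il(3) [symmetric] pos [OF il(1)] by (auto simp: A_def)
    then obtain t where "t < i'" "e (i, l, 0) = e (i', l', t)"
      by (auto simp: A_def)
    then show "i = i' \<and> l = l'"
      using eq [of "(i, l, 0)" "(i', l', t)"] il(1,2) pos [OF il(1)] by (auto simp: X_def P_def)
  qed
  have cardA: "card (A x) = fst x" if "x \<in> P" for x
  proof -
    obtain i l where x: "x = (i, l)" by fastforce
    have "inj_on (\<lambda>t. e (i, l, t)) {..<i}"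
    proof (rule inj_onI)
      fix t u assume "t \<in> {..<i}" "u \<in> {..<i}" "e (i, l, t) = e (i, l, u)"
      then show "t = u" using eq [of "(i, l, t)" "(i, l, u)"] that by (simp add: X_def P_def x)
    qed
    then show ?thesis by (simp add: A_def card_image x)
  qed
  have "cycle_type n \<pi> = image_mset card (image_mset A (mset_set P))"
    unfolding cycle_type_def orbs using \<open>inj_on A P\<close> by (simp add: image_mset_mset_set)
  also have "\<dots> = image_mset fst (mset_set P)"
    using \<open>finite P\<close> by (auto simp: cardA multiset.map_comp intro!: image_mset_cong)
  also have "\<dots> = \<mu>"
  proof (rule multiset_eqI)
    fix i
    have *: "{x \<in> P. i = fst x} = {i} \<times> {..<count \<mu> i}"
      by (auto simp: P_def)
    have "count (image_mset fst (mset_set P)) i = (\<Sum>x\<in>{x \<in> P. i = fst x}. count (mset_set P) x)"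
      using \<open>finite P\<close> by (simp add: count_image_mset')
    also have "\<dots> = (\<Sum>x\<in>{x \<in> P. i = fst x}. 1)"
      using \<open>finite P\<close> by (intro sum.cong) auto
    also have "\<dots> = count \<mu> i"
      unfolding * by simp
    finally show "count (image_mset fst (mset_set P)) i = count \<mu> i" .
  qed
  finally have "\<pi> \<in> conj_class n \<mu>"
    using \<pi> by (simp add: conj_class_def Sym_def)
  with lab show thesis by (rule that [rotated])
qed

lemma faithful_character_exists:
  assumes "i > 0"
  shows "faithful_character i (\<lambda>t. cis (2 * pi * real t / real i))"
  unfolding faithful_character_def
proof (intro conjI allI impI)
  fix s t assume "s < i" "t < i"
  define q where "q = (s + t) div i"
  have "real (s + t) = real i * real q + real ((s + t) mod i)"
    unfolding q_def by (metis mult_div_mod_eq of_nat_add of_nat_mult)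
  then have *: "real ((s + t) mod i) = real s + real t - real i * real q" by simp
  have "2 * pi * real s / real i + 2 * pi * real t / real i =
      2 * pi * real ((s + t) mod i) / real i + 2 * pi * real q"
    unfolding * using assms by (simp add: field_simps)
  moreover have "cis (2 * pi * real q) = 1" by (rule cis_multiple_2pi) auto
  ultimately show "cis (2 * pi * real ((s + t) mod i) / real i) =
      cis (2 * pi * real s / real i) * cis (2 * pi * real t / real i)"
    by (metis cis_mult mult.right_neutral)
next
  show "inj_on (\<lambda>t. cis (2 * pi * real t / real i)) {..<i}"
    using bij_betw_roots_unity [OF assms] by (simp add: bij_betw_def)
qed simp

lemma omega_character_exists:
  assumes part: "partition_of n \<mu>" and lab: "cycle_labelling n \<mu> \<pi> a"
    and \<zeta>: "\<forall>i\<in>#\<mu>. faithful_character i (\<zeta> i)"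
  obtains \<omega> where "omega_character n \<mu> \<pi> a \<zeta> \<omega>"
proof -
  define X where "X = {(i, l, t). l < count \<mu> i \<and> t < i}"
  define P where "P = (SIGMA i:set_mset \<mu>. {..<count \<mu> i})"
  have P_iff: "(i, l) \<in> P \<longleftrightarrow> l < count \<mu> i" for i l
    unfolding P_def by (auto simp flip: count_greater_zero_iff)
  have pos: "i > 0" if "l < count \<mu> i" for i l
    using that part unfolding partition_of_def
    by (metis bot_nat_0.not_eq_extremum count_eq_zero_iff not_less_zero)
  have "finite P" by (auto simp: P_def)
  define e where "e = (\<lambda>(i, l, t). a i l t)"
  have e: "bij_betw e X {1..n}"
    using lab by (simp add: cycle_labelling_def e_def X_def)
  define r where "r = inv_into X e"
  have r: "r (a i l t) = (i, l, t)" if "l < count \<mu> i" "t < i" for i l t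
    using bij_betw_inv_into_left [OF e, of "(i, l, t)"] that by (simp add: r_def e_def X_def)
  have \<pi>: "\<pi> (a i l t) = a i l (Suc t mod i)" if "l < count \<mu> i" "t < i" for i l t
    using lab that by (simp add: cycle_labelling_def)
  have pw: "(\<pi> ^^ k) (a i l t) = a i l ((t + k) mod i)" if "l < count \<mu> i" "t < i" for i l t k
  proof (induction k)
    case 0
    then show ?case using that by simp
  next
    case (Suc k)
    have "(t + k) mod i < i" using that by simp
    with Suc \<pi> [OF that(1) this] show ?case by (simp add: mod_Suc_eq)
  qed
  define T where "T = (\<lambda>g (i, l). snd (snd (r (g (a i l 0)))))"
  define L where "L = (\<lambda>g (i, l). fst (snd (r (g (a i l 0)))))"
  have act: "L g (i, l) < count \<mu> i \<and> T g (i, l) < i \<and>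
      g (a i l t) = a i (L g (i, l)) ((T g (i, l) + t) mod i)"
    if g: "g \<in> centralizer n \<pi>" and il: "l < count \<mu> i" and t: "t < i" for g i l t
  proof -
    have gp: "g permutes {1..n}" and comm: "g \<circ> \<pi> = \<pi> \<circ> g"
      using g by (auto simp: centralizer_def Sym_def)
    have "i > 0" using t by simp
    have "(i, l, 0) \<in> X" using il \<open>i > 0\<close> by (simp add: X_def)
    then have "a i l 0 \<in> {1..n}"
      using bij_betwE [OF e] by (force simp: e_def)
    then have "g (a i l 0) \<in> {1..n}" using gp by (simp only: permutes_in_image)
    then obtain x where "x \<in> X" "g (a i l 0) = e x"
      using e by (metis bij_betw_imp_surj_on imageE)
    then obtain i' l' u where u: "l' < count \<mu> i'" "u < i'" "g (a i l 0) = a i' l' u"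
      by (cases x) (auto simp: X_def e_def)
    have gpw: "g ((\<pi> ^^ k) y) = (\<pi> ^^ k) (g y)" for k y
    proof (induction k)
      case (Suc k)
      then show ?case using fun_cong [OF comm] by simp
    qed simp
    have all: "g (a i l (k mod i)) = a i' l' ((u + k) mod i')" for k
      using gpw [of k "a i l 0"] pw [OF il \<open>i > 0\<close>, of k] pw [OF u(1,2), of k] u(3) by simp
    have "a i' l' ((u + i) mod i') = a i' l' u"
      using all [of i] u(3) by simp
    then have "(u + i) mod i' = u"
      using r [OF u(1), of "(u + i) mod i'"] r [OF u(1,2)] u(2) by simp
    then have "i' dvd i"
      using u(2) by (metis add_diff_cancel_left' mod_eq_dvd_iff_nat le_add1 mod_less)
    then have "i' \<le> i" using \<open>i > 0\<close> by (simp add: dvd_imp_le)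
    moreover have "\<not> i' < i"
    proof
      assume "i' < i"
      have "g (a i l i') = g (a i l 0)"
        using all [of i'] u \<open>i' < i\<close> by simp
      then have "a i l i' = a i l 0" using gp by (metis permutes_inverses(2))
      then show False
        using r [OF il \<open>i' < i\<close>] r [OF il \<open>i > 0\<close>] u by simp
    qed
    ultimately have [simp]: "i' = i" by simp
    have "L g (i, l) = l'" "T g (i, l) = u"
      using u r [OF u(1,2)] by (auto simp: L_def T_def)
    then show ?thesis using all [of t] u t by simp
  qed
  define \<omega> where "\<omega> = (\<lambda>g. \<Prod>x\<in>P. \<zeta> (fst x) (T g x))"
  have lin: "linear_character (centralizer n \<pi>) \<omega>"
    unfolding linear_character_def
  proof (intro conjI ballI)
    fix g assume g: "g \<in> centralizer n \<pi>"
    have "\<zeta> i (T g (i, l)) \<noteq> 0" if "(i, l) \<in> P" for i l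
    proof -
      have l: "l < count \<mu> i" and "i \<in># \<mu>" using that by (auto simp: P_def)
      have "T g (i, l) < i" using act [OF g l, of 0] pos [OF l] by simp
      then show ?thesis using \<zeta> \<open>i \<in># \<mu>\<close> by (auto simp: faithful_character_def)
    qed
    then show "\<omega> g \<noteq> 0" using \<open>finite P\<close> by (auto simp: \<omega>_def)
  next
    fix g assume g: "g \<in> centralizer n \<pi>"
    fix h assume h: "h \<in> centralizer n \<pi>"
    define M where "M = (\<lambda>(i, l). (i, L h (i, l)))"
    have "M ` P \<subseteq> P"
    proof (rule image_subsetI)
      fix x assume "x \<in> P"
      then show "M x \<in> P"
        using act [OF h, of "snd x" "fst x" 0] pos [of "snd x" "fst x"]
        by (cases x) (simp add: M_def P_iff)
    qed
    moreover have "inj_on M P"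
    proof (rule inj_onI, clarify)
      fix i l i' l' assume *: "(i, l) \<in> P" "(i', l') \<in> P" "M (i, l) = M (i', l')"
      then have [simp]: "i' = i" and L: "L h (i, l) = L h (i, l')" by (auto simp: M_def)
      have l: "l < count \<mu> i" "l' < count \<mu> i" using * by (auto simp: P_iff)
      have i: "i > 0" using pos l by blast
      define u where "u = T h (i, l)"
      define u' where "u' = T h (i, l')"
      have "u < i" "u' < i" using act [OF h l(1) i] act [OF h l(2) i] by (auto simp: u_def u'_def)
      define t where "t = (u + (i - u')) mod i"
      have "t < i" using i by (simp add: t_def)
      have "(u' + t) mod i = (u' + (u + (i - u'))) mod i"
        by (simp add: t_def mod_add_right_eq)
      also have "\<dots> = u" using \<open>u < i\<close> \<open>u' < i\<close> by simp
      finally have "h (a i l' t) = h (a i l 0)"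
        using act [OF h l(1) i] act [OF h l(2) \<open>t < i\<close>] L by (simp add: u_def u'_def)
      moreover have "h permutes {1..n}" using h by (auto simp: centralizer_def Sym_def)
      ultimately have "a i l' t = a i l 0" by (metis permutes_inverses(2))
      then show "i = i' \<and> l = l'" using r [OF l(1) i] r [OF l(2) \<open>t < i\<close>] by simp
    qed
    ultimately have M: "bij_betw M P P"
      using \<open>finite P\<close> by (simp add: bij_betw_def endo_inj_surj)
    have T: "\<zeta> (fst x) (T (g \<circ> h) x) = \<zeta> (fst (M x)) (T g (M x)) * \<zeta> (fst x) (T h x)"
      if "x \<in> P" for x
    proof -
      obtain i l where x: "x = (i, l)" by fastforce
      have il: "l < count \<mu> i" using that by (simp add: x P_iff)
      have i: "i > 0" using pos il by blast
      note 1 = act [OF h il i]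
      have 2: "L h (i, l) < count \<mu> i" "T h (i, l) < i" using 1 by auto
      note 3 = act [OF g 2]
      have "(g \<circ> h) (a i l 0) = a i (L g (i, L h (i, l))) ((T g (i, L h (i, l)) + T h (i, l)) mod i)"
        using 1 3 by simp
      then have "T (g \<circ> h) (i, l) = (T g (i, L h (i, l)) + T h (i, l)) mod i"
        using r [of "L g (i, L h (i, l))" i "(T g (i, L h (i, l)) + T h (i, l)) mod i"] 3 i
        by (simp add: T_def)
      moreover have "i \<in># \<mu>" using that by (auto simp: x P_def)
      ultimately show ?thesis
        using \<zeta> 2 3 by (simp add: x M_def faithful_character_def)
    qed
    have "\<omega> (g \<circ> h) = (\<Prod>x\<in>P. \<zeta> (fst (M x)) (T g (M x)) * \<zeta> (fst x) (T h x))"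
      unfolding \<omega>_def by (rule prod.cong [OF refl T])
    also have "\<dots> = (\<Prod>x\<in>P. \<zeta> (fst (M x)) (T g (M x))) * \<omega> h"
      unfolding \<omega>_def by (rule prod.distrib)
    also have "(\<Prod>x\<in>P. \<zeta> (fst (M x)) (T g (M x))) = \<omega> g"
      unfolding \<omega>_def by (rule prod.reindex_bij_betw [OF M])
    finally show "\<omega> (g \<circ> h) = \<omega> g * \<omega> h" .
  qed
  have "omega_character n \<mu> \<pi> a \<zeta> \<omega>"
    unfolding omega_character_def
  proof (intro conjI allI impI lin)
    fix z g assume g: "base_element n \<mu> a z g"
    have "T g (i, l) = z i l" if "(i, l) \<in> P" for i l
    proof -
      have l: "l < count \<mu> i" using that by (simp add: P_iff)
      have "z i l < i" "g (a i l 0) = a i l ((0 + z i l) mod i)"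
        using g l pos [OF l] unfolding base_element_def by blast+
      then show ?thesis using r [OF l, of "z i l"] by (simp add: T_def)
    qed
    then have "\<omega> g = (\<Prod>(i, l)\<in>P. \<zeta> i (z i l))"
      unfolding \<omega>_def by (auto intro!: prod.cong)
    then show "\<omega> g = (\<Prod>i\<in>set_mset \<mu>. \<Prod>l<count \<mu> i. \<zeta> i (z i l))"
      unfolding P_def by (subst prod.Sigma) auto
  next
    fix \<tau> g assume g: "wreathing_element n \<mu> a \<tau> g"
    have "\<zeta> i (T g (i, l)) = 1" if "(i, l) \<in> P" for i l
    proof -
      have l: "l < count \<mu> i" using that by (simp add: P_iff)
      have i: "i > 0" using pos l by blast
      have "\<tau> i permutes {..<count \<mu> i}" using g by (auto simp: wreathing_element_def)
      then have "\<tau> i l < count \<mu> i" using l permutes_in_image by fastforce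
      then have "T g (i, l) = 0"
        using g l i r [of "\<tau> i l" i 0] by (simp add: wreathing_element_def T_def)
      moreover have "faithful_character i (\<zeta> i)" using that \<zeta> by (auto simp: P_def)
      then have "\<zeta> i 0 \<noteq> 0" "\<zeta> i ((0 + 0) mod i) = \<zeta> i 0 * \<zeta> i 0"
        using i unfolding faithful_character_def by blast+
      ultimately show ?thesis by simp
    qed
    then show "\<omega> g = 1" unfolding \<omega>_def by (auto intro!: prod.neutral)
  qed
  then show thesis by (rule that)
qed

lemma higher_lie_character_exists:
  assumes "partition_of n \<mu>"
  shows "\<exists>\<psi>. higher_lie_character n \<mu> \<psi>"
proof -
  obtain \<pi> a where *: "\<pi> \<in> conj_class n \<mu>" "cycle_labelling n \<mu> \<pi> a"
    using assms by (rule cycle_labelling_exists)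
  define \<zeta> where "\<zeta> = (\<lambda>i t. cis (2 * pi * real t / real i))"
  have \<zeta>: "\<forall>i\<in>#\<mu>. faithful_character i (\<zeta> i)"
    unfolding \<zeta>_def using assms faithful_character_exists by (metis gr0I partition_of_def)
  obtain \<omega> where "omega_character n \<mu> \<pi> a \<zeta> \<omega>"
    using omega_character_exists [OF assms *(2) \<zeta>] by blast
  then show ?thesis
    unfolding higher_lie_character_def using * \<zeta> by blast
qed

end

theory Submission
  imports Defs "HOL-Combinatorics.Cycles"
begin

text \<open>
  Let \<open>F(K)\<close> be the number of \<open>\<pi>\<close> in the class with \<open>cDes \<pi> \<subseteq> K\<close>. If \<open>n \<in> K\<close>, then \<open>F(K)\<close> counts
  the \<open>\<pi>\<close> with \<open>Des \<pi> \<subseteq> K\<close>, and by Gessel and Reutenauer this is the coefficient of \<open>L\<^sub>\<mu>\<close> at a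
  monomial whose exponents are the parts of the cyclic composition of \<open>K\<close>, that is, the Hall product
  of \<open>L\<^sub>\<mu>\<close> with the corresponding \<open>h\<close>. Both sides are invariant under cyclic shifts, so this holds for
  every nonempty \<open>K\<close>, while \<open>F({}) = 0\<close>; Moebius inversion turns it into the claim.

  For the theorem of Gessel and Reutenauer, the coefficient of an induced character is an average over
  words \<open>u\<close> of sums of \<open>\<omega>\<close> over the stabilizer of \<open>u\<close> in the centralizer of \<open>\<pi>\<close>. On the other side one
  counts the \<open>h\<close> for which \<open>h \<pi> h\<^sup>-\<^sup>1\<close> has its descents in \<open>K\<close> and \<open>u\<close> lists the blocks of \<open>K\<close> along
  \<open>h\<close>. Such an \<open>h\<close> sorts the points \<open>x\<close> by the infinite words \<open>u(x), u(\<pi> x), u(\<pi>\<^sup>2 x), \<dots>\<close>, and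
  \<open>\<pi>\<close> respects the order of ties. If the words of distinct points of a cycle are distinct, then the
  stabilizer acts simply transitively on these \<open>h\<close> and \<open>\<omega>\<close> is trivial on it; otherwise there is no such
  \<open>h\<close>, and \<open>\<omega>\<close> is nontrivial on the stabilizer, so that its sum vanishes.
\<close>


section \<open>Coefficients of formal power series\<close>

text \<open>The Hall product is defined through \<open>basis_coeff\<close>, a definite description,
  and says nothing until coordinates are known to be unique; this is the purpose of the linear
  independence of \<open>hom_sym_part\<close> and of \<open>mono_sym_part\<close>. The expansions
  themselves are explicit: the affine ribbon is defined as a combination of products of complete
  functions, and the coordinates of a symmetric function in the monomial basis are its coefficients.
  So pairing with such a product reads off one coefficient. Words make these coefficients
  accessible, since a product of power sums indexed by the cycle type of \<open>w\<close> has as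
  coefficients the numbers of words fixed by \<open>w\<close>. The comparison is then made word by
  word rather than through multisets of necklaces. For a word that is periodic on some cycle, the
  nontrivial value of \<open>\<omega>\<close> comes from rotating that cycle alone by a period;
  injectivity of the characters \<open>\<zeta> i\<close> enters there. The shift argument only ever
  moves \<open>K\<close> upwards until it contains \<open>n\<close>, so that no element wraps
  around.\<close>

lemma mcoeff_zero [simp]: "mcoeff 0 m = 0"
  by (simp add: zero_mfps_def)

lemma mcoeff_add [simp]: "mcoeff (f + g) m = mcoeff f m + mcoeff g m"
  by (simp add: plus_mfps_def)

lemma mcoeff_msmult [simp]: "mcoeff (msmult c f) m = c * mcoeff f m"
  by (simp add: msmult_def)

lemma mcoeff_sum [simp]: "mcoeff (\<Sum>x\<in>S. F x) m = (\<Sum>x\<in>S. mcoeff (F x) m)"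
  by (induction S rule: infinite_finite_induct) auto

lemma mcoeff_mult: "mcoeff (f * g) m = (\<Sum>(a, b) | a + b = m. mcoeff f a * mcoeff g b)"
  by (simp add: times_mfps_def)

lemma msmult_add_left: "msmult (a + b) f = msmult a f + msmult b f"
  by (rule mfps_eqI) (simp add: distrib_right)

lemma msmult_zero_left [simp]: "msmult 0 f = 0"
  by (rule mfps_eqI) simp

lemma msmult_sum_left: "msmult (\<Sum>x\<in>S. c x) f = (\<Sum>x\<in>S. msmult (c x) f)"
  by (induction S rule: infinite_finite_induct) (auto simp: msmult_add_left)

text \<open>Every value of \<open>f\<close> is a summand of \<open>m\<close>, and a monomial has
  finitely many splittings, even when the sets \<open>B j\<close> are infinite.\<close>

lemma finite_restricted_monomial_sums:
  fixes B :: "'i \<Rightarrow> (nat \<Rightarrow>\<^sub>0 nat) set"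
  assumes "finite S"
  shows "finite {f \<in> PiE S B. (\<Sum>j\<in>S. f j) = m}"
proof (rule finite_subset)
  let ?D = "fst ` {(a, b). a + b = m}"
  show "finite (PiE S (\<lambda>_. ?D))"
    using assms finite_monomial_splits by (intro finite_PiE finite_imageI) auto
  show "{f \<in> PiE S B. (\<Sum>j\<in>S. f j) = m} \<subseteq> PiE S (\<lambda>_. ?D)"
  proof (clarsimp simp: PiE_iff)
    fix f j assume "j \<in> S" "m = (\<Sum>j\<in>S. f j)"
    then have "(f j, \<Sum>j\<in>S - {j}. f j) \<in> {(a, b). a + b = (\<Sum>j\<in>S. f j)}"
      using assms by (simp add: sum.remove)
    then show "f j \<in> fst ` {(a, b). a + b = (\<Sum>j\<in>S. f j)}"
      by force
  qed
qed

text \<open>Expanding the product picks one monomial from each factor, so a coefficient becomes a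
  count of families. Power sums and complete functions both have this 0/1 form.\<close>

lemma mcoeff_prod_indicator:
  fixes B :: "'i \<Rightarrow> (nat \<Rightarrow>\<^sub>0 nat) set"
  assumes "finite S"
  shows "mcoeff (\<Prod>j\<in>S. Abs_mfps (\<lambda>m. if m \<in> B j then 1 else 0) :: 'a::comm_ring_1 mfps) m =
    of_nat (card {f \<in> PiE S B. (\<Sum>j\<in>S. f j) = m})"
  using assms
proof (induction S arbitrary: m rule: finite_induct)
  case empty
  have "{f. f = (\<lambda>x. undefined) \<and> 0 = m} = (if m = 0 then {\<lambda>x. undefined} else {})" by auto
  then show ?case by (simp add: one_mfps_def)
next
  case (insert j S)
  let ?N = "\<lambda>b. {f \<in> PiE S B. (\<Sum>j\<in>S. f j) = b}"
  let ?P = "{(a, b). a + b = m}"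
  let ?F = "\<lambda>(p :: (nat \<Rightarrow>\<^sub>0 nat) \<times> (nat \<Rightarrow>\<^sub>0 nat)). if fst p \<in> B j then ?N (snd p) else {}"
  have "mcoeff (\<Prod>j\<in>insert j S. Abs_mfps (\<lambda>m. if m \<in> B j then 1 else 0) :: 'a mfps) m =
      (\<Sum>p\<in>?P. of_nat (card (?F p)))"
    using insert by (auto simp: mcoeff_mult intro!: sum.cong)
  also have "\<dots> = of_nat (card (SIGMA p:?P. ?F p))"
    using finite_monomial_splits [of m] finite_restricted_monomial_sums [OF insert(1)]
    by (simp add: card_SigmaI)
  also have "card (SIGMA p:?P. ?F p) = card {f \<in> PiE (insert j S) B. (\<Sum>j\<in>insert j S. f j) = m}"
  proof (rule bij_betw_same_card [OF bij_betw_byWitness])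
    \<comment> \<open>A family on \<open>insert j S\<close> splits into its value at
      \<open>j\<close>, the sum of the other values and its restriction to \<open>S\<close>.\<close>
    let ?f = "\<lambda>(p, f). f(j := fst p)"
    let ?g = "\<lambda>f. ((f j, \<Sum>j\<in>S. f j), f(j := undefined))"
    have upd: "(\<Sum>i\<in>S. if i = j then c i else f i) = (\<Sum>i\<in>S. f i)" for f c
      using insert(2) by (intro sum.cong) auto
    show "\<forall>p\<in>(SIGMA p:?P. ?F p). ?g (?f p) = p"
      using insert(2) by (auto simp: upd fun_eq_iff PiE_iff extensional_def split: if_splits)
    show "\<forall>f\<in>{f \<in> PiE (insert j S) B. (\<Sum>j\<in>insert j S. f j) = m}. ?f (?g f) = f"
      by auto
    show "?f ` (SIGMA p:?P. ?F p) \<subseteq> {f \<in> PiE (insert j S) B. (\<Sum>j\<in>insert j S. f j) = m}"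
      using insert(1,2) by (auto simp: upd PiE_iff extensional_def split: if_splits)
    show "?g ` {f \<in> PiE (insert j S) B. (\<Sum>j\<in>insert j S. f j) = m} \<subseteq> (SIGMA p:?P. ?F p)"
      using insert(1,2) by (auto simp: upd PiE_iff extensional_def split: if_splits)
  qed
  finally show ?case .
qed


section \<open>Monomials as multisets of variables\<close>

text \<open>Multisets of variables replace exponent vectors because the content of a word is then an
  \<open>image_mset\<close>.\<close>

definition mon :: "nat multiset \<Rightarrow> (nat \<Rightarrow>\<^sub>0 nat)" where
  "mon M = (\<Sum>i\<in>#M. Poly_Mapping.single i 1)"

lemma mon_add [simp]: "mon (M + N) = mon M + mon N"
  by (simp add: mon_def)

lemma mon_empty [simp]: "mon {#} = 0"
  by (simp add: mon_def)

lemma mon_sum: "mon (\<Sum>x\<in>S. F x) = (\<Sum>x\<in>S. mon (F x))"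
  by (induction S rule: infinite_finite_induct) auto

lemma lookup_mon [simp]: "Poly_Mapping.lookup (mon M) i = count M i"
  by (induction M) (auto simp: mon_def lookup_add lookup_single when_def)

lemma keys_mon [simp]: "Poly_Mapping.keys (mon M) = set_mset M"
  by (auto simp: in_keys_iff count_eq_zero_iff)

lemma mon_eq_iff [simp]: "mon M = mon N \<longleftrightarrow> M = N"
  by (metis lookup_mon multiset_eqI)

lemma mon_replicate [simp]: "mon (replicate_mset k i) = Poly_Mapping.single i k"
  by (rule poly_mapping_eqI) (simp add: lookup_single when_def)

lemma mon_surj: "\<exists>M. m = mon M"
proof -
  have "finite {i. 0 < Poly_Mapping.lookup m i}"
    by (rule finite_subset [of _ "Poly_Mapping.keys m"]) (auto simp: in_keys_iff)
  then have "m = mon (Abs_multiset (Poly_Mapping.lookup m))"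
    by (intro poly_mapping_eqI) (simp add: count_Abs_multiset)
  then show ?thesis ..
qed

text \<open>The nonzero exponents of \<open>mon M\<close>, as a partition: \<open>mon M\<close> is a
  term of the monomial symmetric function with this index.\<close>

definition mtype :: "nat multiset \<Rightarrow> nat multiset" where
  "mtype M = image_mset (count M) (mset_set (set_mset M))"

lemma mcoeff_mono_sym_part: "mcoeff (mono_sym_part \<nu>) (mon M) = (if mtype M = \<nu> then 1 else 0)"
proof -
  have "Poly_Mapping.lookup (mon M) = count M" by auto
  then show ?thesis by (simp add: mono_sym_part_def mtype_def)
qed

lemma sum_mset_mtype [simp]: "sum_mset (mtype M) = size M"
  by (simp add: mtype_def size_multiset_overloaded_eq sum_unfold_sum_mset)

lemma zero_notin_mtype [simp]: "0 \<notin># mtype M"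
  by (auto simp: mtype_def simp flip: not_in_iff)


section \<open>Words and permutations\<close>

text \<open>Extensionality fixes the values off \<open>{1..n}\<close>, so that a word is determined
  by its letters. The alphabet is polymorphic because letters that are pairs occur below.\<close>

definition words :: "nat \<Rightarrow> 'c multiset \<Rightarrow> (nat \<Rightarrow> 'c) set" where
  "words n M = {u \<in> extensional {1..n}. image_mset u (mset_set {1..n}) = M}"

definition fixed_words :: "nat \<Rightarrow> 'c multiset \<Rightarrow> (nat \<Rightarrow> nat) \<Rightarrow> (nat \<Rightarrow> 'c) set" where
  "fixed_words n M w = {u \<in> words n M. u \<circ> w = u}"

lemma finite_Sym [simp]: "finite (Sym n)"
  by (simp add: Sym_def finite_permutations)

lemma card_Sym [simp]: "card (Sym n) = fact n"
  by (simp add: Sym_def card_permutations)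

lemma finite_words [simp]: "finite (words n M)"
proof (rule finite_subset)
  show "words n M \<subseteq> PiE {1..n} (\<lambda>_. set_mset M)"
    by (auto simp: words_def PiE_iff extensional_def)
qed (auto intro!: finite_PiE)

lemma finite_fixed_words [simp]: "finite (fixed_words n M w)"
  by (simp add: fixed_words_def)

lemma size_words: "u \<in> words n M \<Longrightarrow> size M = n"
  by (auto simp: words_def)

lemma set_mset_words: "u \<in> words n M \<Longrightarrow> set_mset M = u ` {1..n}"
  by (auto simp: words_def)

lemma image_mset_permutes:
  assumes "w permutes S"
  shows "image_mset (u \<circ> w) (mset_set S) = image_mset u (mset_set S)"
proof -
  have "image_mset w (mset_set S) = mset_set S"
    using assms by (simp add: image_mset_mset_set permutes_inj_on permutes_image)
  then show ?thesis by (simp flip: multiset.map_comp)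
qed

lemma words_comp:
  assumes "u \<in> words n M" "w \<in> Sym n"
  shows "u \<circ> w \<in> words n M"
  using assms by (auto simp: words_def Sym_def image_mset_permutes extensional_def permutes_not_in)

lemma words_transitive:
  assumes "u \<in> words n M" "v \<in> words n M"
  obtains w where "w \<in> Sym n" "v = u \<circ> w"
proof -
  have "image_mset v (mset_set {1..n}) = image_mset u (mset_set {1..n})"
    using assms by (simp add: words_def)
  then obtain w where w: "w permutes {1..n}" "\<forall>x\<in>{1..n}. v x = u (w x)"
    using image_mset_eq_implies_permutes [of "{1..n}" v u] by auto
  have "v = u \<circ> w"
  proof
    fix x show "v x = (u \<circ> w) x"
      using w assms by (cases "x \<in> {1..n}") (auto simp: words_def extensional_def permutes_not_in)
  qed
  with w that show thesis by (simp add: Sym_def)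
qed

lemma words_nonempty:
  assumes "size M = n"
  obtains u where "u \<in> words n M"
proof -
  obtain xs where xs: "M = mset xs" using ex_mset by metis
  define u where "u = (\<lambda>x\<in>{1..n}. xs ! (x - 1))"
  have len: "length xs = n" using assms xs by simp
  have "image_mset u (mset_set {1..n}) = image_mset (\<lambda>x. xs ! (x - 1)) (mset_set {1..n})"
    by (rule image_mset_cong) (auto simp: u_def)
  also have "\<dots> = image_mset (\<lambda>x. xs ! (x - 1)) (image_mset Suc (mset_set {0..<n}))"
    by (simp add: image_mset_mset_set image_Suc_atLeastLessThan atLeastLessThanSuc_atLeastAtMost)
  also have "image_mset (\<lambda>x. xs ! (x - 1)) (image_mset Suc (mset_set {0..<n})) =
      mset (map ((!) xs) [0..<length xs])"
    by (simp add: multiset.map_comp o_def len flip: mset_upt)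
  also have "\<dots> = M" by (simp add: xs map_nth)
  finally have "u \<in> words n M" by (auto simp: words_def u_def)
  then show thesis by (rule that)
qed

lemma Sym_comp: "g \<in> Sym n \<Longrightarrow> h \<in> Sym n \<Longrightarrow> g \<circ> h \<in> Sym n"
  by (simp add: Sym_def permutes_compose)

lemma Sym_inv: "g \<in> Sym n \<Longrightarrow> inv g \<in> Sym n"
  by (simp add: Sym_def permutes_inv)

lemma Sym_inv_o: "g \<in> Sym n \<Longrightarrow> g \<circ> inv g = id" "g \<in> Sym n \<Longrightarrow> inv g \<circ> g = id"
  by (auto simp: Sym_def permutes_inv_o)

lemma Sym_inv_apply: "g \<in> Sym n \<Longrightarrow> g (inv g x) = x" "g \<in> Sym n \<Longrightarrow> inv g (g x) = x"
  by (auto simp: Sym_def permutes_inverses)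

lemma Sym_eq_iff: "g \<in> Sym n \<Longrightarrow> g x = g y \<longleftrightarrow> x = y"
  by (metis Sym_inv_apply(2))

lemma Sym_in_iff: "g \<in> Sym n \<Longrightarrow> g x \<in> {1..n} \<longleftrightarrow> x \<in> {1..n}"
  unfolding Sym_def by (metis mem_Collect_eq permutes_in_image)

lemma card_filter_eq_sum: "finite A \<Longrightarrow> card {x \<in> A. P x} = (\<Sum>x\<in>A. if P x then 1 else 0)"
  by (simp flip: sum.inter_filter)

text \<open>Both sides count permutations: sum the orbit-stabilizer relation over the single orbit
  formed by the words of content \<open>M\<close>.\<close>

lemma sum_card_fixed_words:
  assumes "size M = n"
  shows "(\<Sum>w\<in>Sym n. card (fixed_words n M w)) = fact n"
proof -
  obtain u where u: "u \<in> words n M" using words_nonempty assms by blast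
  \<comment> \<open>Composition with some \<open>g\<close> that carries \<open>u\<close> to
    \<open>v\<close> turns the stabilizer of \<open>v\<close> into the set of all \<open>w\<close>
    carrying \<open>u\<close> to \<open>v\<close>; these sets partition
    \<open>Sym n\<close>.\<close>
  have fibre: "card {w \<in> Sym n. v \<circ> w = v} = card {w \<in> Sym n. u \<circ> w = v}" if v: "v \<in> words n M" for v
  proof -
    obtain g where g: "g \<in> Sym n" "v = u \<circ> g" using words_transitive [OF u v] .
    show ?thesis
    proof (rule bij_betw_same_card [OF bij_betw_byWitness [where f = "(\<circ>) g" and f' = "(\<circ>) (inv g)"]])
      show "\<forall>w\<in>{w \<in> Sym n. v \<circ> w = v}. inv g \<circ> (g \<circ> w) = w"
        "\<forall>w\<in>{w \<in> Sym n. u \<circ> w = v}. g \<circ> (inv g \<circ> w) = w"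
        by (simp_all add: o_assoc Sym_inv_o [OF g(1)])
      show "(\<circ>) g ` {w \<in> Sym n. v \<circ> w = v} \<subseteq> {w \<in> Sym n. u \<circ> w = v}"
      proof (rule image_subsetI)
        fix w assume "w \<in> {w \<in> Sym n. v \<circ> w = v}"
        then show "g \<circ> w \<in> {w \<in> Sym n. u \<circ> w = v}"
          by (simp add: o_assoc g(1) Sym_comp flip: g(2))
      qed
      show "(\<circ>) (inv g) ` {w \<in> Sym n. u \<circ> w = v} \<subseteq> {w \<in> Sym n. v \<circ> w = v}"
      proof (rule image_subsetI)
        fix w assume w: "w \<in> {w \<in> Sym n. u \<circ> w = v}"
        have "v \<circ> (inv g \<circ> w) = u \<circ> (g \<circ> inv g) \<circ> w"
          by (simp add: g(2) o_assoc)
        with w show "inv g \<circ> w \<in> {w \<in> Sym n. v \<circ> w = v}"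
          by (simp add: Sym_inv_o [OF g(1)] g(1) Sym_comp Sym_inv)
      qed
    qed
  qed
  have "(\<Sum>w\<in>Sym n. card (fixed_words n M w)) = (\<Sum>w\<in>Sym n. \<Sum>v\<in>words n M. if v \<circ> w = v then 1 else 0)"
    by (simp add: fixed_words_def card_filter_eq_sum)
  also have "\<dots> = (\<Sum>v\<in>words n M. card {w \<in> Sym n. v \<circ> w = v})"
    by (subst sum.swap) (simp add: card_filter_eq_sum)
  also have "\<dots> = (\<Sum>v\<in>words n M. card {w \<in> Sym n. u \<circ> w = v})"
    by (rule sum.cong [OF refl fibre])
  also have "\<dots> = card (\<Union>v\<in>words n M. {w \<in> Sym n. u \<circ> w = v})"
    by (rule card_UN_disjoint [symmetric]) auto
  also have "(\<Union>v\<in>words n M. {w \<in> Sym n. u \<circ> w = v}) = Sym n"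
    using words_comp [OF u] by auto
  finally show ?thesis by simp
qed

text \<open>Reading a word along \<open>x\<close> turns invariance under the conjugate into
  invariance under \<open>c\<close>. So the number of fixed words is a class function.\<close>

lemma card_fixed_words_conj:
  assumes x: "x \<in> Sym n"
  shows "card (fixed_words n M (x \<circ> c \<circ> inv x)) = card (fixed_words n M c)"
proof (rule bij_betw_same_card [OF bij_betw_byWitness [where f = "\<lambda>u. u \<circ> x" and f' = "\<lambda>u. u \<circ> inv x"]])
  show "\<forall>u\<in>fixed_words n M (x \<circ> c \<circ> inv x). u \<circ> x \<circ> inv x = u"
    "\<forall>u\<in>fixed_words n M c. u \<circ> inv x \<circ> x = u"
    by (simp_all add: Sym_inv_o [OF x] flip: o_assoc)
  show "(\<lambda>u. u \<circ> x) ` fixed_words n M (x \<circ> c \<circ> inv x) \<subseteq> fixed_words n M c"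
  proof (rule image_subsetI)
    fix u assume u: "u \<in> fixed_words n M (x \<circ> c \<circ> inv x)"
    then have "u \<circ> x = u \<circ> (x \<circ> c \<circ> inv x) \<circ> x" by (simp add: fixed_words_def)
    also have "\<dots> = u \<circ> x \<circ> c" by (simp add: Sym_inv_o [OF x] flip: o_assoc)
    finally show "u \<circ> x \<in> fixed_words n M c" using u by (simp add: fixed_words_def words_comp x)
  qed
  show "(\<lambda>u. u \<circ> inv x) ` fixed_words n M c \<subseteq> fixed_words n M (x \<circ> c \<circ> inv x)"
  proof (rule image_subsetI)
    fix u assume u: "u \<in> fixed_words n M c"
    have "u \<circ> inv x \<circ> (x \<circ> c \<circ> inv x) = u \<circ> (inv x \<circ> x) \<circ> c \<circ> inv x" by (simp only: o_assoc)
    also have "\<dots> = u \<circ> inv x" using u by (simp add: Sym_inv_o [OF x] fixed_words_def)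
    finally show "u \<circ> inv x \<in> fixed_words n M (x \<circ> c \<circ> inv x)"
      using u by (simp add: fixed_words_def words_comp Sym_inv x)
  qed
qed

section \<open>Cycles, fixed words and power sums\<close>

lemma orbits_Sym:
  assumes w: "w \<in> Sym n"
  shows "x \<in> orbit w x" "y \<in> orbit w x \<Longrightarrow> orbit w y = orbit w x"
    "x \<in> {1..n} \<Longrightarrow> orbit w x \<subseteq> {1..n}" "finite (orbit w x)"
    "orbit w x = {(w ^^ k) x | k. True}"
proof -
  have w': "permutation w" using w by (auto simp: Sym_def permutation_permutes)
  show self: "x \<in> orbit w x" by (rule permutation_self_in_orbit [OF w'])
  show "orbit w y = orbit w x" if "y \<in> orbit w x"
    by (rule orbit_cyclic_eq3 [OF cyclic_on_orbit' [OF w'] that])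
  show "x \<in> {1..n} \<Longrightarrow> orbit w x \<subseteq> {1..n}"
    using w by (simp add: Sym_def permutes_orbit_subset)
  show "finite (orbit w x)" by (rule finite_orbit [OF self])
  show "orbit w x = {(w ^^ k) x | k. True}" by (rule orbit_altdef_permutation [OF w'])
qed

lemma fixed_const_on_orbit:
  assumes "u \<circ> w = u" "y \<in> orbit w x"
  shows "u y = u x"
  using assms(2)
proof induction
  case base show ?case using fun_cong [OF assms(1), of x] by simp
next
  case (step y) then show ?case using fun_cong [OF assms(1), of y] by simp
qed

lemma mset_set_Union_disjoint:
  assumes "finite Q" "\<And>q. q \<in> Q \<Longrightarrow> finite q" "\<And>q r. q \<in> Q \<Longrightarrow> r \<in> Q \<Longrightarrow> q \<noteq> r \<Longrightarrow> q \<inter> r = {}"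
  shows "mset_set (\<Union>Q) = (\<Sum>q\<in>Q. mset_set q)"
  using assms
proof (induction Q rule: finite_induct)
  case (insert q Q)
  have "q \<inter> r = {}" if "r \<in> Q" for r
    using insert.prems(2) [of q r] insert.hyps(2) that by auto
  then have "q \<inter> \<Union>Q = {}" by blast
  then show ?case using insert by (simp add: mset_set_Union)
qed simp

lemma orbits_decomposition:
  assumes w: "w \<in> Sym n"
  shows "mset_set {1..n} = (\<Sum>q\<in>orbit w ` {1..n}. mset_set q)"
proof -
  have "\<Union>(orbit w ` {1..n}) = {1..n}"
    using orbits_Sym [OF w] by blast
  moreover have "mset_set (\<Union>(orbit w ` {1..n})) = (\<Sum>q\<in>orbit w ` {1..n}. mset_set q)"
  proof (rule mset_set_Union_disjoint)
    fix q r assume "q \<in> orbit w ` {1..n}" "r \<in> orbit w ` {1..n}" "q \<noteq> r"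
    then show "q \<inter> r = {}" using orbits_Sym(2) [OF w] by blast
  qed (auto simp: orbits_Sym(4) [OF w])
  ultimately show ?thesis by simp
qed

lemma image_mset_sum: "image_mset f (\<Sum>x\<in>S. A x) = (\<Sum>x\<in>S. image_mset f (A x))"
  by (induction S rule: infinite_finite_induct) auto

lemma image_mset_const_on:
  assumes "finite q" "\<And>y. y \<in> q \<Longrightarrow> u y = i"
  shows "image_mset u (mset_set q) = replicate_mset (card q) i"
proof -
  have "image_mset u (mset_set q) = image_mset (\<lambda>_. i) (mset_set q)"
    using assms by (intro image_mset_cong) auto
  then show ?thesis by (simp add: image_mset_const_eq)
qed

text \<open>A fixed word is constant on each cycle of \<open>w\<close>. Giving the letter i to a
  cycle of length d amounts to choosing the d-th power of the i-th variable in the factor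
  \<open>pow_sym d\<close>.\<close>

lemma mcoeff_pow_sym_part:
  assumes w: "w \<in> Sym n"
  shows "mcoeff (pow_sym_part (cycle_type n w) :: 'a::comm_ring_1 mfps) (mon M) =
    of_nat (card (fixed_words n M w))"
proof -
  define Q where "Q = orbit w ` {1..n}"
  define B where "B = (\<lambda>q :: nat set. range (\<lambda>i :: nat. Poly_Mapping.single i (card q)))"
  have fin: "finite q" if "q \<in> Q" for q using that orbits_Sym(4) [OF w] by (auto simp: Q_def)
  have orb: "orbit w x = q" if "q \<in> Q" "x \<in> q" for q x
    using that orbits_Sym(2) [OF w] by (auto simp: Q_def)
  have orbQ: "orbit w x \<in> Q" "x \<in> orbit w x" if "x \<in> {1..n}" for x
    using that orbits_Sym(1) [OF w] by (auto simp: Q_def)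
  have sub: "q \<subseteq> {1..n}" if "q \<in> Q" for q using that orbits_Sym(3) [OF w] unfolding Q_def by blast
  have cpos: "card q > 0" if "q \<in> Q" for q
    using fin [OF that] that orbits_Sym(1) [OF w] by (auto simp: Q_def card_gt_0_iff)
  define G where "G = (\<lambda>u. \<lambda>q\<in>Q. mon (image_mset u (mset_set q)))"
  have sumG: "(\<Sum>q\<in>Q. G u q) = mon (image_mset u (mset_set {1..n}))" for u
    unfolding orbits_decomposition [OF w] Q_def [symmetric] image_mset_sum mon_sum by (simp add: G_def)
  have G: "G u q = Poly_Mapping.single (u x) (card q)"
    if "u \<circ> w = u" "q \<in> Q" "x \<in> q" for u q x
  proof -
    have "image_mset u (mset_set q) = replicate_mset (card q) (u x)"
      using fixed_const_on_orbit [OF that(1)] orb [OF that(2,3)] fin [OF that(2)]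
      by (intro image_mset_const_on) auto
    then show ?thesis using that by (simp add: G_def)
  qed
  have "(pow_sym_part (cycle_type n w) :: 'a mfps) = (\<Prod>q\<in>Q. Abs_mfps (\<lambda>m. if m \<in> B q then 1 else 0))"
    unfolding pow_sym_part_def cycle_type_def Q_def [symmetric]
    by (simp add: pow_sym_def multiset.map_comp o_def prod_unfold_prod_mset B_def image_def)
  then have "mcoeff (pow_sym_part (cycle_type n w) :: 'a mfps) (mon M) =
      of_nat (card {f \<in> PiE Q B. (\<Sum>q\<in>Q. f q) = mon M})"
    by (simp add: mcoeff_prod_indicator Q_def)
  also have "bij_betw G (fixed_words n M w) {f \<in> PiE Q B. (\<Sum>q\<in>Q. f q) = mon M}"
    unfolding bij_betw_def
  proof (intro conjI equalityI subsetI)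
    show "inj_on G (fixed_words n M w)"
    proof (rule inj_onI, rule ext)
      fix u v x assume uv: "u \<in> fixed_words n M w" "v \<in> fixed_words n M w" "G u = G v"
      show "u x = v x"
      proof (cases "x \<in> {1..n}")
        case True
        have "Poly_Mapping.single (u x) (card (orbit w x)) = Poly_Mapping.single (v x) (card (orbit w x))"
          using uv G [OF _ orbQ(1) orbQ(2), of u x] G [OF _ orbQ(1) orbQ(2), of v x] True
          by (simp add: fixed_words_def)
        \<comment> \<open>Cycle lengths are positive, so the exponent vector still reveals the
          letter.\<close>
        from arg_cong [OF this, of Poly_Mapping.keys] show ?thesis
          using cpos [OF orbQ(1) [OF True]] by simp
      next
        case False
        then show ?thesis using uv by (auto simp: fixed_words_def words_def extensional_def)
      qed
    qed
  next
    fix f assume "f \<in> G ` fixed_words n M w"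
    then obtain u where u: "u \<in> fixed_words n M w" "f = G u" by auto
    have "G u q \<in> B q" if "q \<in> Q" for q
    proof -
      obtain x where "x \<in> q" using \<open>q \<in> Q\<close> orbits_Sym(1) [OF w] by (auto simp: Q_def)
      then show ?thesis using G [of u q x] u that by (auto simp: fixed_words_def B_def)
    qed
    then show "f \<in> {f \<in> PiE Q B. (\<Sum>q\<in>Q. f q) = mon M}"
      using u sumG [of u] by (auto simp: fixed_words_def words_def G_def)
  next
    fix f assume f: "f \<in> {f \<in> PiE Q B. (\<Sum>q\<in>Q. f q) = mon M}"
    then have "\<forall>q\<in>Q. \<exists>i. f q = Poly_Mapping.single i (card q)" by (auto simp: PiE_iff B_def)
    then obtain c where c: "\<And>q. q \<in> Q \<Longrightarrow> f q = Poly_Mapping.single (c q) (card q)" by metis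
    define u where "u = (\<lambda>x\<in>{1..n}. c (orbit w x))"
    have "orbit w (w x) = orbit w x" for x
      using orbits_Sym(2) [OF w, of "w x" x] by (simp add: orbit.base)
    then have uw: "u \<circ> w = u"
      unfolding u_def fun_eq_iff using Sym_in_iff [OF w] by (simp add: restrict_def)
    have Gu: "G u = f"
    proof
      fix q show "G u q = f q"
      proof (cases "q \<in> Q")
        case True
        then obtain x where "x \<in> q" using orbits_Sym(1) [OF w] by (auto simp: Q_def)
        then show ?thesis using G [OF uw True] c [OF True] sub [OF True] orb [OF True] by (auto simp: u_def)
      next
        case False then show ?thesis using f by (auto simp: G_def PiE_iff extensional_def)
      qed
    qed
    have "mon (image_mset u (mset_set {1..n})) = mon M" using sumG [of u] f Gu by simp
    then have "u \<in> fixed_words n M w" using uw by (auto simp: fixed_words_def words_def u_def)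
    with Gu show "f \<in> G ` fixed_words n M w" by blast
  qed
  then have "card {f \<in> PiE Q B. (\<Sum>q\<in>Q. f q) = mon M} = card (fixed_words n M w)"
    by (simp add: bij_betw_same_card)
  finally show ?thesis .
qed


section \<open>Linear independence of the complete homogeneous symmetric functions\<close>

lemma hom_sym_part_mtype:
  "(hom_sym_part (mtype K) :: 'a::comm_ring_1 mfps) = (\<Prod>j\<in>set_mset K. hom_sym (count K j))"
  by (simp add: hom_sym_part_def mtype_def multiset.map_comp o_def prod_unfold_prod_mset)

text \<open>A multiset of pairs is a matrix of natural numbers with finite support; here it is cut
  into its rows.\<close>

lemma mset_pairs_decomposition:
  "A = (\<Sum>j\<in>fst ` set_mset A. image_mset (Pair j) (image_mset snd (filter_mset (\<lambda>p. fst p = j) A)))"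
    (is "A = ?R")
proof (rule multiset_eqI)
  fix p :: "'a \<times> 'b"
  have *: "image_mset (Pair j) (image_mset snd (filter_mset (\<lambda>p. fst p = j) A)) =
      filter_mset (\<lambda>p. fst p = j) A" for j
  proof -
    have "image_mset (Pair j) (image_mset snd (filter_mset (\<lambda>p. fst p = j) A)) =
        image_mset (\<lambda>p. p) (filter_mset (\<lambda>p. fst p = j) A)"
      unfolding multiset.map_comp by (rule image_mset_cong) auto
    then show ?thesis by simp
  qed
  have "count ?R p = (\<Sum>j\<in>fst ` set_mset A. if fst p = j then count A p else 0)"
    unfolding * count_sum by (intro sum.cong) auto
  also have "\<dots> = count A p"
    by (auto simp: image_iff not_in_iff split: prod.splits)
  finally show "count A p = count ?R p" by simp
qed

text \<open>Choosing a monomial of degree \<open>count K j\<close> from each factor fills row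
  \<open>j\<close> of a matrix, so the coefficient counts the matrices with row sums
  \<open>K\<close> and column sums \<open>M\<close>, encoded as multisets of index pairs.\<close>

lemma mcoeff_hom_sym_part:
  "mcoeff (hom_sym_part (mtype K) :: 'a::comm_ring_1 mfps) (mon M) =
    of_nat (card {A. image_mset fst A = K \<and> image_mset snd A = M})"
proof -
  define S where "S = set_mset K"
  define B where "B = (\<lambda>j. mon ` {N. size N = count K j})"
  have "(\<Sum>i\<in>Poly_Mapping.keys m. Poly_Mapping.lookup m i) = k \<longleftrightarrow> m \<in> mon ` {N. size N = k}" for m k
  proof -
    obtain N where "m = mon N" using mon_surj by blast
    then show ?thesis by (auto simp: size_multiset_overloaded_eq)
  qed
  then have "(hom_sym_part (mtype K) :: 'a mfps) = (\<Prod>j\<in>S. Abs_mfps (\<lambda>m. if m \<in> B j then 1 else 0))"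
    unfolding hom_sym_part_mtype S_def B_def hom_sym_def by simp
  then have "mcoeff (hom_sym_part (mtype K) :: 'a mfps) (mon M) =
      of_nat (card {f \<in> PiE S B. (\<Sum>j\<in>S. f j) = mon M})"
    by (simp add: mcoeff_prod_indicator S_def)
  also have "card {f \<in> PiE S B. (\<Sum>j\<in>S. f j) = mon M} =
      card {A. image_mset fst A = K \<and> image_mset snd A = M}"
  proof -
    define row where "row = (\<lambda>(A :: (nat \<times> nat) multiset) j. image_mset snd (filter_mset (\<lambda>p. fst p = j) A))"
    define G where "G = (\<lambda>A. \<lambda>j\<in>S. mon (row A j))"
    have dec: "A = (\<Sum>j\<in>S. image_mset (Pair j) (row A j))" if "image_mset fst A = K" for A
      using mset_pairs_decomposition [of A] that by (auto simp: S_def row_def)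
    have "bij_betw G {A. image_mset fst A = K \<and> image_mset snd A = M} {f \<in> PiE S B. (\<Sum>j\<in>S. f j) = mon M}"
      unfolding bij_betw_def
    proof (intro conjI equalityI subsetI)
      show "inj_on G {A. image_mset fst A = K \<and> image_mset snd A = M}"
      proof (rule inj_onI)
        fix A A' assume A: "A \<in> {A. image_mset fst A = K \<and> image_mset snd A = M}"
          "A' \<in> {A. image_mset fst A = K \<and> image_mset snd A = M}" "G A = G A'"
        have "row A j = row A' j" if "j \<in> S" for j
          using fun_cong [OF A(3), of j] that by (simp add: G_def)
        then show "A = A'" using dec [of A] dec [of A'] A(1,2) by simp
      qed
    next
      fix f assume "f \<in> G ` {A. image_mset fst A = K \<and> image_mset snd A = M}"
      then obtain A where A: "image_mset fst A = K" "image_mset snd A = M" "f = G A" by auto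
      have "size (row A j) = count K j" for j
        unfolding A(1) [symmetric] row_def by (simp add: count_conv_size_mset filter_mset_image_mset)
      moreover have "(\<Sum>j\<in>S. row A j) = M"
        unfolding A(2) [symmetric] by (subst (2) dec [OF A(1)]) (simp add: image_mset_sum multiset.map_comp o_def)
      ultimately show "f \<in> {f \<in> PiE S B. (\<Sum>j\<in>S. f j) = mon M}"
        unfolding A(3) G_def B_def by (auto simp flip: mon_sum)
    next
      fix f assume f: "f \<in> {f \<in> PiE S B. (\<Sum>j\<in>S. f j) = mon M}"
      then have "\<forall>j\<in>S. \<exists>N. size N = count K j \<and> f j = mon N" by (auto simp: PiE_iff B_def)
      then obtain N where N: "\<And>j. j \<in> S \<Longrightarrow> size (N j) = count K j" "\<And>j. j \<in> S \<Longrightarrow> f j = mon (N j)"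
        by metis
      define A where "A = (\<Sum>j\<in>S. image_mset (Pair j) (N j))"
      have "finite S" by (simp add: S_def)
      have row: "row A i = N i" if "i \<in> S" for i
      proof -
        have "filter_mset (\<lambda>p. fst p = i) A = (\<Sum>j\<in>S. if i = j then image_mset (Pair j) (N j) else {#})"
          unfolding A_def using \<open>finite S\<close>
          by (induction S rule: finite_induct) (auto simp: filter_mset_image_mset)
        then show ?thesis using that \<open>finite S\<close> by (simp add: row_def multiset.map_comp o_def)
      qed
      have "image_mset fst A = (\<Sum>j\<in>S. replicate_mset (count K j) j)"
        using N(1) by (simp add: A_def image_mset_sum multiset.map_comp o_def image_mset_const_eq)
      also have "\<dots> = K"
        using \<open>finite S\<close> by (intro multiset_eqI) (auto simp: count_sum S_def not_in_iff)
      finally have 1: "image_mset fst A = K" .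
      have "mon (image_mset snd A) = mon M"
        using f N(2) by (simp add: A_def image_mset_sum multiset.map_comp o_def mon_sum)
      moreover have "G A = f" using f row N(2) by (auto simp: G_def fun_eq_iff PiE_iff extensional_def)
      ultimately show "f \<in> G ` {A. image_mset fst A = K \<and> image_mset snd A = M}" using 1 by auto
    qed
    then show ?thesis by (simp add: bij_betw_same_card)
  qed
  finally show ?thesis .
qed

lemma finite_mset_pairs_marginals: "finite {A. image_mset fst A = K \<and> image_mset snd A = M}"
proof (rule finite_subset)
  show "{A. image_mset fst A = K \<and> image_mset snd A = M} \<subseteq>
      {A. set_mset A \<subseteq> set_mset K \<times> set_mset M \<and> size A = size K}"
    by force
  show "finite {A. set_mset A \<subseteq> set_mset K \<times> set_mset M \<and> size A = size K}"
    by (rule finite_subset [of _ "mset ` {xs. set xs \<subseteq> set_mset K \<times> set_mset M \<and> length xs = size K}"])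
      (auto simp: image_iff finite_lists_length_eq intro: ex_mset, metis ex_mset set_mset_mset size_mset)
qed

lemma restrict_comp_Sym_eq_iff:
  assumes "w \<in> Sym n"
  shows "restrict g {1..n} \<circ> w = restrict g {1..n} \<longleftrightarrow> (\<forall>x\<in>{1..n}. g (w x) = g x)"
proof -
  have "(restrict g {1..n} \<circ> w) x = restrict g {1..n} x \<longleftrightarrow> (x \<in> {1..n} \<longrightarrow> g (w x) = g x)" for x
    using Sym_in_iff [OF assms, of x] by (auto simp: restrict_def)
  then show ?thesis unfolding fun_eq_iff by blast
qed

text \<open>Two words form one word in pairs. Its content is a matrix whose marginals are the two
  contents, and \<open>w\<close> fixes it if and only if it fixes both words.\<close>

lemma card_fixed_words_mult:
  "card (fixed_words n K w) * card (fixed_words n M w) =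
    (\<Sum>A | image_mset fst A = K \<and> image_mset snd A = M. card (fixed_words n A w))"
  if "w \<in> Sym n"
proof -
  let ?Z = "{A. image_mset fst A = K \<and> image_mset snd A = M}"
  let ?G = "\<lambda>p. (\<lambda>x\<in>{1..n}. fst (p x), \<lambda>x\<in>{1..n}. snd (p x))"
  let ?H = "\<lambda>(u, v). \<lambda>x\<in>{1..n}. (u x, v x)"
  note restr = restrict_comp_Sym_eq_iff [OF that]
  have ext: "(\<forall>x\<in>{1..n}. u (w x) = u x)" if "u \<circ> w = u" for u :: "nat \<Rightarrow> 'x"
    using that by (metis comp_apply)
  have cong: "image_mset (restrict g {1..n}) (mset_set {1..n}) = image_mset g (mset_set {1..n})" for g :: "nat \<Rightarrow> 'x"
    by (rule image_mset_cong) auto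
  have "(\<Sum>A\<in>?Z. card (fixed_words n A w)) = card (\<Union>A\<in>?Z. fixed_words n A w)"
    by (rule card_UN_disjoint [symmetric])
      (auto simp: finite_mset_pairs_marginals, auto simp: fixed_words_def words_def)
  also have "\<dots> = card (fixed_words n K w \<times> fixed_words n M w)"
  proof (rule bij_betw_same_card [OF bij_betw_byWitness [where f = ?G and f' = ?H]])
    show "\<forall>p\<in>\<Union>A\<in>?Z. fixed_words n A w. ?H (?G p) = p"
      by (auto simp: fixed_words_def words_def extensional_def fun_eq_iff)
    show "\<forall>q\<in>fixed_words n K w \<times> fixed_words n M w. ?G (?H q) = q"
      by (auto simp: fixed_words_def words_def extensional_def fun_eq_iff)
    show "?G ` (\<Union>A\<in>?Z. fixed_words n A w) \<subseteq> fixed_words n K w \<times> fixed_words n M w"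
    proof (rule image_subsetI)
      fix p assume "p \<in> (\<Union>A\<in>?Z. fixed_words n A w)"
      then obtain A where A: "A \<in> ?Z" "p \<in> fixed_words n A w" by auto
      have pw: "\<forall>x\<in>{1..n}. p (w x) = p x" using A ext by (auto simp: fixed_words_def)
      have im: "image_mset p (mset_set {1..n}) = A" using A by (simp add: fixed_words_def words_def)
      have "image_mset (\<lambda>x. fst (p x)) (mset_set {1..n}) = K"
        "image_mset (\<lambda>x. snd (p x)) (mset_set {1..n}) = M"
        using A(1) im by (auto simp: multiset.map_comp o_def)
      with pw show "?G p \<in> fixed_words n K w \<times> fixed_words n M w"
        by (simp only: fixed_words_def words_def mem_Collect_eq mem_Times_iff fst_conv snd_conv restr cong
            restrict_extensional) simp
    qed
    show "?H ` (fixed_words n K w \<times> fixed_words n M w) \<subseteq> (\<Union>A\<in>?Z. fixed_words n A w)"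
    proof (rule image_subsetI)
      fix q assume "q \<in> fixed_words n K w \<times> fixed_words n M w"
      then obtain u v where q: "q = (u, v)" "u \<in> fixed_words n K w" "v \<in> fixed_words n M w" by auto
      define A where "A = image_mset (\<lambda>x. (u x, v x)) (mset_set {1..n})"
      have "\<forall>x\<in>{1..n}. u (w x) = u x" "\<forall>x\<in>{1..n}. v (w x) = v x"
        using q ext by (auto simp: fixed_words_def)
      then have "?H q \<in> fixed_words n A w"
        unfolding q(1) by (simp only: fixed_words_def words_def mem_Collect_eq restr cong
            restrict_extensional prod.case A_def) simp
      moreover have "A \<in> ?Z" using q by (simp add: A_def multiset.map_comp o_def fixed_words_def words_def)
      ultimately show "?H q \<in> (\<Union>A\<in>?Z. fixed_words n A w)" by blast
    qed
  qed
  finally show ?thesis by (simp add: card_cartesian_product)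
qed


text \<open>The products of word counts become counts of words in pairs, and
  \<open>sum_card_fixed_words\<close> contributes \<open>fact n\<close> for each matrix.\<close>

lemma hom_sym_gram:
  assumes "size K = n"
  shows "fact n * mcoeff (hom_sym_part (mtype K) :: 'a::{comm_ring_1,ring_char_0} mfps) (mon M) =
    of_nat (\<Sum>w\<in>Sym n. card (fixed_words n K w) * card (fixed_words n M w))"
proof -
  let ?Z = "{A. image_mset fst A = K \<and> image_mset snd A = M}"
  have "(\<Sum>w\<in>Sym n. card (fixed_words n K w) * card (fixed_words n M w)) =
      (\<Sum>w\<in>Sym n. \<Sum>A\<in>?Z. card (fixed_words n A w))"
    by (intro sum.cong refl card_fixed_words_mult)
  also have "\<dots> = (\<Sum>A\<in>?Z. \<Sum>w\<in>Sym n. card (fixed_words n A w))"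
    by (rule sum.swap)
  also have "\<dots> = (\<Sum>A\<in>?Z. fact n)"
    using assms by (intro sum.cong refl sum_card_fixed_words) auto
  finally show ?thesis by (simp add: mcoeff_hom_sym_part mult.commute)
qed

lemma mcoeff_hom_sym_part_eq_0:
  assumes "size K \<noteq> size M"
  shows "mcoeff (hom_sym_part (mtype K) :: 'a::comm_ring_1 mfps) (mon M) = 0"
proof -
  have "{A. image_mset fst A = K \<and> image_mset snd A = M} = {}"
    using assms by (metis (mono_tags, lifting) Collect_empty_eq size_image_mset)
  then show ?thesis by (simp only: mcoeff_hom_sym_part card.empty of_nat_0)
qed

text \<open>When distinct cycles carry distinct letters, each letter occurs as often as its cycle is
  long.\<close>

lemma mtype_fixed_word_inj:
  assumes w: "w \<in> Sym n" and u: "u \<in> fixed_words n K w"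
    and \<phi>: "\<And>x. x \<in> {1..n} \<Longrightarrow> \<phi> (orbit w x) = u x" and inj: "inj_on \<phi> (orbit w ` {1..n})"
  shows "mtype K = cycle_type n w"
proof -
  define Q where "Q = orbit w ` {1..n}"
  have fin: "finite Q" by (simp add: Q_def)
  have "image_mset u (mset_set q) = replicate_mset (card q) (\<phi> q)" if "q \<in> Q" for q
  proof (rule image_mset_const_on)
    fix y assume "y \<in> q"
    with that have "y \<in> {1..n}" "orbit w y = q"
      using orbits_Sym(2,3) [OF w] unfolding Q_def by blast+
    then show "u y = \<phi> q" using \<phi> by auto
  qed (use that orbits_Sym(4) [OF w] in \<open>auto simp: Q_def\<close>)
  then have "K = (\<Sum>q\<in>Q. replicate_mset (card q) (\<phi> q))"
    using u unfolding fixed_words_def words_def orbits_decomposition [OF w] image_mset_sum Q_def by auto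
  then have cnt: "count K j = (\<Sum>q\<in>Q. if j = \<phi> q then card q else 0)" for j
    by (simp add: count_sum)
  have cnt': "count K (\<phi> q) = card q" if "q \<in> Q" for q
  proof -
    have "count K (\<phi> q) = (\<Sum>r\<in>Q. if r = q then card r else 0)"
      unfolding cnt using inj that by (intro sum.cong) (auto simp: Q_def inj_on_def)
    then show ?thesis using that fin by simp
  qed
  have "set_mset K = \<phi> ` Q"
    using set_mset_words [of u n K] u \<phi>
    by (simp add: fixed_words_def Q_def image_image del: atLeastAtMost_iff cong: image_cong)
  then have "mtype K = image_mset (count K) (image_mset \<phi> (mset_set Q))"
    using inj by (simp add: mtype_def image_mset_mset_set Q_def)
  also have "\<dots> = image_mset card (mset_set Q)"
    unfolding multiset.map_comp using fin cnt' by (intro image_mset_cong) auto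
  finally show ?thesis by (simp add: cycle_type_def Q_def)
qed

text \<open>A word that is constant on cycles has at most as many distinct letters as there are
  cycles, and in the case of equality the letters separate the cycles. This is the triangularity
  behind linear independence.\<close>

lemma fixed_words_coarser:
  assumes w: "w \<in> Sym n" and u: "u \<in> fixed_words n K w"
  shows "mtype K = cycle_type n w \<or> size (mtype K) < size (cycle_type n w)"
proof -
  define Q where "Q = orbit w ` {1..n}"
  define \<phi> where "\<phi> = (\<lambda>q. u (SOME x. x \<in> q))"
  have \<phi>: "\<phi> (orbit w x) = u x" for x
  proof -
    have "(SOME y. y \<in> orbit w x) \<in> orbit w x"
      by (rule someI [of _ x]) (rule orbits_Sym(1) [OF w])
    then show ?thesis using fixed_const_on_orbit [of u w _ x] u by (simp add: \<phi>_def fixed_words_def)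
  qed
  have "set_mset K = \<phi> ` Q"
    using set_mset_words [of u n K] u \<phi>
    by (simp add: fixed_words_def Q_def image_image del: atLeastAtMost_iff cong: image_cong)
  then have "card (set_mset K) \<le> card Q" "card (set_mset K) = card Q \<Longrightarrow> inj_on \<phi> Q"
    by (auto simp: Q_def card_image_le eq_card_imp_inj_on)
  moreover have "size (mtype K) = card (set_mset K)" "size (cycle_type n w) = card Q"
    by (simp_all add: mtype_def cycle_type_def Q_def)
  ultimately show ?thesis
    using mtype_fixed_word_inj [OF w u, of \<phi>] \<phi> unfolding Q_def by fastforce
qed

text \<open>Writing at every position the least point of its cycle separates the cycles. This
  supplies the nonzero diagonal entries, and it shows that every partition is an
  \<open>mtype\<close> and a cycle type.\<close>

lemma fixed_word_of_type_exists:
  assumes "partition_of n \<nu>"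
  obtains w K where "w \<in> Sym n" "cycle_type n w = \<nu>" "mtype K = \<nu>" "fixed_words n K w \<noteq> {}"
proof -
  obtain w where w: "w \<in> Sym n" "cycle_type n w = \<nu>"
    using assms cycle_labelling_exists unfolding conj_class_def by blast
  define u where "u = (\<lambda>x\<in>{1..n}. Min (orbit w x))"
  define K where "K = image_mset u (mset_set {1..n})"
  have "orbit w (w x) = orbit w x" for x
    using orbits_Sym(2) [OF w(1), of "w x" x] by (simp add: orbit.base)
  then have u: "u \<in> fixed_words n K w"
    unfolding u_def fixed_words_def words_def K_def
    by (simp add: restrict_comp_Sym_eq_iff [OF w(1), simplified])
  have "mtype K = cycle_type n w"
  proof (rule mtype_fixed_word_inj [OF w(1) u, where \<phi> = Min])
    show "inj_on Min (orbit w ` {1..n})"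
    proof (rule inj_onI)
      fix q r assume *: "q \<in> orbit w ` {1..n}" "r \<in> orbit w ` {1..n}" "Min q = Min r"
      have "Min q \<in> q" if "q \<in> orbit w ` {1..n}" for q
        using that orbits_Sym(1,4) [OF w(1)] by (metis Min_in empty_iff imageE)
      then have "Min q \<in> q" "Min r \<in> r" using * by blast+
      with * show "q = r" using orbits_Sym(2) [OF w(1)] by (metis imageE)
    qed
  qed (simp add: u_def)
  with w u that show thesis by blast
qed

text \<open>Shaped after the uniqueness that \<open>basis_coeff\<close> demands: finite support and
  no zero parts.\<close>

definition partition_independent :: "(nat multiset \<Rightarrow> 'a::comm_ring_1 mfps) \<Rightarrow> bool" where
  "partition_independent B \<longleftrightarrow> (\<forall>S c. finite S \<and> (\<forall>\<nu>\<in>S. 0 \<notin># \<nu>) \<and> (\<Sum>\<nu>\<in>S. msmult (c \<nu>) (B \<nu>)) = 0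
     \<longrightarrow> (\<forall>\<nu>\<in>S. c \<nu> = 0))"

text \<open>The coefficients of the \<open>h\<^sub>\<nu>\<close> form the Gram matrix of the functions
  \<open>w \<mapsto> card (fixed_words n K w)\<close> on \<open>S\<^sub>n\<close>, which are triangular with respect to cycle types.\<close>

lemma partition_independent_hom_sym_part:
  "partition_independent (hom_sym_part :: nat multiset \<Rightarrow> complex mfps)"
  unfolding partition_independent_def
proof (intro allI impI, elim conjE, rule ccontr)
  fix S and c :: "nat multiset \<Rightarrow> complex"
  assume S: "finite S" "\<forall>\<nu>\<in>S. 0 \<notin># \<nu>" and zero: "(\<Sum>\<nu>\<in>S. msmult (c \<nu>) (hom_sym_part \<nu>)) = 0"
    and "\<not> (\<forall>\<nu>\<in>S. c \<nu> = 0)"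
  then obtain \<nu>0 where \<nu>0: "\<nu>0 \<in> S" "c \<nu>0 \<noteq> 0" by blast
  \<comment> \<open>A single degree is examined: complete functions of other degrees have
    coefficient 0 at monomials of degree \<open>n\<close>.\<close>
  define n where "n = sum_mset \<nu>0"
  define T where "T = {\<nu> \<in> S. c \<nu> \<noteq> 0 \<and> sum_mset \<nu> = n}"
  have "finite T" "T \<noteq> {}" using S \<nu>0 by (auto simp: T_def n_def)
  have "\<exists>w K. w \<in> Sym (sum_mset \<nu>) \<and> cycle_type (sum_mset \<nu>) w = \<nu> \<and> mtype K = \<nu> \<and> fixed_words (sum_mset \<nu>) K w \<noteq> {}"
    if "\<nu> \<in> S" for \<nu>
    using fixed_word_of_type_exists [of "sum_mset \<nu>" \<nu>] S that by (metis partition_of_def)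
  then obtain w K where wK: "\<And>\<nu>. \<nu> \<in> S \<Longrightarrow> w \<nu> \<in> Sym (sum_mset \<nu>) \<and> cycle_type (sum_mset \<nu>) (w \<nu>) = \<nu> \<and>
      mtype (K \<nu>) = \<nu> \<and> fixed_words (sum_mset \<nu>) (K \<nu>) (w \<nu>) \<noteq> {}"
    by metis
  have sizeK: "size (K \<nu>) = sum_mset \<nu>" if "\<nu> \<in> S" for \<nu>
    using wK [OF that] by (metis sum_mset_mtype)
  define f where "f = (\<lambda>\<nu> v. complex_of_nat (card (fixed_words n (K \<nu>) v)))"
  \<comment> \<open>The linear relation makes \<open>y\<close> orthogonal to every
    \<open>f \<kappa>\<close>, hence to itself, and over the complex numbers this forces
    \<open>y\<close> to vanish.\<close>
  define y where "y = (\<lambda>v. \<Sum>\<nu>\<in>T. c \<nu> * f \<nu> v)"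
  have orth: "(\<Sum>\<nu>\<in>T. c \<nu> * (\<Sum>v\<in>Sym n. f \<nu> v * f \<kappa> v)) = 0" if "\<kappa> \<in> T" for \<kappa>
  proof -
    have "0 = mcoeff (\<Sum>\<nu>\<in>S. msmult (c \<nu>) (hom_sym_part \<nu>)) (mon (K \<kappa>))"
      unfolding zero by simp
    also have "\<dots> = (\<Sum>\<nu>\<in>S. c \<nu> * mcoeff (hom_sym_part \<nu>) (mon (K \<kappa>)))"
      by simp
    also have "\<dots> = (\<Sum>\<nu>\<in>T. c \<nu> * mcoeff (hom_sym_part \<nu>) (mon (K \<kappa>)))"
    proof (rule sum.mono_neutral_right)
      show "\<forall>\<nu>\<in>S - T. c \<nu> * mcoeff (hom_sym_part \<nu>) (mon (K \<kappa>)) = 0"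
      proof
        fix \<nu> assume \<nu>: "\<nu> \<in> S - T"
        show "c \<nu> * mcoeff (hom_sym_part \<nu>) (mon (K \<kappa>)) = 0"
        proof (cases "c \<nu> = 0")
          case False
          then have "size (K \<nu>) \<noteq> size (K \<kappa>)" using \<nu> that sizeK by (auto simp: T_def)
          from mcoeff_hom_sym_part_eq_0 [OF this, where 'a = complex] show ?thesis using \<nu> wK by simp
        qed simp
      qed
    qed (use S in \<open>auto simp: T_def\<close>)
    finally have zero': "fact n * (\<Sum>\<nu>\<in>T. c \<nu> * mcoeff (hom_sym_part \<nu>) (mon (K \<kappa>))) = 0" by simp
    have gram: "fact n * mcoeff (hom_sym_part \<nu>) (mon (K \<kappa>)) = (\<Sum>v\<in>Sym n. f \<nu> v * f \<kappa> v)"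
      if "\<nu> \<in> T" for \<nu>
    proof -
      have \<nu>: "\<nu> \<in> S" "size (K \<nu>) = n" using sizeK that by (auto simp: T_def)
      show ?thesis using hom_sym_gram [OF \<nu>(2), of "K \<kappa>", where 'a = complex] wK [OF \<nu>(1)]
        by (simp add: f_def)
    qed
    have "(\<Sum>\<nu>\<in>T. c \<nu> * (\<Sum>v\<in>Sym n. f \<nu> v * f \<kappa> v)) =
        (\<Sum>\<nu>\<in>T. c \<nu> * (fact n * mcoeff (hom_sym_part \<nu>) (mon (K \<kappa>))))"
      by (intro sum.cong refl) (simp only: gram)
    also have "\<dots> = fact n * (\<Sum>\<nu>\<in>T. c \<nu> * mcoeff (hom_sym_part \<nu>) (mon (K \<kappa>)))"
      by (simp add: sum_distrib_left mult.left_commute)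
    finally show ?thesis using zero' by simp
  qed
  have "(\<Sum>v\<in>Sym n. y v * cnj (y v)) = (\<Sum>v\<in>Sym n. \<Sum>\<kappa>\<in>T. cnj (c \<kappa>) * (\<Sum>\<nu>\<in>T. c \<nu> * (f \<nu> v * f \<kappa> v)))"
    unfolding y_def by (intro sum.cong refl)
      (simp add: sum_distrib_left sum_distrib_right cnj_sum f_def mult_ac)
  also have "\<dots> = (\<Sum>\<kappa>\<in>T. cnj (c \<kappa>) * (\<Sum>\<nu>\<in>T. c \<nu> * (\<Sum>v\<in>Sym n. f \<nu> v * f \<kappa> v)))"
    unfolding sum_distrib_left by (subst sum.swap, intro sum.cong refl, subst sum.swap) simp
  also have "\<dots> = 0" using orth by simp
  finally have "(\<Sum>v\<in>Sym n. y v * cnj (y v)) = 0" .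
  moreover have "(\<Sum>v\<in>Sym n. y v * cnj (y v)) = complex_of_real (\<Sum>v\<in>Sym n. (cmod (y v))\<^sup>2)"
    by (simp only: of_real_sum complex_norm_square)
  ultimately have "(\<Sum>v\<in>Sym n. (cmod (y v))\<^sup>2) = 0" using of_real_eq_0_iff by metis
  then have y0: "y v = 0" if "v \<in> Sym n" for v
    using that by (simp add: sum_nonneg_eq_0_iff)
  \<comment> \<open>With the fewest parts, \<open>\<kappa>\<close> is the only index in
    \<open>T\<close> whose word count survives at \<open>w \<kappa>\<close>: by
    \<open>fixed_words_coarser\<close> any other one would have fewer parts.\<close>
  obtain \<kappa> where \<kappa>: "\<kappa> \<in> T" "\<And>\<nu>. \<nu> \<in> T \<Longrightarrow> size \<kappa> \<le> size \<nu>"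
    using ex_has_least_nat [of "\<lambda>\<nu>. \<nu> \<in> T" _ size] \<open>T \<noteq> {}\<close> by blast
  have \<kappa>': "\<kappa> \<in> S" "sum_mset \<kappa> = n" "c \<kappa> \<noteq> 0" using \<kappa> by (auto simp: T_def)
  have "f \<nu> (w \<kappa>) = 0" if "\<nu> \<in> T" "\<nu> \<noteq> \<kappa>" for \<nu>
  proof -
    have "fixed_words n (K \<nu>) (w \<kappa>) = {}"
    proof (rule ccontr)
      assume "fixed_words n (K \<nu>) (w \<kappa>) \<noteq> {}"
      then have "\<nu> = \<kappa> \<or> size \<nu> < size \<kappa>"
        using fixed_words_coarser [of "w \<kappa>" n _ "K \<nu>"] wK [OF \<kappa>'(1)] wK [of \<nu>] \<kappa>'(2) that
        by (auto simp: T_def)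
      with \<kappa>(2) [OF that(1)] that(2) show False by simp
    qed
    then show ?thesis by (simp add: f_def)
  qed
  then have "y (w \<kappa>) = c \<kappa> * f \<kappa> (w \<kappa>)"
    unfolding y_def using \<open>finite T\<close> \<kappa>(1) by (subst sum.remove [of _ \<kappa>]) (auto intro!: sum.neutral)
  moreover have "f \<kappa> (w \<kappa>) \<noteq> 0" "w \<kappa> \<in> Sym n"
    using wK [OF \<kappa>'(1)] \<kappa>'(2) by (auto simp: f_def)
  ultimately show False using y0 \<kappa>'(3) by simp
qed


section \<open>The Hall inner product with a symmetric function\<close>

text \<open>Every monomial occurs in exactly one \<open>mono_sym_part\<close>, so its coefficient
  isolates one \<open>c \<nu>\<close>.\<close>

lemma partition_independent_mono_sym_part:
  "partition_independent (mono_sym_part :: nat multiset \<Rightarrow> 'a::comm_ring_1 mfps)"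
  unfolding partition_independent_def
proof (intro allI impI ballI, elim conjE)
  fix S \<nu> and c :: "nat multiset \<Rightarrow> 'a"
  assume S: "finite S" "\<forall>\<nu>\<in>S. 0 \<notin># \<nu>" "(\<Sum>\<nu>\<in>S. msmult (c \<nu>) (mono_sym_part \<nu>)) = 0" and \<nu>: "\<nu> \<in> S"
  obtain K where K: "mtype K = \<nu>"
    using fixed_word_of_type_exists [of "sum_mset \<nu>" \<nu>] S(2) \<nu> unfolding partition_of_def by metis
  have "0 = mcoeff (\<Sum>\<nu>\<in>S. msmult (c \<nu>) (mono_sym_part \<nu>)) (mon K)"
    unfolding S(3) by simp
  also have "\<dots> = (\<Sum>\<kappa>\<in>S. if \<nu> = \<kappa> then c \<kappa> else 0)"
    by (simp add: mcoeff_mono_sym_part K if_distrib cong: if_cong)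
  finally show "c \<nu> = 0" using S(1) \<nu> by simp
qed

text \<open>Subtracting two expansions over the union of their supports discharges the definite
  description.\<close>

lemma basis_coeff_eqI:
  assumes B: "partition_independent B"
    and c: "finite {\<nu>. c \<nu> \<noteq> 0}" "\<And>\<nu>. c \<nu> \<noteq> 0 \<Longrightarrow> 0 \<notin># \<nu>"
    and f: "f = (\<Sum>\<nu> | c \<nu> \<noteq> 0. msmult (c \<nu>) (B \<nu>))"
  shows "basis_coeff B f = c"
  unfolding basis_coeff_def
proof (rule the_equality)
  fix d assume d: "finite {\<nu>. d \<nu> \<noteq> 0} \<and> (\<forall>\<nu>. d \<nu> \<noteq> 0 \<longrightarrow> 0 \<notin># \<nu>) \<and>
    f = (\<Sum>\<nu> | d \<nu> \<noteq> 0. msmult (d \<nu>) (B \<nu>))"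
  define S where "S = {\<nu>. c \<nu> \<noteq> 0} \<union> {\<nu>. d \<nu> \<noteq> 0}"
  have fin: "finite S" using c d by (simp add: S_def)
  have "f = (\<Sum>\<nu>\<in>S. msmult (c \<nu>) (B \<nu>))"
    unfolding f using fin by (intro sum.mono_neutral_left) (auto simp: S_def)
  moreover have "f = (\<Sum>\<nu>\<in>S. msmult (d \<nu>) (B \<nu>))"
    using d fin by (auto simp: S_def intro!: sum.mono_neutral_left)
  moreover have "msmult (d \<nu> - c \<nu>) (B \<nu>) = msmult (d \<nu>) (B \<nu>) - msmult (c \<nu>) (B \<nu>)" for \<nu>
    by (rule mfps_eqI) (simp add: minus_mfps_def left_diff_distrib)
  ultimately have "(\<Sum>\<nu>\<in>S. msmult (d \<nu> - c \<nu>) (B \<nu>)) = 0"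
    by (simp add: sum_subtractf)
  moreover have "\<forall>\<nu>\<in>S. 0 \<notin># \<nu>" using c(2) d by (auto simp: S_def)
  ultimately have *: "\<forall>\<nu>\<in>S. d \<nu> - c \<nu> = 0"
    using B [unfolded partition_independent_def, rule_format, of S "\<lambda>\<nu>. d \<nu> - c \<nu>"] fin by blast
  show "d = c"
  proof
    fix \<nu> show "d \<nu> = c \<nu>"
      using bspec [OF *, of \<nu>] by (cases "\<nu> \<in> S") (simp_all add: S_def)
  qed
qed (use c f in auto)

text \<open>Different indices may share a partition and their coefficients may cancel, so they are
  first collected into \<open>c\<close>, the function that \<open>basis_coeff\<close>
  returns.\<close>

lemma hall_sum_hom_sym_part:
  fixes g :: "complex mfps"
  assumes fin: "finite T" and \<nu>: "\<And>I. I \<in> T \<Longrightarrow> 0 \<notin># \<nu> I"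
  shows "hall (\<Sum>I\<in>T. msmult (s I) (hom_sym_part (\<nu> I))) g =
    (\<Sum>I\<in>T. s I * basis_coeff mono_sym_part g (\<nu> I))"
proof -
  define c where "c = (\<lambda>\<kappa>. \<Sum>I\<in>{I \<in> T. \<nu> I = \<kappa>}. s I)"
  have sub: "{\<kappa>. c \<kappa> \<noteq> 0} \<subseteq> \<nu> ` T"
    unfolding c_def by (auto intro: sum.neutral)
  \<comment> \<open>Regrouping by partition, for arbitrary \<open>F\<close> because it is applied to
    series and to complex numbers.\<close>
  have *: "(\<Sum>I\<in>T. F I (\<nu> I)) = (\<Sum>\<kappa> | c \<kappa> \<noteq> 0. \<Sum>I\<in>{I \<in> T. \<nu> I = \<kappa>}. F I \<kappa>)"
    if "\<And>\<kappa>. c \<kappa> = 0 \<Longrightarrow> (\<Sum>I\<in>{I \<in> T. \<nu> I = \<kappa>}. F I \<kappa>) = 0" for F :: "'a \<Rightarrow> nat multiset \<Rightarrow> 'x::comm_monoid_add"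
  proof -
    have "(\<Sum>I\<in>T. F I (\<nu> I)) = (\<Sum>\<kappa>\<in>\<nu> ` T. \<Sum>I\<in>{I \<in> T. \<nu> I = \<kappa>}. F I (\<nu> I))"
      by (rule sum.image_gen [OF fin])
    also have "\<dots> = (\<Sum>\<kappa>\<in>\<nu> ` T. \<Sum>I\<in>{I \<in> T. \<nu> I = \<kappa>}. F I \<kappa>)"
      by (intro sum.cong refl) auto
    also have "\<dots> = (\<Sum>\<kappa> | c \<kappa> \<noteq> 0. \<Sum>I\<in>{I \<in> T. \<nu> I = \<kappa>}. F I \<kappa>)"
      using sub fin that by (intro sum.mono_neutral_right) auto
    finally show ?thesis .
  qed
  have "basis_coeff hom_sym_part (\<Sum>I\<in>T. msmult (s I) (hom_sym_part (\<nu> I))) = c"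
  proof (rule basis_coeff_eqI [OF partition_independent_hom_sym_part])
    show "finite {\<nu>. c \<nu> \<noteq> 0}" using finite_subset [OF sub] fin by blast
    show "\<And>\<kappa>. c \<kappa> \<noteq> 0 \<Longrightarrow> 0 \<notin># \<kappa>" using sub \<nu> by blast
    show "(\<Sum>I\<in>T. msmult (s I) (hom_sym_part (\<nu> I))) = (\<Sum>\<nu> | c \<nu> \<noteq> 0. msmult (c \<nu>) (hom_sym_part \<nu>))"
      by (subst *) (simp_all add: c_def flip: msmult_sum_left)
  qed
  then have "hall (\<Sum>I\<in>T. msmult (s I) (hom_sym_part (\<nu> I))) g =
      (\<Sum>\<kappa> | c \<kappa> \<noteq> 0. c \<kappa> * basis_coeff mono_sym_part g \<kappa>)"
    by (simp add: hall_def)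
  also have "\<dots> = (\<Sum>I\<in>T. s I * basis_coeff mono_sym_part g (\<nu> I))"
    by (subst *) (simp_all add: c_def flip: sum_distrib_right)
  finally show ?thesis .
qed

text \<open>Symmetry makes a coefficient depend on the type alone, and homogeneity leaves only
  partitions of \<open>n\<close>, hence a finite support.\<close>

lemma basis_coeff_mono_sym_part:
  fixes g :: "'a::comm_ring_1 mfps"
  assumes sym: "\<And>M N. mtype M = mtype N \<Longrightarrow> mcoeff g (mon M) = mcoeff g (mon N)"
    and hom: "\<And>M. size M \<noteq> n \<Longrightarrow> mcoeff g (mon M) = 0"
  shows "basis_coeff mono_sym_part g (mtype M) = mcoeff g (mon M)"
proof -
  define c where "c = (\<lambda>\<nu>. if \<nu> \<in> range mtype then mcoeff g (mon (SOME M. mtype M = \<nu>)) else 0)"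
  have c: "c (mtype M) = mcoeff g (mon M)" for M
  proof -
    have "mtype (SOME N. mtype N = mtype M) = mtype M" by (rule someI) (rule refl)
    from sym [OF this] show ?thesis by (simp add: c_def)
  qed
  \<comment> \<open>Finiteness is borrowed from \<open>Sym n\<close>, since every partition of
    \<open>n\<close> is a cycle type.\<close>
  have nz: "0 \<notin># \<nu> \<and> \<nu> \<in> cycle_type n ` Sym n" if "c \<nu> \<noteq> 0" for \<nu>
  proof -
    obtain M where M: "\<nu> = mtype M" using \<open>c \<nu> \<noteq> 0\<close> by (auto simp: c_def split: if_splits)
    then have "size M = n" using that c hom by metis
    then have "partition_of n \<nu>" by (simp add: M partition_of_def)
    then show ?thesis using fixed_word_of_type_exists [of n \<nu>] M by (metis imageI zero_notin_mtype)
  qed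
  have fin: "finite {\<nu>. c \<nu> \<noteq> 0}"
    by (rule finite_subset [of _ "cycle_type n ` Sym n"]) (use nz in auto)
  have "basis_coeff mono_sym_part g = c"
  proof (rule basis_coeff_eqI [OF partition_independent_mono_sym_part fin])
    show "g = (\<Sum>\<nu> | c \<nu> \<noteq> 0. msmult (c \<nu>) (mono_sym_part \<nu>))"
    proof (rule mfps_eqI)
      fix m
      obtain M where M: "m = mon M" using mon_surj by blast
      have "mcoeff (\<Sum>\<nu> | c \<nu> \<noteq> 0. msmult (c \<nu>) (mono_sym_part \<nu>)) m =
          (\<Sum>\<nu> | c \<nu> \<noteq> 0. if mtype M = \<nu> then c \<nu> else 0)"
        by (simp add: M mcoeff_mono_sym_part if_distrib cong: if_cong)
      also have "\<dots> = c (mtype M)" using fin by simp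
      finally show "mcoeff g m = mcoeff (\<Sum>\<nu> | c \<nu> \<noteq> 0. msmult (c \<nu>) (mono_sym_part \<nu>)) m"
        by (simp add: c M)
    qed
  qed (use nz in auto)
  then show ?thesis using c by simp
qed

lemma image_mset_eq_implies_bij_betw:
  assumes "finite A" "finite B" "image_mset f (mset_set A) = image_mset g (mset_set B)"
  obtains \<phi> where "bij_betw \<phi> A B" "\<And>x. x \<in> A \<Longrightarrow> f x = g (\<phi> x)"
proof -
  have "card A = card B" using assms(3) by (metis size_image_mset size_mset_set)
  then obtain e where e: "bij_betw e A B" using assms finite_same_card_bij by blast
  have "image_mset (g \<circ> e) (mset_set A) = image_mset g (image_mset e (mset_set A))"
    by (simp add: multiset.map_comp)
  also have "image_mset e (mset_set A) = mset_set B"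
    using e by (simp add: image_mset_mset_set bij_betw_def)
  finally have "image_mset f (mset_set A) = image_mset (g \<circ> e) (mset_set A)" using assms(3) by (simp only:)
  then obtain p where p: "p permutes A" "\<forall>x\<in>A. f x = (g \<circ> e) (p x)"
    using image_mset_eq_implies_permutes [OF assms(1)] by blast
  have "bij_betw (e \<circ> p) A B" using e p(1) by (meson bij_betw_trans permutes_imp_bij)
  with p(2) that show thesis by auto
qed

text \<open>Renaming letters by a bijection that preserves multiplicities preserves invariance under
  \<open>w\<close>. This is what makes Frobenius characteristics symmetric.\<close>

lemma card_fixed_words_cong_mtype:
  assumes w: "w \<in> Sym n" and MN: "mtype M = mtype N"
  shows "card (fixed_words n M w) = card (fixed_words n N w)"
proof -
  have le: "card (fixed_words n M w) \<le> card (fixed_words n N w)" if MN: "mtype M = mtype N" for M N :: "nat multiset"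
  proof -
    obtain \<phi> where \<phi>: "bij_betw \<phi> (set_mset M) (set_mset N)" "\<And>x. x \<in> set_mset M \<Longrightarrow> count M x = count N (\<phi> x)"
      using MN image_mset_eq_implies_bij_betw [of "set_mset M" "set_mset N" "count M" "count N"]
      unfolding mtype_def by blast
    have NM: "image_mset \<phi> M = N"
    proof (rule multiset_eqI)
      fix j
      show "count (image_mset \<phi> M) j = count N j"
      proof (cases "j \<in># N")
        case True
        then obtain i where i: "i \<in># M" "j = \<phi> i" using \<phi>(1) by (auto simp: bij_betw_def)
        then have "\<phi> -` {j} \<inter> set_mset M = {i}" using \<phi>(1) by (auto simp: bij_betw_def inj_on_def)
        then show ?thesis using i \<phi>(2) by (simp add: count_image_mset)
      next
        case False
        then have "j \<notin># image_mset \<phi> M" using \<phi>(1) by (auto simp: bij_betw_def)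
        with False show ?thesis by (metis not_in_iff)
      qed
    qed
    have set: "u x \<in># M" if "u \<in> words n M" "x \<in> {1..n}" for u x
      using set_mset_words [OF that(1)] that(2) by blast
    define F where "F = (\<lambda>u. \<lambda>x\<in>{1..n}. \<phi> (u x))"
    show ?thesis
    proof (rule card_inj_on_le [of F])
      show "inj_on F (fixed_words n M w)"
      proof (rule inj_onI, rule ext)
        fix u v x assume uv: "u \<in> fixed_words n M w" "v \<in> fixed_words n M w" "F u = F v"
        show "u x = v x"
        proof (cases "x \<in> {1..n}")
          case True
          then have "\<phi> (u x) = \<phi> (v x)" using fun_cong [OF uv(3), of x] by (simp add: F_def)
          then show ?thesis
            using \<phi>(1) set uv True unfolding fixed_words_def bij_betw_def inj_on_def by blast
        next
          case False
          then show ?thesis using uv by (auto simp: fixed_words_def words_def extensional_def)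
        qed
      qed
      show "F ` fixed_words n M w \<subseteq> fixed_words n N w"
      proof (rule image_subsetI)
        fix u assume u: "u \<in> fixed_words n M w"
        then have uw: "u (w x) = u x" for x by (metis (mono_tags, lifting) comp_apply fixed_words_def mem_Collect_eq)
        have "image_mset (F u) (mset_set {1..n}) = image_mset \<phi> (image_mset u (mset_set {1..n}))"
          unfolding multiset.map_comp by (rule image_mset_cong) (auto simp: F_def)
        then have "image_mset (F u) (mset_set {1..n}) = N"
          using u NM by (simp add: fixed_words_def words_def)
        moreover have "F u \<circ> w = F u"
          unfolding F_def restrict_comp_Sym_eq_iff [OF w] using uw by simp
        ultimately show "F u \<in> fixed_words n N w"
          by (simp add: fixed_words_def words_def F_def)
      qed
    qed simp
  qed
  from le [OF MN] le [OF MN [symmetric]] show ?thesis by (rule antisym)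
qed


section \<open>Coefficients of Frobenius characteristics\<close>

lemma mcoeff_frobenius_ch:
  "mcoeff (frobenius_ch n \<chi>) (mon M) =
    (\<Sum>w\<in>Sym n. \<chi> w * of_nat (card (fixed_words n M w))) / fact n"
  by (simp add: frobenius_ch_def mcoeff_pow_sym_part)

lemma basis_coeff_frobenius_ch:
  "basis_coeff mono_sym_part (frobenius_ch n \<chi>) (mtype M) = mcoeff (frobenius_ch n \<chi>) (mon M)"
proof (rule basis_coeff_mono_sym_part)
  show "mcoeff (frobenius_ch n \<chi>) (mon M) = mcoeff (frobenius_ch n \<chi>) (mon N)"
    if "mtype M = mtype N" for M N
    using card_fixed_words_cong_mtype [OF _ that, of _ n] by (simp add: mcoeff_frobenius_ch)
  show "mcoeff (frobenius_ch n \<chi>) (mon M) = 0" if "size M \<noteq> n" for M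
  proof -
    have "fixed_words n M w = {}" for w
      using that size_words by (auto simp: fixed_words_def)
    then show ?thesis by (simp add: mcoeff_frobenius_ch)
  qed
qed

text \<open>Every conjugator \<open>x\<close> contributes the same sum over \<open>H\<close>,
  because the number of fixed words is a class function; the factor \<open>fact n\<close> cancels,
  and exchanging the sums brings out the stabilizer of each word.\<close>

lemma mcoeff_frobenius_ch_induced:
  assumes H: "H \<subseteq> Sym n"
  shows "mcoeff (frobenius_ch n (induced_character (Sym n) H \<omega>)) (mon M) =
    (\<Sum>u\<in>words n M. \<Sum>c | c \<in> H \<and> u \<circ> c = u. \<omega> c) / of_nat (card H)"
proof -
  have finH: "finite H" using H finite_subset finite_Sym by blast
  define F where "F = (\<lambda>w. complex_of_nat (card (fixed_words n M w)))"
  have conj: "(\<Sum>w | w \<in> Sym n \<and> inv x \<circ> w \<circ> x \<in> H. \<omega> (inv x \<circ> w \<circ> x) * F w) = (\<Sum>c\<in>H. \<omega> c * F c)"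
    if x: "x \<in> Sym n" for x
  proof (rule sum.reindex_bij_witness [where i = "\<lambda>c. x \<circ> c \<circ> inv x" and j = "\<lambda>w. inv x \<circ> w \<circ> x"])
    have 1: "x \<circ> (inv x \<circ> w \<circ> x) \<circ> inv x = w" for w
      by (simp add: fun_eq_iff Sym_inv_apply [OF x])
    fix w assume "w \<in> {w. w \<in> Sym n \<and> inv x \<circ> w \<circ> x \<in> H}"
    then show "x \<circ> (inv x \<circ> w \<circ> x) \<circ> inv x = w" "inv x \<circ> w \<circ> x \<in> H"
      "\<omega> (inv x \<circ> w \<circ> x) * F (inv x \<circ> w \<circ> x) = \<omega> (inv x \<circ> w \<circ> x) * F w"
      using 1 card_fixed_words_conj [OF x, of M "inv x \<circ> w \<circ> x"] unfolding F_def by auto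
  next
    have 2: "inv x \<circ> (x \<circ> w \<circ> inv x) \<circ> x = w" for w
      by (simp add: fun_eq_iff Sym_inv_apply [OF x])
    fix c assume "c \<in> H"
    then show "inv x \<circ> (x \<circ> c \<circ> inv x) \<circ> x = c" "x \<circ> c \<circ> inv x \<in> {w. w \<in> Sym n \<and> inv x \<circ> w \<circ> x \<in> H}"
      using 2 H x Sym_comp Sym_inv by auto
  qed
  have "(\<Sum>w\<in>Sym n. induced_character (Sym n) H \<omega> w * F w) =
      (\<Sum>w\<in>Sym n. \<Sum>x\<in>Sym n. if inv x \<circ> w \<circ> x \<in> H then \<omega> (inv x \<circ> w \<circ> x) * F w else 0) / of_nat (card H)"
    by (simp add: induced_character_def sum_divide_distrib sum_distrib_right flip: sum.inter_filter)
  also have "(\<Sum>w\<in>Sym n. \<Sum>x\<in>Sym n. if inv x \<circ> w \<circ> x \<in> H then \<omega> (inv x \<circ> w \<circ> x) * F w else 0) =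
      (\<Sum>x\<in>Sym n. \<Sum>w | w \<in> Sym n \<and> inv x \<circ> w \<circ> x \<in> H. \<omega> (inv x \<circ> w \<circ> x) * F w)"
    by (subst sum.swap) (simp flip: sum.inter_filter)
  also have "\<dots> = fact n * (\<Sum>c\<in>H. \<omega> c * F c)"
    using conj by simp
  finally have "mcoeff (frobenius_ch n (induced_character (Sym n) H \<omega>)) (mon M) =
      (\<Sum>c\<in>H. \<omega> c * F c) / of_nat (card H)"
    by (simp add: mcoeff_frobenius_ch F_def)
  also have "(\<Sum>c\<in>H. \<omega> c * F c) = (\<Sum>c\<in>H. \<Sum>u\<in>words n M. if u \<circ> c = u then \<omega> c else 0)"
  proof (rule sum.cong [OF refl])
    fix c
    have "(\<Sum>u\<in>words n M. if u \<circ> c = u then \<omega> c else 0) = (\<Sum>u\<in>fixed_words n M c. \<omega> c)"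
      unfolding fixed_words_def by (rule sum.inter_filter [symmetric]) simp
    then show "\<omega> c * F c = (\<Sum>u\<in>words n M. if u \<circ> c = u then \<omega> c else 0)"
      by (simp add: F_def)
  qed
  also have "\<dots> = (\<Sum>u\<in>words n M. \<Sum>c | c \<in> H \<and> u \<circ> c = u. \<omega> c)"
    using finH by (subst sum.swap) (simp flip: sum.inter_filter)
  finally show ?thesis .
qed


section \<open>Permutations with descents in a given set\<close>

text \<open>The number, counted from 0, of the block of \<open>x\<close> when \<open>{1..n}\<close>
  is cut after each element of \<open>I\<close>; the strict inequality puts an element of
  \<open>I\<close> at the end of its block.\<close>

definition block :: "nat set \<Rightarrow> nat \<Rightarrow> nat" where
  "block I x = card {i \<in> I. i < x}"

lemma block_mono: "finite I \<Longrightarrow> x \<le> y \<Longrightarrow> block I x \<le> block I y"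
  unfolding block_def by (intro card_mono) auto

lemma block_Suc: "finite I \<Longrightarrow> block I (Suc x) = block I x + (if x \<in> I then 1 else 0)"
proof -
  assume "finite I"
  have "{i \<in> I. i < Suc x} = (if x \<in> I then insert x {i \<in> I. i < x} else {i \<in> I. i < x})"
    by (auto simp: less_Suc_eq)
  then show ?thesis using \<open>finite I\<close> by (simp add: block_def)
qed

text \<open>Neighbouring positions share a block exactly when the first of them lies outside
  \<open>I\<close>. Comparisons of neighbours then propagate through each block.\<close>

lemma Des_subset_iff:
  assumes "finite I"
  shows "Des n \<sigma> \<subseteq> I \<longleftrightarrow> (\<forall>x\<in>{1..n}. \<forall>y\<in>{1..n}. x < y \<and> block I x = block I y \<longrightarrow> \<sigma> x \<le> \<sigma> y)"
proof
  assume D: "Des n \<sigma> \<subseteq> I"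
  have "\<sigma> x \<le> \<sigma> y" if "x \<le> y" "1 \<le> x" "y \<le> n" "block I x = block I y" for x y
    using that
  proof (induction y rule: dec_induct)
    case (step y)
    have "block I x \<le> block I y" "block I y \<le> block I (Suc y)"
      using block_mono [OF assms \<open>x \<le> y\<close>] block_mono [OF assms, of y "Suc y"] by simp_all
    with \<open>block I x = block I (Suc y)\<close> have eq: "block I x = block I y" "block I y = block I (Suc y)"
      by simp_all
    have "y \<notin> I"
    proof
      assume "y \<in> I"
      then have "block I (Suc y) = block I y + 1" using block_Suc [OF assms, of y] by simp
      with eq(2) show False by simp
    qed
    then have "y \<notin> Des n \<sigma>" using D by blast
    then have "\<sigma> y \<le> \<sigma> (Suc y)" using step by (auto simp: Des_def)
    moreover have "\<sigma> x \<le> \<sigma> y" using step eq by auto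
    ultimately show ?case by simp
  qed simp
  then show "\<forall>x\<in>{1..n}. \<forall>y\<in>{1..n}. x < y \<and> block I x = block I y \<longrightarrow> \<sigma> x \<le> \<sigma> y" by auto
next
  assume *: "\<forall>x\<in>{1..n}. \<forall>y\<in>{1..n}. x < y \<and> block I x = block I y \<longrightarrow> \<sigma> x \<le> \<sigma> y"
  show "Des n \<sigma> \<subseteq> I"
  proof
    fix x assume x: "x \<in> Des n \<sigma>"
    show "x \<in> I"
    proof (rule ccontr)
      assume "x \<notin> I"
      then have "block I x = block I (Suc x)" using block_Suc [OF assms, of x] by simp
      then have "\<sigma> x \<le> \<sigma> (Suc x)" using * x by (auto simp: Des_def)
      then show False using x by (simp add: Des_def)
    qed
  qed
qed

lemma sorted_rearrangement_unique:
  fixes f g :: "nat \<Rightarrow> 'a::linorder"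
  assumes mset: "image_mset f (mset_set {1..n}) = image_mset g (mset_set {1..n})"
    and f: "\<And>x y. 1 \<le> x \<Longrightarrow> x \<le> y \<Longrightarrow> y \<le> n \<Longrightarrow> f x \<le> f y"
    and g: "\<And>x y. 1 \<le> x \<Longrightarrow> x \<le> y \<Longrightarrow> y \<le> n \<Longrightarrow> g x \<le> g y"
    and x: "x \<in> {1..n}"
  shows "f x = g x"
proof -
  have sorted: "sorted (map h [1..<Suc n])" if "\<And>x y. 1 \<le> x \<Longrightarrow> x \<le> y \<Longrightarrow> y \<le> n \<Longrightarrow> h x \<le> h y" for h :: "nat \<Rightarrow> 'a"
    using that by (auto simp: sorted_iff_nth_mono simp del: upt_Suc)
  have "{1..n} = {1..<Suc n}" by auto
  then have m: "mset (map h [1..<Suc n]) = image_mset h (mset_set {1..n})" for h :: "nat \<Rightarrow> 'a"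
    by (simp del: upt_Suc)
  have "sort (map g [1..<Suc n]) = map f [1..<Suc n]"
  proof (rule properties_for_sort)
    show "mset (map f [1..<Suc n]) = mset (map g [1..<Suc n])" by (simp only: m mset)
    show "sorted (map f [1..<Suc n])" by (rule sorted) (rule f)
  qed
  moreover have "sort (map g [1..<Suc n]) = map g [1..<Suc n]"
    by (rule sorted_sort_id, rule sorted) (rule g)
  ultimately have "map f [1..<Suc n] = map g [1..<Suc n]" by (simp only:)
  then show ?thesis using x by (simp del: upt_Suc)
qed

lemma rank_permutation_exists:
  fixes f :: "nat \<Rightarrow> nat"
  assumes inj: "inj_on f {1..n}"
  obtains h where "h \<in> Sym n" "\<And>a b. a \<in> {1..n} \<Longrightarrow> b \<in> {1..n} \<Longrightarrow> h a < h b \<longleftrightarrow> f a < f b"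
proof -
  define R where "R = (\<lambda>a. {b \<in> {1..n}. f b \<le> f a})"
  define h where "h = (\<lambda>a. if a \<in> {1..n} then card (R a) else a)"
  have fin: "finite (R a)" for a by (simp add: R_def)
  have less: "card (R a) < card (R b)" if "b \<in> {1..n}" "f a < f b" for a b
  proof (rule psubset_card_mono [OF fin])
    have "b \<in> R b" "b \<notin> R a" using that by (auto simp: R_def)
    moreover have "R a \<subseteq> R b" using that by (auto simp: R_def)
    ultimately show "R a \<subset> R b" by blast
  qed
  have iff: "h a < h b \<longleftrightarrow> f a < f b" if "a \<in> {1..n}" "b \<in> {1..n}" for a b
  proof (cases "f a" "f b" rule: linorder_cases)
    case equal
    then have "a = b" using inj_onD [OF inj _ that] by simp
    then show ?thesis by simp
  qed (use less [of a b] less [of b a] that in \<open>auto simp: h_def\<close>)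
  have "inj_on h {1..n}"
  proof (rule inj_onI)
    fix a b assume ab: "a \<in> {1..n}" "b \<in> {1..n}" "h a = h b"
    then have "\<not> f a < f b" "\<not> f b < f a" using iff by (metis less_irrefl)+
    then show "a = b" using inj_onD [OF inj _ ab(1,2)] by simp
  qed
  moreover have "h ` {1..n} \<subseteq> {1..n}"
  proof (rule image_subsetI)
    fix a assume a: "a \<in> {1..n}"
    have "R a \<noteq> {}" using a by (auto simp: R_def)
    then have "card (R a) > 0" using fin by (simp add: card_gt_0_iff)
    moreover have "card (R a) \<le> card {1..n}" by (rule card_mono) (auto simp: R_def)
    ultimately show "h a \<in> {1..n}" using a by (simp add: h_def)
  qed
  ultimately have "bij_betw h {1..n} {1..n}" by (simp add: bij_betw_def endo_inj_surj)
  then have "h permutes {1..n}" by (rule bij_imp_permutes) (auto simp: h_def)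
  with iff that show thesis by (simp add: Sym_def)
qed

text \<open>Digits of at most \<open>B - 2\<close> keep the value strictly below
  \<open>B ^ N - 1\<close>. The digit \<open>B - 1\<close> throughout would attain that bound, which
  \<open>code_less\<close> has to exclude.\<close>

lemma digit_sum_bound:
  fixes d :: "nat \<Rightarrow> nat"
  assumes "\<And>k. k < N \<Longrightarrow> d k + 2 \<le> B" "N > 0"
  shows "(\<Sum>k<N. d k * B ^ (N - Suc k)) + 2 \<le> B ^ N"
  using assms
proof (induction N)
  case (Suc N)
  have shift: "(\<Sum>k<N. d k * B ^ (Suc N - Suc k)) = B * (\<Sum>k<N. d k * B ^ (N - Suc k))"
    unfolding sum_distrib_left
    by (intro sum.cong refl) (auto simp: Suc_diff_Suc simp flip: power_Suc)
  have "(\<Sum>k<N. d k * B ^ (N - Suc k)) + 1 \<le> B ^ N"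
    using Suc by (cases "N = 0") force+
  then have "B * ((\<Sum>k<N. d k * B ^ (N - Suc k)) + 1) \<le> B * B ^ N" by (rule mult_le_mono2)
  then show ?case using shift Suc.prems(1) [of N] by (simp add: algebra_simps)
qed simp

lemma Sym_funpow: "g \<in> Sym n \<Longrightarrow> g ^^ k \<in> Sym n"
  by (simp add: Sym_def permutes_funpow)

section \<open>Numerical codes of the periodic words along a permutation\<close>

locale word_on_permutation =
  fixes n :: nat and \<pi> u :: "nat \<Rightarrow> nat"
  assumes Sym: "\<pi> \<in> Sym n"
begin

text \<open>A period common to all points, so that codes from different cycles have equally many
  digits.\<close>

definition period :: nat where
  "period = (SOME N. N > 0 \<and> \<pi> ^^ N = id)"

lemma period: "period > 0" "\<pi> ^^ period = id"
proof -
  have "permutation \<pi>" using Sym by (auto simp: Sym_def permutation_permutes)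
  then obtain N where "N > 0" "\<pi> ^^ N = id" by (rule permutation_is_nilpotent)
  then have "period > 0 \<and> \<pi> ^^ period = id" unfolding period_def by (rule someI [of _ N, OF conjI])
  then show "period > 0" "\<pi> ^^ period = id" by auto
qed

text \<open>Two more than the largest letter, so that digits are at most \<open>base - 2\<close>, as
  \<open>digit_sum_bound\<close> requires; the inserted 0 covers \<open>n = 0\<close>.\<close>

definition base :: nat where
  "base = Max (insert 0 (u ` {1..n})) + 2"

lemma base: "a \<in> {1..n} \<Longrightarrow> u a + 2 \<le> base"
  unfolding base_def by simp

text \<open>The infinite word \<open>u a, u (\<pi> a), u (\<pi>\<^sup>2 a), \<dots>\<close> is periodic; \<open>code a\<close> encodes
  one period as a number, so that the lexicographic order becomes the order of the codes.\<close>

definition code :: "nat \<Rightarrow> nat" where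
  "code a = (\<Sum>k<period. u ((\<pi> ^^ k) a) * base ^ (period - Suc k))"

lemma pow_in: "a \<in> {1..n} \<Longrightarrow> (\<pi> ^^ k) a \<in> {1..n}"
  using Sym_in_iff [OF Sym_funpow [OF Sym]] by blast

lemma step_in: "a \<in> {1..n} \<Longrightarrow> \<pi> a \<in> {1..n}"
  using Sym_in_iff [OF Sym] by blast

lemma code_bound: "a \<in> {1..n} \<Longrightarrow> code a + 2 \<le> base ^ period"
  unfolding code_def using base pow_in period(1) by (intro digit_sum_bound) auto

text \<open>Multiplication by \<open>base\<close> shifts the word by one place: the leading digit
  \<open>u a\<close> moves out to weight \<open>base ^ period\<close>, and by periodicity the digit
  that enters at the end is \<open>u a\<close> again. Rearranged,
  \<open>base * code a = code (\<pi> a) + u a * (base ^ period - 1)\<close>.\<close>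

lemma code_step: "base * code a + u a = code (\<pi> a) + u a * base ^ period"
proof -
  have "base * code a + u ((\<pi> ^^ period) a) = (\<Sum>k<Suc period. u ((\<pi> ^^ k) a) * base ^ (period - k))"
    unfolding code_def sum_distrib_left
    by (auto intro!: sum.cong simp: Suc_diff_Suc simp flip: power_Suc)
  also have "\<dots> = u a * base ^ period + (\<Sum>k<period. u ((\<pi> ^^ Suc k) a) * base ^ (period - Suc k))"
    by (subst sum.lessThan_Suc_shift) simp
  also have "(\<Sum>k<period. u ((\<pi> ^^ Suc k) a) * base ^ (period - Suc k)) = code (\<pi> a)"
    unfolding code_def by (simp add: funpow_swap1)
  finally show ?thesis by (simp add: period(2))
qed

lemma base_pos: "base > 1"
  by (simp add: base_def)

text \<open>In the rearranged form of \<open>code_step\<close>, the term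
  \<open>code (\<pi> a)\<close> is a remainder smaller than \<open>base ^ period - 1\<close>, so the
  first letter decides.\<close>

lemma code_less:
  assumes a: "a \<in> {1..n}" "b \<in> {1..n}" and less: "u a < u b"
  shows "code a < code b"
proof (rule ccontr)
  assume "\<not> code a < code b"
  then have 1: "base * code b \<le> base * code a" by simp
  obtain d where d: "u b = u a + Suc d" using less less_iff_Suc_add by auto
  define Q where "Q = base ^ period - 1"
  have Q: "base ^ period = Suc Q" using base_pos by (simp add: Q_def)
  have "base * code b = code (\<pi> b) + u b * Q" "base * code a = code (\<pi> a) + u a * Q"
    using code_step [of a] code_step [of b] by (simp_all add: Q algebra_simps)
  moreover have "code (\<pi> a) < Q" using code_bound [OF step_in [OF a(1)]] Q by simp
  ultimately show False using 1 by (simp add: d algebra_simps)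
qed

text \<open>For equal first letters, \<open>code_step\<close> expresses both images by the same
  affine map of the codes.\<close>

lemma code_step_less: "u a = u b \<Longrightarrow> code (\<pi> a) < code (\<pi> b) \<longleftrightarrow> code a < code b"
proof -
  assume eq: "u a = u b"
  have "base * code b + u a = code (\<pi> b) + u a * base ^ period"
    using code_step [of b] by (simp only: eq)
  with code_step [of a] have "base * code a < base * code b \<longleftrightarrow> code (\<pi> a) < code (\<pi> b)" by linarith
  then show ?thesis using base_pos by simp
qed

lemma code_eq_letter: "a \<in> {1..n} \<Longrightarrow> b \<in> {1..n} \<Longrightarrow> code a = code b \<Longrightarrow> u a = u b"
  using code_less by (metis less_irrefl linorder_neqE_nat)

lemma code_eq_step: "a \<in> {1..n} \<Longrightarrow> b \<in> {1..n} \<Longrightarrow> code a = code b \<Longrightarrow> code (\<pi> a) = code (\<pi> b)"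
  using code_eq_letter [of a b] code_step_less [of a b] code_step_less [of b a]
  by (metis less_irrefl linorder_neqE_nat)

lemma code_eq_pow:
  assumes "a \<in> {1..n}" "b \<in> {1..n}" "code a = code b"
  shows "code ((\<pi> ^^ k) a) = code ((\<pi> ^^ k) b)"
proof (induction k)
  case (Suc k)
  then show ?case using code_eq_step pow_in assms by simp
qed (simp add: assms)

lemma code_eqI: "(\<And>k. u ((\<pi> ^^ k) a) = u ((\<pi> ^^ k) b)) \<Longrightarrow> code a = code b"
  by (simp add: code_def)

text \<open>For the converse, the remaining \<open>period - 1\<close> applications of
  \<open>\<pi>\<close> lead back to \<open>a\<close> and \<open>b\<close>.\<close>

lemma code_eq_step_iff:
  assumes "a \<in> {1..n}" "b \<in> {1..n}"
  shows "code (\<pi> a) = code (\<pi> b) \<longleftrightarrow> code a = code b"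
proof
  have cyc: "(\<pi> ^^ (period - 1)) (\<pi> x) = x" for x
    using period by (metis Suc_diff_1 comp_apply funpow_Suc_right id_apply)
  assume "code (\<pi> a) = code (\<pi> b)"
  then show "code a = code b"
    using code_eq_pow [OF step_in step_in, of a b "period - 1"] assms by (simp only: cyc)
qed (use code_eq_step assms in blast)

section \<open>Sortings, primitive words and stabilizers\<close>

text \<open>Equivalently, the letters along each cycle form a primitive necklace.\<close>

definition primitive :: bool where
  "primitive \<longleftrightarrow> (\<forall>a\<in>{1..n}. \<forall>k. code ((\<pi> ^^ k) a) = code a \<longrightarrow> (\<pi> ^^ k) a = a)"

text \<open>The condition on the descents of \<open>h \<circ> \<pi> \<circ> inv h\<close> appears
  here as preservation of order within each letter class, which is what the arguments about codes
  use; \<open>sortings_eq_Des\<close> translates.\<close>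

definition sortings :: "nat set \<Rightarrow> (nat \<Rightarrow> nat) set" where
  "sortings I = {h \<in> Sym n. (\<forall>a\<in>{1..n}. u a = block I (h a)) \<and>
     (\<forall>a\<in>{1..n}. \<forall>b\<in>{1..n}. u a = u b \<and> h a < h b \<longrightarrow> h (\<pi> a) < h (\<pi> b))}"

definition stabilizer :: "(nat \<Rightarrow> nat) set" where
  "stabilizer = {c \<in> centralizer n \<pi>. u \<circ> c = u}"

text \<open>If \<open>h\<close> and the codes ordered \<open>a\<close> and \<open>b\<close>
  oppositely, both words would start with the same letter and the conflict would pass on to
  \<open>\<pi> a\<close> and \<open>\<pi> b\<close>. Continuing forever, the words agree, and so do
  the codes.\<close>

lemma sortings_code_mono:
  assumes I: "finite I" and h: "h \<in> sortings I" and a: "a \<in> {1..n}" "b \<in> {1..n}" and less: "h a < h b"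
  shows "code a \<le> code b"
proof (rule ccontr)
  assume "\<not> code a \<le> code b"
  then have gt: "code b < code a" by simp
  have *: "u x = u y \<and> h (\<pi> x) < h (\<pi> y) \<and> code (\<pi> y) < code (\<pi> x)"
    if xy: "x \<in> {1..n}" "y \<in> {1..n}" "h x < h y" "code y < code x" for x y
  proof -
    have "block I (h x) \<le> block I (h y)" using block_mono [OF I] xy(3) by simp
    then have "u x \<le> u y" using h xy by (simp add: sortings_def)
    moreover have "\<not> u x < u y" using code_less [OF xy(1,2)] xy(4) by auto
    ultimately have eq: "u x = u y" by simp
    moreover have "h (\<pi> x) < h (\<pi> y)" using h xy eq unfolding sortings_def by blast
    moreover have "code (\<pi> y) < code (\<pi> x)" using code_step_less eq xy(4) by metis
    ultimately show ?thesis by blast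
  qed
  have "h ((\<pi> ^^ k) a) < h ((\<pi> ^^ k) b) \<and> code ((\<pi> ^^ k) b) < code ((\<pi> ^^ k) a)" for k
  proof (induction k)
    case (Suc k)
    then show ?case using * [OF pow_in pow_in] a by simp
  qed (use less gt in simp)
  then have "u ((\<pi> ^^ k) a) = u ((\<pi> ^^ k) b)" for k
    using * [OF pow_in pow_in] a by blast
  then have "code a = code b" by (rule code_eqI)
  with gt show False by simp
qed

lemma sortings_step:
  assumes "h \<in> sortings I" "a \<in> {1..n}" "b \<in> {1..n}" "code a = code b" "h a < h b"
  shows "h (\<pi> a) < h (\<pi> b)"
  using assms code_eq_letter [OF assms(2,3,4)] unfolding sortings_def by blast

text \<open>If \<open>a\<close> and a different point \<open>(\<pi> ^^ k) a\<close> had the same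
  word, iterating \<open>\<pi> ^^ k\<close> would give a chain of points with one code along which
  \<open>h\<close> is strictly monotone, although the chain returns to \<open>a\<close>.\<close>

lemma sortings_imp_primitive:
  assumes h: "h \<in> sortings I"
  shows primitive
  unfolding primitive_def
proof (intro ballI allI impI, rule ccontr)
  fix a k assume a: "a \<in> {1..n}" and eq: "code ((\<pi> ^^ k) a) = code a" and ne: "(\<pi> ^^ k) a \<noteq> a"
  have hS: "h \<in> Sym n" using h by (simp add: sortings_def)
  define x where "x = (\<lambda>j. (\<pi> ^^ (k * j)) a)"
  have x_in: "x j \<in> {1..n}" for j unfolding x_def by (rule pow_in [OF a])
  have xS: "x (Suc j) = (\<pi> ^^ k) (x j)" for j
    by (simp add: x_def funpow_add)
  have code_x: "code (x j) = code a" for j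
  proof (induction j)
    case (Suc j)
    have "code ((\<pi> ^^ k) (x j)) = code ((\<pi> ^^ k) a)" by (rule code_eq_pow [OF x_in a Suc])
    then show ?case by (simp add: xS eq)
  qed (simp add: x_def)
  have pw: "h ((\<pi> ^^ m) b) < h ((\<pi> ^^ m) c)"
    if "b \<in> {1..n}" "c \<in> {1..n}" "code b = code c" "h b < h c" for b c m
  proof (induction m)
    case (Suc m)
    then show ?case
      using sortings_step [OF h pow_in [OF that(1)] pow_in [OF that(2)] code_eq_pow [OF that(1,2,3)]] by simp
  qed (use that in simp)
  have cyc: "x period = a"
  proof -
    have "(\<pi> ^^ (k * period)) = id"
      by (simp add: mult.commute [of k] funpow_mult [symmetric] period)
    then show ?thesis by (simp add: x_def)
  qed
  have "h (x 0) \<noteq> h (x 1)" using ne Sym_eq_iff [OF hS] by (simp add: x_def)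
  then consider "h (x 0) < h (x 1)" | "h (x 1) < h (x 0)" by linarith
  then show False
  proof cases
    case 1
    have "h (x j) < h (x (Suc j))" for j
    proof (induction j)
      case (Suc j)
      have "code (x j) = code (x (Suc j))" by (simp only: code_x)
      from pw [OF x_in x_in this Suc, of k] show ?case by (simp only: xS)
    qed (use 1 in simp)
    then have "strict_mono (\<lambda>j. h (x j))" by (simp add: strict_mono_Suc_iff)
    from strict_monoD [OF this period(1)] have "h (x 0) < h (x period)" .
    then show False by (simp add: cyc) (simp add: x_def)
  next
    case 2
    have "h (x (Suc j)) < h (x j)" for j
    proof (induction j)
      case (Suc j)
      have "code (x (Suc j)) = code (x j)" by (simp only: code_x)
      from pw [OF x_in x_in this Suc, of k] show ?case by (simp only: xS)
    qed (use 2 in simp)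
    then have "h (x j) + j \<le> h (x 0)" for j
    proof (induction j)
      case (Suc j)
      from Suc.IH [OF Suc.prems] Suc.prems [of j] show ?case by simp
    qed simp
    from this [of period] show False using period(1) by (simp add: cyc) (simp add: x_def)
  qed
qed

lemma sortings_comp_stabilizer:
  assumes h: "h \<in> sortings I" and c: "c \<in> stabilizer"
  shows "h \<circ> c \<in> sortings I"
proof -
  have cS: "c \<in> Sym n" and comm: "c (\<pi> a) = \<pi> (c a)" and fix_u: "u (c a) = u a" for a
    using c by (auto simp: stabilizer_def centralizer_def fun_eq_iff)
  have c_in: "c a \<in> {1..n}" if "a \<in> {1..n}" for a using Sym_in_iff [OF cS] that by blast
  have hS: "h \<in> Sym n" using h by (simp add: sortings_def)
  show ?thesis
    unfolding sortings_def
  proof (intro CollectI conjI ballI impI)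
    show "h \<circ> c \<in> Sym n" by (rule Sym_comp [OF hS cS])
    show "u a = block I ((h \<circ> c) a)" if "a \<in> {1..n}" for a
      using h c_in [OF that] fix_u [of a] by (simp add: sortings_def)
    show "(h \<circ> c) (\<pi> a) < (h \<circ> c) (\<pi> b)"
      if "a \<in> {1..n}" "b \<in> {1..n}" "u a = u b \<and> (h \<circ> c) a < (h \<circ> c) b" for a b
    proof -
      have "u (c a) = u (c b)" "h (c a) < h (c b)" using that fix_u by auto
      then have "h (\<pi> (c a)) < h (\<pi> (c b))"
        using h c_in [OF that(1)] c_in [OF that(2)] unfolding sortings_def by blast
      then show ?thesis by (simp add: comm)
    qed
  qed
qed

text \<open>Both permutations arrange the codes in weakly increasing order, so
  \<open>inv g \<circ> h\<close> preserves codes. It carries ranks within a code class from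
  \<open>h\<close> to \<open>g\<close>, and \<open>\<pi>\<close> preserves the ranks of either.
  Hence \<open>c (\<pi> a)\<close> and \<open>\<pi> (c a)\<close> agree in code and in rank and
  coincide.\<close>

lemma sortings_quotient_stabilizer:
  assumes I: "finite I" and h: "h \<in> sortings I" and g: "g \<in> sortings I"
    and u: "u \<in> extensional {1..n}"
  shows "inv g \<circ> h \<in> stabilizer"
proof -
  define c where "c = inv g \<circ> h"
  have hS: "h \<in> Sym n" and gS: "g \<in> Sym n" using h g by (auto simp: sortings_def)
  have cS: "c \<in> Sym n" unfolding c_def by (rule Sym_comp [OF Sym_inv [OF gS] hS])
  have gc: "g (c a) = h a" for a by (simp add: c_def Sym_inv_apply [OF gS])
  have c_in: "c a \<in> {1..n} \<longleftrightarrow> a \<in> {1..n}" for a by (rule Sym_in_iff [OF cS])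
  have mono: "code (inv f x) \<le> code (inv f y)"
    if f: "f \<in> sortings I" and xy: "1 \<le> x" "x \<le> y" "y \<le> n" for f x y
  proof (cases "x = y")
    case False
    have fS: "f \<in> Sym n" using f by (simp add: sortings_def)
    have "inv f x \<in> {1..n}" "inv f y \<in> {1..n}"
      using Sym_in_iff [OF Sym_inv [OF fS]] xy by auto
    moreover have "f (inv f x) < f (inv f y)" using False xy by (simp add: Sym_inv_apply [OF fS])
    ultimately show ?thesis by (rule sortings_code_mono [OF I f])
  qed simp
  have mset: "image_mset (code \<circ> inv f) (mset_set {1..n}) = image_mset code (mset_set {1..n})"
    if "f \<in> Sym n" for f
    using Sym_inv [OF that] unfolding Sym_def by (intro image_mset_permutes) simp
  have sorted: "(code \<circ> inv h) x = (code \<circ> inv g) x" if "x \<in> {1..n}" for x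
  proof (rule sorted_rearrangement_unique [OF _ _ _ that])
    show "image_mset (code \<circ> inv h) (mset_set {1..n}) = image_mset (code \<circ> inv g) (mset_set {1..n})"
      by (simp only: mset [OF hS] mset [OF gS])
  qed (use mono [OF h] mono [OF g] in simp_all)
  have code_c: "code (c a) = code a" if "a \<in> {1..n}" for a
  proof -
    have "h a \<in> {1..n}" using Sym_in_iff [OF hS] that by blast
    from sorted [OF this] show ?thesis by (simp add: c_def Sym_inv_apply [OF hS])
  qed
  \<comment> \<open>The rank among the points with the same code; by \<open>rk_less\<close> it is
    injective on each code class when \<open>f\<close> is \<open>g\<close>.\<close>
  define rk where "rk = (\<lambda>(f :: nat \<Rightarrow> nat) a. card {b \<in> {1..n}. code b = code a \<and> f b < f a})"
  have rk_step: "rk f (\<pi> a) = rk f a" if f: "f \<in> sortings I" and a: "a \<in> {1..n}" for f a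
  proof -
    have "{b \<in> {1..n}. code b = code (\<pi> a) \<and> f b < f (\<pi> a)} = \<pi> ` {b \<in> {1..n}. code b = code a \<and> f b < f a}"
    proof (intro equalityI subsetI)
      fix b assume b: "b \<in> {b \<in> {1..n}. code b = code (\<pi> a) \<and> f b < f (\<pi> a)}"
      define d where "d = inv \<pi> b"
      have bd: "b = \<pi> d" by (simp add: d_def Sym_inv_apply [OF Sym])
      have d: "d \<in> {1..n}" using b Sym_in_iff [OF Sym] unfolding bd by blast
      have code_d: "code d = code a" using b code_eq_step_iff [OF d a] by (simp add: bd)
      have "f d < f a"
      proof (rule ccontr)
        assume "\<not> f d < f a"
        moreover have "f d \<noteq> f a" using b f Sym_eq_iff [of f n d a] by (auto simp: bd sortings_def)
        ultimately have "f a < f d" by simp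
        from sortings_step [OF f a d code_d [symmetric] this] show False using b by (simp add: bd)
      qed
      then show "b \<in> \<pi> ` {b \<in> {1..n}. code b = code a \<and> f b < f a}" using d code_d bd by blast
    next
      fix b assume "b \<in> \<pi> ` {b \<in> {1..n}. code b = code a \<and> f b < f a}"
      then obtain d where d: "b = \<pi> d" "d \<in> {1..n}" "code d = code a" "f d < f a" by blast
      show "b \<in> {b \<in> {1..n}. code b = code (\<pi> a) \<and> f b < f (\<pi> a)}"
        using step_in [OF d(2)] code_eq_step [OF d(2) a d(3)] sortings_step [OF f d(2) a d(3,4)] d(1) by simp
    qed
    moreover have "inj_on \<pi> X" for X by (rule inj_onI) (simp add: Sym_eq_iff [OF Sym])
    ultimately show ?thesis by (simp add: rk_def card_image)
  qed
  have rk_c: "rk g (c a) = rk h a" if a: "a \<in> {1..n}" for a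
  proof -
    have "{b \<in> {1..n}. code b = code (c a) \<and> g b < g (c a)} = c ` {b \<in> {1..n}. code b = code a \<and> h b < h a}"
    proof (intro equalityI subsetI)
      fix b assume b: "b \<in> {b \<in> {1..n}. code b = code (c a) \<and> g b < g (c a)}"
      define d where "d = inv c b"
      have bd: "b = c d" by (simp add: d_def Sym_inv_apply [OF cS])
      have d: "d \<in> {1..n}" using b c_in unfolding bd by blast
      then show "b \<in> c ` {b \<in> {1..n}. code b = code a \<and> h b < h a}"
        using b code_c [OF d] code_c [OF a] by (auto simp: bd gc)
    next
      fix b assume "b \<in> c ` {b \<in> {1..n}. code b = code a \<and> h b < h a}"
      then obtain d where d: "b = c d" "d \<in> {1..n}" "code d = code a" "h d < h a" by blast
      show "b \<in> {b \<in> {1..n}. code b = code (c a) \<and> g b < g (c a)}"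
        using c_in [of d] d code_c [OF d(2)] code_c [OF a] by (simp add: gc)
    qed
    moreover have "inj_on c X" for X by (rule inj_onI) (simp add: Sym_eq_iff [OF cS])
    ultimately show ?thesis by (simp add: rk_def card_image)
  qed
  have rk_less: "rk g a < rk g b" if "a \<in> {1..n}" "code a = code b" "g a < g b" for a b
    unfolding rk_def
  proof (rule psubset_card_mono)
    have "a \<in> {d \<in> {1..n}. code d = code b \<and> g d < g b}" "a \<notin> {d \<in> {1..n}. code d = code a \<and> g d < g a}"
      using that by auto
    moreover have "{d \<in> {1..n}. code d = code a \<and> g d < g a} \<subseteq> {d \<in> {1..n}. code d = code b \<and> g d < g b}"
      using that by auto
    ultimately show "{d \<in> {1..n}. code d = code a \<and> g d < g a} \<subset> {d \<in> {1..n}. code d = code b \<and> g d < g b}"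
      by blast
  qed simp
  have comm: "c (\<pi> a) = \<pi> (c a)" for a
  proof (cases "a \<in> {1..n}")
    case True
    have in': "c (\<pi> a) \<in> {1..n}" "\<pi> (c a) \<in> {1..n}" using True c_in step_in by blast+
    have "code (c (\<pi> a)) = code (\<pi> a)" by (rule code_c [OF step_in [OF True]])
    also have "\<dots> = code (\<pi> (c a))"
      using code_eq_step [of "c a" a] code_c [OF True] True c_in by simp
    finally have code_eq: "code (c (\<pi> a)) = code (\<pi> (c a))" .
    have "c a \<in> {1..n}" using True c_in by blast
    then have "rk g (c (\<pi> a)) = rk g (\<pi> (c a))"
      using rk_c [OF step_in [OF True]] rk_step [OF h True] rk_step [OF g, of "c a"] rk_c [OF True] by simp
    then have "\<not> g (c (\<pi> a)) < g (\<pi> (c a))" "\<not> g (\<pi> (c a)) < g (c (\<pi> a))"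
      using rk_less [OF in'(1) code_eq] rk_less [OF in'(2) code_eq [symmetric]] by auto
    then have "g (c (\<pi> a)) = g (\<pi> (c a))" by simp
    then show ?thesis using Sym_eq_iff [OF gS] by blast
  next
    case False
    have "\<pi> a = a" "c a = a" using False Sym cS unfolding Sym_def by (auto simp: permutes_not_in)
    then show ?thesis by simp
  qed
  have "u (c a) = u a" for a
  proof (cases "a \<in> {1..n}")
    case True
    then have "c a \<in> {1..n}" using c_in by blast
    then have "u (c a) = block I (g (c a))" using g unfolding sortings_def by blast
    moreover have "u a = block I (h a)" using h True unfolding sortings_def by blast
    ultimately show ?thesis by (simp only: gc)
  next
    case False
    then show ?thesis using u c_in [of a] by (auto simp: extensional_def)
  qed
  then have "c \<in> stabilizer"
    using cS comm by (simp add: stabilizer_def centralizer_def fun_eq_iff)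
  then show ?thesis by (simp add: c_def)
qed

lemma card_sortings:
  assumes I: "finite I" and ne: "sortings I \<noteq> {}" and u: "u \<in> extensional {1..n}"
  shows "card (sortings I) = card stabilizer"
proof -
  obtain h where h: "h \<in> sortings I" using ne by blast
  have hS: "h \<in> Sym n" using h by (simp add: sortings_def)
  have "sortings I = (\<lambda>c. h \<circ> c) ` stabilizer"
  proof (intro equalityI subsetI)
    fix g assume g: "g \<in> sortings I"
    have "g = h \<circ> (inv h \<circ> g)" by (simp add: fun_eq_iff Sym_inv_apply [OF hS])
    then show "g \<in> (\<lambda>c. h \<circ> c) ` stabilizer"
      using sortings_quotient_stabilizer [OF I g h u] by blast
  next
    fix g assume "g \<in> (\<lambda>c. h \<circ> c) ` stabilizer"
    then show "g \<in> sortings I" using sortings_comp_stabilizer [OF h] by blast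
  qed
  moreover have "inj_on (\<lambda>c. h \<circ> c) stabilizer"
    by (rule inj_onI) (simp add: fun_eq_iff Sym_eq_iff [OF hS])
  ultimately show ?thesis by (simp add: card_image)
qed

text \<open>Points are ordered by code, with ties broken by the least point of the cycle. The
  tie-breaker is constant along cycles, so \<open>\<pi>\<close> respects it, and primitivity makes
  the combined key injective.\<close>

lemma sortings_nonempty:
  assumes I: "finite I" and prim: primitive
    and u: "image_mset u (mset_set {1..n}) = image_mset (block I) (mset_set {1..n})"
  shows "sortings I \<noteq> {}"
proof -
  \<comment> \<open>Cycle minima of points in \<open>{1..n}\<close> are below \<open>Suc n\<close>,
    so keys compare like pairs in lexicographic order.\<close>
  define key where "key = (\<lambda>a. code a * Suc n + Min (orbit \<pi> a))"
  have Min: "Min (orbit \<pi> a) \<in> orbit \<pi> a" for a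
    using orbits_Sym(1,4) [OF Sym] by (metis Min_in empty_iff)
  have Min_le: "Min (orbit \<pi> a) < Suc n" if "a \<in> {1..n}" for a
    using Min [of a] orbits_Sym(3) [OF Sym that] by (auto simp: less_Suc_eq_le)
  have key: "code a = key a div Suc n" "Min (orbit \<pi> a) = key a mod Suc n" if "a \<in> {1..n}" for a
    using Min_le [OF that] unfolding key_def by (simp_all del: mult_Suc_right)
  have key_less: "key a < key b \<longleftrightarrow> code a < code b \<or> code a = code b \<and> Min (orbit \<pi> a) < Min (orbit \<pi> b)"
    if a: "a \<in> {1..n}" and b: "b \<in> {1..n}" for a b
  proof (cases "code a" "code b" rule: linorder_cases)
    case less
    then have "Suc (code a) * Suc n \<le> code b * Suc n" by (intro mult_le_mono1) simp
    then have "key a < key b" using Min_le [OF a] unfolding key_def mult_Suc by linarith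
    then show ?thesis using less by simp
  next
    case greater
    then have "Suc (code b) * Suc n \<le> code a * Suc n" by (intro mult_le_mono1) simp
    then have "key b < key a" using Min_le [OF b] unfolding key_def mult_Suc by linarith
    then show ?thesis using greater by simp
  qed (simp add: key_def)
  have "inj_on key {1..n}"
  proof (rule inj_onI)
    fix a b assume ab: "a \<in> {1..n}" "b \<in> {1..n}" "key a = key b"
    then have eq: "code a = code b" "Min (orbit \<pi> a) = Min (orbit \<pi> b)" using key by metis+
    then have "orbit \<pi> b = orbit \<pi> a" using orbits_Sym(2) [OF Sym] Min by metis
    then have "b \<in> orbit \<pi> a" using orbits_Sym(1) [OF Sym] by blast
    then obtain k where "b = (\<pi> ^^ k) a" using orbits_Sym(5) [OF Sym] by blast
    then show "a = b" using prim ab(1) eq(1) unfolding primitive_def by metis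
  qed
  then obtain h where h: "h \<in> Sym n" "\<And>a b. a \<in> {1..n} \<Longrightarrow> b \<in> {1..n} \<Longrightarrow> h a < h b \<longleftrightarrow> key a < key b"
    by (rule rank_permutation_exists) blast
  have inv_in: "inv h x \<in> {1..n} \<longleftrightarrow> x \<in> {1..n}" for x by (rule Sym_in_iff [OF Sym_inv [OF h(1)]])
  \<comment> \<open>Both sides are weakly increasing and have the same content.\<close>
  have "(u \<circ> inv h) x = block I x" if "x \<in> {1..n}" for x
  proof (rule sorted_rearrangement_unique [OF _ _ _ that])
    have "image_mset (u \<circ> inv h) (mset_set {1..n}) = image_mset u (mset_set {1..n})"
      using Sym_inv [OF h(1)] unfolding Sym_def by (intro image_mset_permutes) simp
    then show "image_mset (u \<circ> inv h) (mset_set {1..n}) = image_mset (block I) (mset_set {1..n})"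
      by (simp only: u)
  next
    fix x y assume xy: "1 \<le> x" "x \<le> y" "y \<le> n"
    have inx: "inv h x \<in> {1..n}" "inv h y \<in> {1..n}" using inv_in xy by auto
    have "\<not> h (inv h y) < h (inv h x)" using xy by (simp add: Sym_inv_apply [OF h(1)])
    then have "\<not> key (inv h y) < key (inv h x)" using h(2) [OF inx(2,1)] by blast
    then have "\<not> code (inv h y) < code (inv h x)" using key_less [OF inx(2,1)] by blast
    then show "(u \<circ> inv h) x \<le> (u \<circ> inv h) y"
      using code_less [OF inx(2,1)] by (metis comp_apply not_le)
  qed (use block_mono [OF I] in blast)
  then have u_block: "u a = block I (h a)" if "a \<in> {1..n}" for a
    using that Sym_in_iff [OF h(1), of a] by (metis Sym_inv_apply(2) [OF h(1)] comp_apply)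
  have "h (\<pi> a) < h (\<pi> b)" if ab: "a \<in> {1..n}" "b \<in> {1..n}" and eq: "u a = u b" and less: "h a < h b" for a b
  proof -
    have orb: "orbit \<pi> (\<pi> x) = orbit \<pi> x" for x
      by (rule orbits_Sym(2) [OF Sym orbit.base])
    have "key a < key b" using h(2) [OF ab] less by blast
    then have "key (\<pi> a) < key (\<pi> b)"
      using key_less [OF ab] key_less [OF step_in step_in, OF ab] code_step_less [OF eq]
        code_eq_step_iff [OF ab] by (simp only: orb)
    then show ?thesis using h(2) [OF step_in step_in, OF ab] by blast
  qed
  with u_block h(1) have "h \<in> sortings I" unfolding sortings_def by blast
  then show ?thesis by blast
qed

end


section \<open>Conjugacy classes\<close>

lemma funpow_eq_iff_card_orbit:
  assumes w: "w \<in> Sym n"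
  shows "(w ^^ j) x = (w ^^ k) x \<longleftrightarrow> j mod card (orbit w x) = k mod card (orbit w x)"
proof -
  define d where "d = funpow_dist1 w x x"
  have self: "x \<in> orbit w x" by (rule orbits_Sym(1) [OF w])
  have fix_d: "(w ^^ d) x = x" unfolding d_def by (rule funpow_dist1_prop [OF self])
  have "orbit w x = (\<lambda>k. (w ^^ k) x) ` {0..<d}"
    unfolding d_def by (rule orbit_conv_funpow_dist1 [OF self])
  moreover have "inj_on (\<lambda>k. (w ^^ k) x) {0..<d}"
    unfolding d_def by (rule inj_on_funpow_dist1 [OF self])
  ultimately have card: "card (orbit w x) = d" by (simp add: card_image)
  have per: "(w ^^ k) x = x \<longleftrightarrow> d dvd k" for k
  proof
    assume "(w ^^ k) x = x"
    then have "(w ^^ (k mod d)) x = x" using funpow_mod_eq [OF fix_d] by metis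
    moreover have "k mod d < d" by (simp add: d_def)
    ultimately have "k mod d = 0"
      using funpow_dist1_least [of "k mod d" w x x] unfolding d_def by blast
    then show "d dvd k" by blast
  next
    assume "d dvd k"
    then have "k mod d = 0" by simp
    then show "(w ^^ k) x = x" using funpow_mod_eq [OF fix_d, of k] by simp
  qed
  have le: "(w ^^ j) x = (w ^^ k) x \<longleftrightarrow> j mod d = k mod d" if "j \<le> k" for j k
  proof -
    have "(w ^^ k) x = (w ^^ j) ((w ^^ (k - j)) x)"
      using that by (metis comp_apply funpow_add le_add_diff_inverse)
    then have "(w ^^ j) x = (w ^^ k) x \<longleftrightarrow> x = (w ^^ (k - j)) x"
      by (simp add: Sym_eq_iff [OF Sym_funpow [OF w]])
    also have "\<dots> \<longleftrightarrow> d dvd k - j" using per by metis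
    also have "\<dots> \<longleftrightarrow> j mod d = k mod d" using mod_eq_dvd_iff_nat [OF that] by metis
    finally show ?thesis .
  qed
  show ?thesis unfolding card using le [of j k] le [of k j] by (cases "j \<le> k") auto
qed

text \<open>Cycles of equal length are matched by \<open>\<phi>\<close> and a base point is chosen
  in each; \<open>h\<close> sends every iterate of a base point to the same iterate of its
  partner.\<close>

lemma conjugate_if_cycle_type_eq:
  assumes p: "\<pi> \<in> Sym n" and s: "\<sigma> \<in> Sym n" and type: "cycle_type n \<pi> = cycle_type n \<sigma>"
  obtains h where "h \<in> Sym n" "h \<circ> \<pi> = \<sigma> \<circ> h"
proof -
  define Q where "Q = orbit \<pi> ` {1..n}"
  define R where "R = orbit \<sigma> ` {1..n}"
  obtain \<phi> where \<phi>: "bij_betw \<phi> Q R" "\<And>q. q \<in> Q \<Longrightarrow> card q = card (\<phi> q)"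
    using type image_mset_eq_implies_bij_betw [of Q R card card]
    unfolding cycle_type_def Q_def [symmetric] R_def [symmetric] by (auto simp: Q_def R_def)
  define a where "a = (\<lambda>q :: nat set. SOME x. x \<in> q)"
  have aQ: "a q \<in> q" "orbit \<pi> (a q) = q" "a q \<in> {1..n}" if "q \<in> Q" for q
  proof -
    have "q \<noteq> {}" using that orbits_Sym(1) [OF p] unfolding Q_def by blast
    then show 1: "a q \<in> q" unfolding a_def by (simp add: some_in_eq)
    show "orbit \<pi> (a q) = q" "a q \<in> {1..n}"
      using 1 that orbits_Sym(2,3) [OF p] unfolding Q_def by blast+
  qed
  have aR: "a q \<in> q" "orbit \<sigma> (a q) = q" "a q \<in> {1..n}" if "q \<in> R" for q
  proof -
    have "q \<noteq> {}" using that orbits_Sym(1) [OF s] unfolding R_def by blast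
    then show 1: "a q \<in> q" unfolding a_def by (simp add: some_in_eq)
    show "orbit \<sigma> (a q) = q" "a q \<in> {1..n}"
      using 1 that orbits_Sym(2,3) [OF s] unfolding R_def by blast+
  qed
  have \<phi>R: "\<phi> q \<in> R" if "q \<in> Q" for q using \<phi>(1) that by (auto simp: bij_betw_def)
  have "\<exists>k. x = (\<pi> ^^ k) (a (orbit \<pi> x))" if "x \<in> {1..n}" for x
  proof -
    have q: "orbit \<pi> x \<in> Q" using that by (simp add: Q_def)
    have "x \<in> orbit \<pi> (a (orbit \<pi> x))" using aQ(2) [OF q] orbits_Sym(1) [OF p] by simp
    then show ?thesis using orbits_Sym(5) [OF p] by blast
  qed
  then obtain m where m: "\<And>x. x \<in> {1..n} \<Longrightarrow> x = (\<pi> ^^ m x) (a (orbit \<pi> x))" by metis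
  define h where "h = (\<lambda>x. if x \<in> {1..n} then (\<sigma> ^^ m x) (a (\<phi> (orbit \<pi> x))) else x)"
  \<comment> \<open>The exponent chosen in \<open>m\<close> is immaterial, since iterates repeat
    with the same cycle length on both sides.\<close>
  have h: "h ((\<pi> ^^ k) (a q)) = (\<sigma> ^^ k) (a (\<phi> q))" if q: "q \<in> Q" for k q
  proof -
    define x where "x = (\<pi> ^^ k) (a q)"
    have x_in: "x \<in> {1..n}" unfolding x_def using Sym_in_iff [OF Sym_funpow [OF p]] aQ(3) [OF q] by blast
    have "x \<in> orbit \<pi> (a q)" using orbits_Sym(5) [OF p] unfolding x_def by blast
    then have orb: "orbit \<pi> x = q" using orbits_Sym(2) [OF p] aQ(2) [OF q] by metis
    have "(\<pi> ^^ m x) (a q) = (\<pi> ^^ k) (a q)" using m [OF x_in, unfolded orb] unfolding x_def [symmetric] by (rule sym)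
    then have "m x mod card q = k mod card q" using funpow_eq_iff_card_orbit [OF p] aQ(2) [OF q] by metis
    then have "(\<sigma> ^^ m x) (a (\<phi> q)) = (\<sigma> ^^ k) (a (\<phi> q))"
      using funpow_eq_iff_card_orbit [OF s] aR(2) [OF \<phi>R [OF q]] \<phi>(2) [OF q] by metis
    then show ?thesis using x_in by (simp add: h_def orb x_def [symmetric])
  qed
  have rep: "\<exists>q\<in>Q. \<exists>k. x = (\<pi> ^^ k) (a q)" if "x \<in> {1..n}" for x
    using m [OF that] that unfolding Q_def by blast
  have h_in: "h x \<in> {1..n}" if "x \<in> {1..n}" for x
  proof -
    obtain q k where qk: "q \<in> Q" "x = (\<pi> ^^ k) (a q)" using rep [OF \<open>x \<in> {1..n}\<close>] by blast
    have "h x = (\<sigma> ^^ k) (a (\<phi> q))" using h qk by simp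
    then show ?thesis using Sym_in_iff [OF Sym_funpow [OF s]] aR(3) [OF \<phi>R [OF qk(1)]] by metis
  qed
  have inj: "inj_on h {1..n}"
  proof (rule inj_onI)
    fix x y assume xy: "x \<in> {1..n}" "y \<in> {1..n}" "h x = h y"
    obtain q k where qk: "q \<in> Q" "x = (\<pi> ^^ k) (a q)" using rep [OF xy(1)] by blast
    obtain r j where rj: "r \<in> Q" "y = (\<pi> ^^ j) (a r)" using rep [OF xy(2)] by blast
    have eq: "(\<sigma> ^^ k) (a (\<phi> q)) = (\<sigma> ^^ j) (a (\<phi> r))" using xy(3) h qk rj by simp
    have orb: "orbit \<sigma> ((\<sigma> ^^ k) (a (\<phi> q))) = \<phi> q" if "q \<in> Q" for q k
    proof -
      have "(\<sigma> ^^ k) (a (\<phi> q)) \<in> orbit \<sigma> (a (\<phi> q))" using orbits_Sym(5) [OF s] by blast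
      then show ?thesis using orbits_Sym(2) [OF s] aR(2) [OF \<phi>R [OF \<open>q \<in> Q\<close>]] by metis
    qed
    have "\<phi> q = \<phi> r" using orb [OF qk(1), of k] orb [OF rj(1), of j] eq by simp
    then have [simp]: "r = q" using \<phi>(1) qk(1) rj(1) by (auto simp: bij_betw_def inj_on_def)
    have "k mod card q = j mod card q"
      using eq funpow_eq_iff_card_orbit [OF s, of k "a (\<phi> q)" j] aR(2) [OF \<phi>R [OF qk(1)]] \<phi>(2) [OF qk(1)]
      by simp
    then show "x = y"
      using funpow_eq_iff_card_orbit [OF p, of k "a q" j] aQ(2) [OF qk(1)] qk(2) rj(2) by simp
  qed
  have "bij_betw h {1..n} {1..n}"
    using inj h_in by (simp add: bij_betw_def endo_inj_surj image_subset_iff)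
  then have "h permutes {1..n}" by (rule bij_imp_permutes) (auto simp: h_def)
  then have hS: "h \<in> Sym n" by (simp add: Sym_def)
  have "h (\<pi> x) = \<sigma> (h x)" for x
  proof (cases "x \<in> {1..n}")
    case True
    then obtain q k where qk: "q \<in> Q" "x = (\<pi> ^^ k) (a q)" using rep by blast
    then show ?thesis using h [OF qk(1), of k] h [OF qk(1), of "Suc k"] by simp
  next
    case False
    then have "\<pi> x = x" "\<sigma> x = x" "h x = x"
      using p s by (auto simp: Sym_def permutes_not_in h_def)
    then show ?thesis by simp
  qed
  then have "h \<circ> \<pi> = \<sigma> \<circ> h" by (simp add: fun_eq_iff)
  with hS show thesis by (rule that)
qed

lemma cycle_type_conj:
  assumes p: "\<pi> \<in> Sym n" and h: "h \<in> Sym n"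
  shows "cycle_type n (h \<circ> \<pi> \<circ> inv h) = cycle_type n \<pi>"
proof -
  define \<sigma> where "\<sigma> = h \<circ> \<pi> \<circ> inv h"
  have s: "\<sigma> \<in> Sym n" unfolding \<sigma>_def using p h by (intro Sym_comp Sym_inv)
  have pw: "(\<sigma> ^^ k) (h x) = h ((\<pi> ^^ k) x)" for k x
    by (induction k) (simp_all add: \<sigma>_def Sym_inv_apply [OF h])
  have orb: "orbit \<sigma> (h x) = h ` orbit \<pi> x" for x
    unfolding orbits_Sym(5) [OF s] orbits_Sym(5) [OF p] by (auto simp: pw)
  have inj: "inj_on h X" for X by (rule inj_onI) (simp add: Sym_eq_iff [OF h])
  have "h ` {1..n} = {1..n}" using h by (simp add: Sym_def permutes_image)
  then have "orbit \<sigma> ` {1..n} = (`) h ` orbit \<pi> ` {1..n}"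
    using orb by (metis (no_types, lifting) image_cong image_image)
  moreover have "inj_on ((`) h) (orbit \<pi> ` {1..n})"
    by (rule inj_on_image) (rule inj)
  ultimately have "cycle_type n \<sigma> = image_mset card (image_mset ((`) h) (mset_set (orbit \<pi> ` {1..n})))"
    by (simp add: cycle_type_def image_mset_mset_set)
  also have "\<dots> = cycle_type n \<pi>"
    unfolding cycle_type_def multiset.map_comp
    by (rule image_mset_cong) (simp add: card_image [OF inj])
  finally show ?thesis by (simp add: \<sigma>_def)
qed

lemma finite_centralizer [simp]: "finite (centralizer n \<pi>)"
  by (rule finite_subset [of _ "Sym n"]) (auto simp: centralizer_def)

text \<open>The permutations that conjugate \<open>\<pi>\<close> into a given
  \<open>\<sigma>\<close> form a coset of the centralizer.\<close>

lemma card_conjugators: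
  assumes p: "\<pi> \<in> conj_class n \<mu>"
  shows "card {h \<in> Sym n. P (h \<circ> \<pi> \<circ> inv h)} = card {\<sigma> \<in> conj_class n \<mu>. P \<sigma>} * card (centralizer n \<pi>)"
proof -
  have pS: "\<pi> \<in> Sym n" and type: "cycle_type n \<pi> = \<mu>" using p by (auto simp: conj_class_def)
  define A where "A = {\<sigma> \<in> conj_class n \<mu>. P \<sigma>}"
  have finA: "finite A" by (rule finite_subset [of _ "Sym n"]) (auto simp: A_def conj_class_def)
  have fibre: "card {h \<in> Sym n. h \<circ> \<pi> \<circ> inv h = \<sigma>} = card (centralizer n \<pi>)" if \<sigma>: "\<sigma> \<in> A" for \<sigma>
  proof -
    have sS: "\<sigma> \<in> Sym n" "cycle_type n \<pi> = cycle_type n \<sigma>" using \<sigma> type by (auto simp: A_def conj_class_def)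
    obtain g where g: "g \<in> Sym n" "g \<circ> \<pi> = \<sigma> \<circ> g" using conjugate_if_cycle_type_eq [OF pS sS] .
    have iff: "h \<circ> \<pi> \<circ> inv h = \<sigma> \<longleftrightarrow> h \<circ> \<pi> = \<sigma> \<circ> h" if "h \<in> Sym n" for h
      using Sym_inv_o [OF that] by (metis comp_id o_assoc)
    have "{h \<in> Sym n. h \<circ> \<pi> \<circ> inv h = \<sigma>} = (\<lambda>c. g \<circ> c) ` centralizer n \<pi>"
    proof (intro equalityI subsetI)
      fix h assume "h \<in> {h \<in> Sym n. h \<circ> \<pi> \<circ> inv h = \<sigma>}"
      then have h: "h \<in> Sym n" "h \<circ> \<pi> = \<sigma> \<circ> h" using iff by auto
      define c where "c = inv g \<circ> h"
      have hc: "h = g \<circ> c" by (simp add: c_def fun_eq_iff Sym_inv_apply [OF g(1)])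
      have "g (c (\<pi> x)) = g (\<pi> (c x))" for x
        using fun_cong [OF h(2), of x] fun_cong [OF g(2), of "c x"] by (simp add: hc)
      then have "c \<circ> \<pi> = \<pi> \<circ> c" by (simp add: fun_eq_iff Sym_eq_iff [OF g(1)])
      moreover have "c \<in> Sym n" unfolding c_def using g h by (intro Sym_comp Sym_inv)
      ultimately show "h \<in> (\<lambda>c. g \<circ> c) ` centralizer n \<pi>" using hc by (auto simp: centralizer_def)
    next
      fix h assume "h \<in> (\<lambda>c. g \<circ> c) ` centralizer n \<pi>"
      then obtain c where c: "h = g \<circ> c" "c \<in> Sym n" "c \<circ> \<pi> = \<pi> \<circ> c" by (auto simp: centralizer_def)
      have hS: "h \<in> Sym n" unfolding c(1) by (rule Sym_comp [OF g(1) c(2)])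
      have "h \<circ> \<pi> = g \<circ> (c \<circ> \<pi>)" by (simp add: c(1) o_assoc)
      also have "\<dots> = (g \<circ> \<pi>) \<circ> c" by (simp only: c(3) o_assoc)
      also have "\<dots> = \<sigma> \<circ> h" by (simp only: g(2) c(1) o_assoc)
      finally show "h \<in> {h \<in> Sym n. h \<circ> \<pi> \<circ> inv h = \<sigma>}" using iff [OF hS] hS by blast
    qed
    moreover have "inj_on (\<lambda>c. g \<circ> c) (centralizer n \<pi>)"
      by (rule inj_onI) (simp add: fun_eq_iff Sym_eq_iff [OF g(1)])
    ultimately show ?thesis by (simp add: card_image)
  qed
  have "{h \<in> Sym n. P (h \<circ> \<pi> \<circ> inv h)} = (\<Union>\<sigma>\<in>A. {h \<in> Sym n. h \<circ> \<pi> \<circ> inv h = \<sigma>})"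
    using cycle_type_conj [OF pS] type Sym_comp Sym_inv pS unfolding A_def conj_class_def by auto
  then have "card {h \<in> Sym n. P (h \<circ> \<pi> \<circ> inv h)} = (\<Sum>\<sigma>\<in>A. card {h \<in> Sym n. h \<circ> \<pi> \<circ> inv h = \<sigma>})"
    using finA by (simp only:) (intro card_UN_disjoint, auto)
  also have "\<dots> = (\<Sum>\<sigma>\<in>A. card (centralizer n \<pi>))" by (rule sum.cong [OF refl fibre])
  finally show ?thesis by (simp add: A_def)
qed

text \<open>Substituting \<open>x = h a\<close> in \<open>Des_subset_iff\<close> removes the
  inverse; weak and strict order agree there because \<open>h \<circ> \<pi>\<close> is
  injective.\<close>

lemma (in word_on_permutation) sortings_eq_Des:
  assumes "finite I"
  shows "sortings I = {h \<in> Sym n. (\<forall>a\<in>{1..n}. u a = block I (h a)) \<and> Des n (h \<circ> \<pi> \<circ> inv h) \<subseteq> I}"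
proof -
  have "(\<forall>a\<in>{1..n}. \<forall>b\<in>{1..n}. u a = u b \<and> h a < h b \<longrightarrow> h (\<pi> a) < h (\<pi> b)) \<longleftrightarrow> Des n (h \<circ> \<pi> \<circ> inv h) \<subseteq> I"
    if h: "h \<in> Sym n" and ub: "\<forall>a\<in>{1..n}. u a = block I (h a)" for h
  proof -
    have ims: "h ` {1..n} = {1..n}" using h by (simp add: Sym_def permutes_image)
    have "Des n (h \<circ> \<pi> \<circ> inv h) \<subseteq> I \<longleftrightarrow> (\<forall>x\<in>h ` {1..n}. \<forall>y\<in>h ` {1..n}. x < y \<and> block I x = block I y \<longrightarrow>
        h (\<pi> (inv h x)) \<le> h (\<pi> (inv h y)))"
      unfolding ims Des_subset_iff [OF assms] by simp
    also have "\<dots> \<longleftrightarrow> (\<forall>a\<in>{1..n}. \<forall>b\<in>{1..n}. h a < h b \<and> block I (h a) = block I (h b) \<longrightarrow> h (\<pi> a) \<le> h (\<pi> b))"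
      by (simp add: Sym_inv_apply [OF h])
    also have "\<dots> \<longleftrightarrow> (\<forall>a\<in>{1..n}. \<forall>b\<in>{1..n}. u a = u b \<and> h a < h b \<longrightarrow> h (\<pi> a) < h (\<pi> b))"
    proof (intro ball_cong refl)
      fix a b assume ab: "a \<in> {1..n}" "b \<in> {1..n}"
      have "u a = block I (h a)" "u b = block I (h b)" using ub ab by blast+
      moreover have "h (\<pi> a) = h (\<pi> b) \<Longrightarrow> h a = h b" by (simp add: Sym_eq_iff [OF h] Sym_eq_iff [OF Sym])
      ultimately show "(h a < h b \<and> block I (h a) = block I (h b) \<longrightarrow> h (\<pi> a) \<le> h (\<pi> b)) \<longleftrightarrow>
          (u a = u b \<and> h a < h b \<longrightarrow> h (\<pi> a) < h (\<pi> b))"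
        by (auto simp: le_less)
    qed
    finally show ?thesis by blast
  qed
  then show ?thesis unfolding sortings_def by blast
qed

text \<open>A sorting \<open>h\<close> determines its word as \<open>block I \<circ> h\<close> on
  \<open>{1..n}\<close>, so different words have disjoint sets of sortings. Together they are all
  \<open>h\<close> whose conjugate of \<open>\<pi>\<close> has its descents in
  \<open>I\<close>.\<close>

lemma sum_card_sortings:
  assumes I: "finite I" and p: "\<pi> \<in> conj_class n \<mu>"
  shows "(\<Sum>u\<in>words n (image_mset (block I) (mset_set {1..n})). card (word_on_permutation.sortings n \<pi> u I)) =
    card {\<sigma> \<in> conj_class n \<mu>. Des n \<sigma> \<subseteq> I} * card (centralizer n \<pi>)"
proof -
  define M where "M = image_mset (block I) (mset_set {1..n})"
  have pS: "\<pi> \<in> Sym n" using p by (simp add: conj_class_def)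
  interpret word_on_permutation n \<pi> u for u by unfold_locales (rule pS)
  have "(\<Sum>u\<in>words n M. card (sortings u I)) = card (\<Union>u\<in>words n M. sortings u I)"
  proof (rule card_UN_disjoint [symmetric])
    show "\<forall>u\<in>words n M. finite (sortings u I)"
      by (auto simp: sortings_def)
    show "\<forall>u\<in>words n M. \<forall>v\<in>words n M. u \<noteq> v \<longrightarrow> sortings u I \<inter> sortings v I = {}"
    proof (intro ballI impI)
      fix u v assume uv: "u \<in> words n M" "v \<in> words n M" "u \<noteq> v"
      show "sortings u I \<inter> sortings v I = {}"
      proof (rule ccontr)
        assume "sortings u I \<inter> sortings v I \<noteq> {}"
        then have "u a = v a" if "a \<in> {1..n}" for a using that by (auto simp: sortings_def)
        then have "u = v" using uv(1,2) by (intro extensionalityI [of u "{1..n}"]) (auto simp: words_def)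
        with uv(3) show False by contradiction
      qed
    qed
  qed simp
  also have "(\<Union>u\<in>words n M. sortings u I) = {h \<in> Sym n. Des n (h \<circ> \<pi> \<circ> inv h) \<subseteq> I}"
  proof (intro equalityI subsetI)
    fix h assume "h \<in> {h \<in> Sym n. Des n (h \<circ> \<pi> \<circ> inv h) \<subseteq> I}"
    then have h: "h \<in> Sym n" "Des n (h \<circ> \<pi> \<circ> inv h) \<subseteq> I" by auto
    define u where "u = (\<lambda>a\<in>{1..n}. block I (h a))"
    have "image_mset u (mset_set {1..n}) = image_mset (block I \<circ> h) (mset_set {1..n})"
      by (rule image_mset_cong) (simp add: u_def)
    also have "\<dots> = M"
      using h(1) unfolding M_def Sym_def by (intro image_mset_permutes) simp
    finally have "u \<in> words n M" by (simp add: words_def u_def)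
    moreover have "h \<in> sortings u I" using h by (simp add: sortings_eq_Des [OF I] u_def)
    ultimately show "h \<in> (\<Union>u\<in>words n M. sortings u I)" by blast
  qed (auto simp: sortings_eq_Des [OF I])
  finally show ?thesis using card_conjugators [OF p, of "\<lambda>\<sigma>. Des n \<sigma> \<subseteq> I"] by (simp add: M_def)
qed


section \<open>Higher Lie characters on stabilizers of words\<close>

lemma add_mod_cancel_right:
  fixes t t' s i :: nat
  assumes "(t + s) mod i = (t' + s) mod i" "t < i" "t' < i"
  shows "t = t'"
proof -
  have le: "t = t'" if "t \<le> t'" "(t + s) mod i = (t' + s) mod i" "t' < i" for t t'
  proof -
    have "i dvd t' - t" using that mod_eq_dvd_iff_nat [of "t + s" "t' + s" i] by simp
    moreover have "t' - t < i" using that(3) by simp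
    ultimately show ?thesis using that(1) nat_dvd_not_less by fastforce
  qed
  show ?thesis using le [of t t'] le [of t' t] assms by (cases "t \<le> t'") auto
qed

locale labelled_permutation =
  fixes n :: nat and \<mu> :: "nat multiset" and \<pi> :: "nat \<Rightarrow> nat" and a :: "nat \<Rightarrow> nat \<Rightarrow> nat \<Rightarrow> nat"
  assumes Sym_\<pi>: "\<pi> \<in> Sym n" and labelling: "cycle_labelling n \<mu> \<pi> a"
begin

lemma label_in: "l < count \<mu> i \<Longrightarrow> t < i \<Longrightarrow> a i l t \<in> {1..n}"
  using labelling unfolding cycle_labelling_def bij_betw_def by force

lemma label_inj:
  assumes "l < count \<mu> i" "t < i" "l' < count \<mu> i'" "t' < i'" "a i l t = a i' l' t'"
  shows "i = i'" "l = l'" "t = t'"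
proof -
  have "inj_on (\<lambda>(i, l, t). a i l t) {(i, l, t). l < count \<mu> i \<and> t < i}"
    using labelling by (simp add: cycle_labelling_def bij_betw_def)
  from inj_onD [OF this, of "(i, l, t)" "(i', l', t')"] assms
  show "i = i'" "l = l'" "t = t'" by auto
qed

lemma label_cases:
  assumes "x \<in> {1..n}"
  obtains i l t where "l < count \<mu> i" "t < i" "x = a i l t"
proof -
  have "x \<in> (\<lambda>(i, l, t). a i l t) ` {(i, l, t). l < count \<mu> i \<and> t < i}"
    using labelling assms by (simp add: cycle_labelling_def bij_betw_def)
  then show thesis using that by auto
qed

lemma label_pow:
  assumes "l < count \<mu> i" "t < i"
  shows "(\<pi> ^^ k) (a i l t) = a i l ((t + k) mod i)"
proof (induction k)
  case (Suc k)
  have "(t + k) mod i < i" using assms by simp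
  then have "\<pi> (a i l ((t + k) mod i)) = a i l (Suc ((t + k) mod i) mod i)"
    using labelling assms(1) by (simp add: cycle_labelling_def)
  then show ?case by (simp add: Suc mod_Suc_eq)
qed (use assms in simp)

lemma label_pow_0: "l < count \<mu> i \<Longrightarrow> t < i \<Longrightarrow> a i l t = (\<pi> ^^ t) (a i l 0)"
  using label_pow [of l i 0 t] by simp

lemma centralizer_pow:
  assumes "c \<in> centralizer n \<pi>"
  shows "c ((\<pi> ^^ k) x) = (\<pi> ^^ k) (c x)"
proof (induction k)
  case (Suc k)
  have "c (\<pi> y) = \<pi> (c y)" for y
    using assms by (auto simp: centralizer_def fun_eq_iff)
  then show ?case by (simp add: Suc)
qed simp

lemma centralizer_Sym: "c \<in> centralizer n \<pi> \<Longrightarrow> c \<in> Sym n"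
  by (simp add: centralizer_def)

lemma centralizer_comp: "c \<in> centralizer n \<pi> \<Longrightarrow> d \<in> centralizer n \<pi> \<Longrightarrow> c \<circ> d \<in> centralizer n \<pi>"
  by (auto simp: centralizer_def Sym_comp fun_eq_iff)

lemma centralizer_inv:
  assumes "c \<in> centralizer n \<pi>"
  shows "inv c \<in> centralizer n \<pi>"
proof -
  have c: "c \<in> Sym n" "c (\<pi> x) = \<pi> (c x)" for x using assms by (auto simp: centralizer_def fun_eq_iff)
  have "inv c (\<pi> x) = \<pi> (inv c x)" for x
    using c(2) [of "inv c x"] Sym_inv_apply [OF c(1)] by metis
  then show ?thesis using c(1) by (simp add: centralizer_def Sym_inv fun_eq_iff)
qed

text \<open>Commuting with \<open>\<pi>\<close> forces \<open>c\<close> to map a cycle to a cycle up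
  to rotation. The lengths divide each other: one round of the source closes the image, and
  injectivity of \<open>c\<close> gives the reverse.\<close>

lemma centralizer_action:
  assumes c: "c \<in> centralizer n \<pi>" and l: "l < count \<mu> i" and i: "i > 0"
  obtains l' z where "l' < count \<mu> i" "z < i" "\<And>k. c (a i l (k mod i)) = a i l' ((z + k) mod i)"
proof -
  have cS: "c \<in> Sym n" by (rule centralizer_Sym [OF c])
  have "c (a i l 0) \<in> {1..n}" using Sym_in_iff [OF cS] label_in [OF l i] by blast
  then obtain i' l' z where z: "l' < count \<mu> i'" "z < i'" "c (a i l 0) = a i' l' z" by (rule label_cases)
  have all: "c (a i l (k mod i)) = a i' l' ((z + k) mod i')" for k
    using centralizer_pow [OF c, of k "a i l 0"] label_pow [OF l i, of k] label_pow [OF z(1,2), of k] z(3)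
    by simp
  have "i = i'"
  proof -
    have "(z + i) mod i' = z"
      using label_inj(3) [OF z(1) _ z(1,2), of "(z + i) mod i'"] all [of i] z(2,3) by simp
    then have "i' dvd i" using z(2) by (metis add_diff_cancel_left' mod_eq_dvd_iff_nat le_add1 mod_less)
    moreover have "c (a i l (i' mod i)) = c (a i l 0)" using all [of i'] z by simp
    then have "a i l (i' mod i) = a i l 0" by (simp add: Sym_eq_iff [OF cS])
    then have "i' mod i = 0" using label_inj(3) [OF l _ l i, of "i' mod i"] i by simp
    then have "i dvd i'" by blast
    ultimately show ?thesis by (metis dvd_antisym)
  qed
  with z all that show thesis by blast
qed

lemma base_element_exists:
  assumes z: "\<And>i l. l < count \<mu> i \<Longrightarrow> i > 0 \<Longrightarrow> z i l < i"
  obtains b where "base_element n \<mu> a z b" "b \<in> centralizer n \<pi>"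
proof -
  \<comment> \<open>Labels are unique, so the choice has a single candidate.\<close>
  define b where "b = (\<lambda>x. if x \<in> {1..n}
    then (SOME y. \<exists>i l t. l < count \<mu> i \<and> t < i \<and> x = a i l t \<and> y = a i l ((t + z i l) mod i)) else x)"
  have b: "b (a i l t) = a i l ((t + z i l) mod i)" if lt: "l < count \<mu> i" "t < i" for i l t
  proof -
    have "(SOME y. \<exists>i' l' t'. l' < count \<mu> i' \<and> t' < i' \<and> a i l t = a i' l' t' \<and> y = a i' l' ((t' + z i' l') mod i')) =
        a i l ((t + z i l) mod i)"
    proof (rule some_equality)
      fix y assume "\<exists>i' l' t'. l' < count \<mu> i' \<and> t' < i' \<and> a i l t = a i' l' t' \<and> y = a i' l' ((t' + z i' l') mod i')"
      then obtain i' l' t' where *: "l' < count \<mu> i'" "t' < i'" "a i l t = a i' l' t'"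
        "y = a i' l' ((t' + z i' l') mod i')" by blast
      from label_inj [OF lt *(1,2,3)] *(4) show "y = a i l ((t + z i l) mod i)" by simp
    qed (use lt in blast)
    then show ?thesis using label_in [OF lt] by (simp add: b_def)
  qed
  have "inj_on b {1..n}"
  proof (rule inj_onI)
    fix x y assume xy: "x \<in> {1..n}" "y \<in> {1..n}" "b x = b y"
    obtain i l t where x: "l < count \<mu> i" "t < i" "x = a i l t" using xy(1) by (rule label_cases)
    obtain i' l' t' where y: "l' < count \<mu> i'" "t' < i'" "y = a i' l' t'" using xy(2) by (rule label_cases)
    have eq: "a i l ((t + z i l) mod i) = a i' l' ((t' + z i' l') mod i')"
      using xy(3) b [OF x(1,2)] b [OF y(1,2)] x(3) y(3) by simp
    have "i = i'" "l = l'" "(t + z i l) mod i = (t' + z i' l') mod i'"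
      using label_inj [OF x(1) _ y(1) _ eq] x(2) y(2) by auto
    then show "x = y" using x y add_mod_cancel_right [of t "z i l" i t'] by simp
  qed
  moreover have "b ` {1..n} \<subseteq> {1..n}"
  proof (rule image_subsetI)
    fix x assume "x \<in> {1..n}"
    then obtain i l t where x: "l < count \<mu> i" "t < i" "x = a i l t" by (rule label_cases)
    then show "b x \<in> {1..n}" using b [OF x(1,2)] label_in [OF x(1), of "(t + z i l) mod i"] by simp
  qed
  ultimately have "bij_betw b {1..n} {1..n}" by (simp add: bij_betw_def endo_inj_surj)
  then have "b permutes {1..n}" by (rule bij_imp_permutes) (auto simp: b_def)
  then have bS: "b \<in> Sym n" by (simp add: Sym_def)
  have "b (\<pi> x) = \<pi> (b x)" for x
  proof (cases "x \<in> {1..n}")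
    case True
    then obtain i l t where x: "l < count \<mu> i" "t < i" "x = a i l t" by (rule label_cases)
    have i: "i > 0" using x by simp
    have "b (\<pi> x) = a i l ((Suc t mod i + z i l) mod i)"
      using label_pow [OF x(1,2), of 1] b [OF x(1), of "Suc t mod i"] i x(3) by simp
    moreover have "\<pi> (b x) = a i l (Suc ((t + z i l) mod i) mod i)"
      using label_pow [OF x(1), of "(t + z i l) mod i" 1] b [OF x(1,2)] i x(3) by simp
    ultimately show ?thesis by (simp add: mod_Suc_eq mod_add_left_eq)
  next
    case False
    then show ?thesis using Sym_\<pi> bS by (simp add: Sym_def permutes_not_in)
  qed
  then have "b \<in> centralizer n \<pi>" using bS by (simp add: centralizer_def fun_eq_iff)
  moreover have "base_element n \<mu> a z b" unfolding base_element_def using bS b z by auto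
  ultimately show thesis using that by blast
qed

end


locale labelled_word = labelled_permutation n \<mu> \<pi> a + word_on_permutation n \<pi> u
  for n \<mu> \<pi> a u
begin

text \<open>Starting every cycle at the point of least code conjugates an element that preserves the
  codes to a wreathing element, since primitivity makes that point unique.\<close>

lemma omega_stabilizer_primitive:
  assumes prim: primitive and \<omega>: "omega_character n \<mu> \<pi> a \<zeta> \<omega>" and c: "c \<in> stabilizer"
  shows "\<omega> c = 1"
proof -
  have cC: "c \<in> centralizer n \<pi>" and uc: "u (c x) = u x" for x
    using c by (auto simp: stabilizer_def fun_eq_iff)
  have code_c: "code (c x) = code x" for x
    by (rule code_eqI) (simp add: uc flip: centralizer_pow [OF cC])
  define W where "W = (\<lambda>i l. (\<lambda>t. code (a i l t)) ` {..<i})"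
  have "\<exists>t. t < i \<and> code (a i l t) = Min (W i l)" if "i > 0" for i l
  proof -
    have "Min (W i l) \<in> W i l" using \<open>i > 0\<close> by (intro Min_in) (auto simp: W_def)
    then show ?thesis by (auto simp: W_def)
  qed
  then obtain s where s: "\<And>i l. i > 0 \<Longrightarrow> s i l < i \<and> code (a i l (s i l)) = Min (W i l)"
    by metis
  obtain b where b: "base_element n \<mu> a s b" "b \<in> centralizer n \<pi>"
    using base_element_exists [of s] s by blast
  define g where "g = inv b \<circ> (c \<circ> b)"
  have bS: "b \<in> Sym n" by (rule centralizer_Sym [OF b(2)])
  have gC: "g \<in> centralizer n \<pi>"
    unfolding g_def by (intro centralizer_comp centralizer_inv b(2) cC)
  have gS: "g \<in> Sym n" by (rule centralizer_Sym [OF gC])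
  have b0: "b (a i l 0) = a i l (s i l)" if "l < count \<mu> i" "i > 0" for i l
    using b(1) that s [of i l] unfolding base_element_def by fastforce
  have g0: "\<exists>l'. l' < count \<mu> i \<and> (\<forall>t<i. g (a i l t) = a i l' t)" if l: "l < count \<mu> i" and i: "i > 0" for i l
  proof -
    obtain l' z where z: "l' < count \<mu> i" "z < i" "\<And>k. c (a i l (k mod i)) = a i l' ((z + k) mod i)"
      using centralizer_action [OF cC l i] by blast
    \<comment> \<open>As \<open>c\<close> preserves codes and maps the cycle \<open>l\<close> onto
      the cycle \<open>l'\<close>, both carry the same set of codes and hence the same
      minimum.\<close>
    have "W i l = W i l'"
    proof -
      have ct: "c (a i l t) = a i l' ((z + t) mod i)" if "t < i" for t
        using z(3) [of t] that by simp
      have "W i l = (\<lambda>t. code (c (a i l t))) ` {..<i}" by (simp add: W_def code_c)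
      also have "\<dots> = (\<lambda>t. code (a i l' ((z + t) mod i))) ` {..<i}"
        using ct by (intro image_cong) auto
      also have "\<dots> = (\<lambda>t. code (a i l' t)) ` ((\<lambda>t. (z + t) mod i) ` {..<i})"
        by (simp add: image_image)
      also have "(\<lambda>t. (z + t) mod i) ` {..<i} = {..<i}"
      proof (rule endo_inj_surj)
        show "inj_on (\<lambda>t. (z + t) mod i) {..<i}"
          by (rule inj_onI) (metis add.commute add_mod_cancel_right lessThan_iff)
      qed (use i in auto)
      finally show ?thesis by (simp add: W_def)
    qed
    define y where "y = c (b (a i l 0))"
    have sl: "s i l < i" using s [OF i] by blast
    have y: "y = a i l' ((z + s i l) mod i)"
      using z(3) [of "s i l"] sl b0 [OF l i] by (simp add: y_def)
    have "code y = code (a i l (s i l))" by (simp add: y_def code_c b0 [OF l i])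
    also have "\<dots> = Min (W i l')" using s [OF i, of l] \<open>W i l = W i l'\<close> by simp
    also have "\<dots> = code (a i l' (s i l'))" using s [OF i, of l'] by simp
    finally have code_y: "code y = code (a i l' (s i l'))" .
    \<comment> \<open>The number of steps from the least point of the cycle \<open>l'\<close> to
      \<open>y\<close>, with \<open>i\<close> added to avoid truncated subtraction.\<close>
    define k where "k = (z + s i l) mod i + (i - s i l')"
    have sl': "s i l' < i" using s [OF i] by blast
    have "(s i l' + k) mod i = (z + s i l) mod i" using sl' by (simp add: k_def)
    then have yk: "y = (\<pi> ^^ k) (a i l' (s i l'))"
      using label_pow [OF z(1) sl', of k] y by simp
    then have "y = a i l' (s i l')"
      using prim code_y label_in [OF z(1) sl'] unfolding primitive_def by metis
    then have "y = b (a i l' 0)" using b0 [OF z(1) i] by simp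
    then have g0: "g (a i l 0) = a i l' 0"
      by (simp add: g_def y_def [symmetric] Sym_inv_apply [OF bS])
    have "g (a i l t) = a i l' t" if t: "t < i" for t
      using label_pow_0 [OF l t] label_pow_0 [OF z(1) t] centralizer_pow [OF gC, of t "a i l 0"] g0 by simp
    with z(1) show ?thesis by blast
  qed
  define \<tau> where "\<tau> = (\<lambda>i l. if l < count \<mu> i \<and> i > 0
    then SOME l'. l' < count \<mu> i \<and> (\<forall>t<i. g (a i l t) = a i l' t) else l)"
  have \<tau>: "\<tau> i l < count \<mu> i \<and> (\<forall>t<i. g (a i l t) = a i (\<tau> i l) t)" if "l < count \<mu> i" "i > 0" for i l
  proof -
    have eq: "\<tau> i l = (SOME l'. l' < count \<mu> i \<and> (\<forall>t<i. g (a i l t) = a i l' t))"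
      unfolding \<tau>_def by (rule if_P) (use that in blast)
    show ?thesis unfolding eq by (rule someI_ex [OF g0 [OF that]])
  qed
  have "\<tau> i permutes {..<count \<mu> i}" for i
  proof (cases "i > 0")
    case True
    have "inj_on (\<tau> i) {..<count \<mu> i}"
    proof (rule inj_onI)
      fix l m assume lm: "l \<in> {..<count \<mu> i}" "m \<in> {..<count \<mu> i}" "\<tau> i l = \<tau> i m"
      then have "g (a i l 0) = g (a i m 0)" using \<tau> [of l i] \<tau> [of m i] True by simp
      then have "a i l 0 = a i m 0" by (simp add: Sym_eq_iff [OF gS])
      then show "l = m" using label_inj(2) [of l i 0 m i 0] lm True by simp
    qed
    moreover have "\<tau> i ` {..<count \<mu> i} \<subseteq> {..<count \<mu> i}" using \<tau> True by auto
    ultimately have "bij_betw (\<tau> i) {..<count \<mu> i} {..<count \<mu> i}"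
      by (simp add: bij_betw_def endo_inj_surj)
    then show ?thesis by (rule bij_imp_permutes) (simp add: \<tau>_def)
  next
    case False
    then have "\<tau> i = id" by (simp add: \<tau>_def fun_eq_iff)
    then show ?thesis by (simp add: permutes_id)
  qed
  then have "wreathing_element n \<mu> a \<tau> g"
    unfolding wreathing_element_def using gS \<tau> by auto
  then have "\<omega> g = 1" using \<omega> unfolding omega_character_def by blast
  \<comment> \<open>Multiplicativity and nonvanishing of \<open>\<omega>\<close> give conjugate
    elements of the centralizer the same value.\<close>
  moreover have "c \<circ> b = b \<circ> g"
    by (simp add: g_def fun_eq_iff Sym_inv_apply [OF bS])
  then have "\<omega> c * \<omega> b = \<omega> b * \<omega> g"
    using \<omega> cC b(2) gC unfolding omega_character_def linear_character_def by metis
  moreover have "\<omega> b \<noteq> 0" using \<omega> b(2) unfolding omega_character_def linear_character_def by blast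
  ultimately show ?thesis by simp
qed

text \<open>A nontrivial shift by \<open>k\<close> that keeps the code of one point is a period of
  the whole cycle, so rotating this cycle alone by \<open>k\<close> preserves \<open>u\<close>.
  There \<open>\<omega>\<close> takes the value \<open>\<zeta> i (k mod i)\<close>, which differs
  from \<open>\<zeta> i 0 = 1\<close> by faithfulness.\<close>

lemma omega_stabilizer_not_primitive:
  assumes prim: "\<not> primitive" and \<omega>: "omega_character n \<mu> \<pi> a \<zeta> \<omega>"
    and \<zeta>: "\<forall>i\<in>#\<mu>. faithful_character i (\<zeta> i)" and nz: "0 \<notin># \<mu>"
  obtains d where "d \<in> stabilizer" "\<omega> d \<noteq> 1"
proof -
  obtain x k where x: "x \<in> {1..n}" "code ((\<pi> ^^ k) x) = code x" "(\<pi> ^^ k) x \<noteq> x"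
    using prim unfolding primitive_def by blast
  obtain i l t where lt: "l < count \<mu> i" "t < i" "x = a i l t" using x(1) by (rule label_cases)
  have i: "i > 0" "i \<in># \<mu>" using lt by (auto simp flip: count_greater_zero_iff)
  define z where "z = (\<lambda>i' l'. if i' = i \<and> l' = l then k mod i else 0)"
  have z_less: "z i' l' < i'" if "i' > 0" for i' l' using that by (simp add: z_def)
  obtain d where d: "base_element n \<mu> a z d" "d \<in> centralizer n \<pi>"
    using base_element_exists [of z] z_less by blast
  have kz: "k mod i \<noteq> 0"
  proof
    assume "k mod i = 0"
    then have "(t + k) mod i = t" using lt(2) by (metis add.right_neutral mod_add_right_eq mod_less)
    then show False using x(3) label_pow [OF lt(1,2), of k] lt(3) by simp
  qed
  have per: "code ((\<pi> ^^ k) y) = code y" if y: "y = a i l r" "r < i" for y r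
  proof -
    have "(t + (r + (i - t))) mod i = r" using lt(2) that by simp
    then have yx: "y = (\<pi> ^^ (r + (i - t))) x" using label_pow [OF lt(1,2)] y lt(3) by simp
    have "(\<pi> ^^ k) y = (\<pi> ^^ (r + (i - t))) ((\<pi> ^^ k) x)"
      unfolding yx by (metis add.commute comp_apply funpow_add)
    then show ?thesis using code_eq_pow [OF pow_in [OF x(1)] x(1) x(2)] yx by simp
  qed
  have "u (d y) = u y" for y
  proof (cases "y \<in> {1..n}")
    case True
    then obtain i' l' r where r: "l' < count \<mu> i'" "r < i'" "y = a i' l' r" by (rule label_cases)
    have dy: "d y = a i' l' ((r + z i' l') mod i')" using d(1) r unfolding base_element_def by blast
    show ?thesis
    proof (cases "i' = i \<and> l' = l")
      case True
      then have "d y = (\<pi> ^^ k) y"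
        using dy label_pow [OF r(1,2), of k] r(3) by (simp add: z_def mod_add_right_eq)
      then have "code (d y) = code y" using per [of y r] r True by simp
      moreover have "d y \<in> {1..n}" using \<open>d y = (\<pi> ^^ k) y\<close> pow_in [OF \<open>y \<in> {1..n}\<close>] by simp
      ultimately show ?thesis using code_eq_letter \<open>y \<in> {1..n}\<close> by blast
    next
      case False
      then have "z i' l' = 0" by (auto simp: z_def)
      then show ?thesis using dy r by simp
    qed
  next
    case False
    then have "d y = y" using centralizer_Sym [OF d(2)] by (simp add: Sym_def permutes_not_in)
    then show ?thesis by simp
  qed
  then have dst: "d \<in> stabilizer" using d(2) by (simp add: stabilizer_def fun_eq_iff)
  have \<zeta>0: "\<zeta> j 0 = 1" if "j \<in># \<mu>" "j > 0" for j
  proof -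
    have "faithful_character j (\<zeta> j)" using \<zeta> that by blast
    then have "\<zeta> j 0 \<noteq> 0" "\<zeta> j ((0 + 0) mod j) = \<zeta> j 0 * \<zeta> j 0"
      using that(2) unfolding faithful_character_def by blast+
    then show ?thesis by simp
  qed
  have "\<omega> d = (\<Prod>j\<in>set_mset \<mu>. \<Prod>m<count \<mu> j. \<zeta> j (z j m))"
    using \<omega> d(1) unfolding omega_character_def by blast
  also have "\<dots> = (\<Prod>j\<in>set_mset \<mu>. if j = i then \<zeta> i (k mod i) else 1)"
  proof (rule prod.cong [OF refl])
    fix j assume j: "j \<in> set_mset \<mu>"
    have jpos: "j > 0" using j nz by (metis gr0I)
    have "(\<Prod>m<count \<mu> j. \<zeta> j (z j m)) = (\<Prod>m<count \<mu> j. if m = l \<and> j = i then \<zeta> i (k mod i) else 1)"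
      by (rule prod.cong [OF refl]) (auto simp: z_def \<zeta>0 [OF j jpos])
    also have "\<dots> = (if j = i then \<zeta> i (k mod i) else 1)"
      using lt(1) by (cases "j = i") simp_all
    finally show "(\<Prod>m<count \<mu> j. \<zeta> j (z j m)) = (if j = i then \<zeta> i (k mod i) else 1)" .
  qed
  also have "\<dots> = \<zeta> i (k mod i)" using i(2) by simp
  finally have "\<omega> d = \<zeta> i (k mod i)" .
  moreover have "\<zeta> i (k mod i) \<noteq> \<zeta> i 0"
    using \<zeta> i kz unfolding faithful_character_def by (metis inj_onD lessThan_iff mod_less_divisor)
  ultimately show thesis using that dst \<zeta>0 [OF i(2,1)] by simp
qed

end

lemma (in labelled_word) sum_omega_stabilizer:
  assumes \<omega>: "omega_character n \<mu> \<pi> a \<zeta> \<omega>"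
    and \<zeta>: "\<forall>i\<in>#\<mu>. faithful_character i (\<zeta> i)" and nz: "0 \<notin># \<mu>"
    and I: "finite I" and u: "u \<in> words n (image_mset (block I) (mset_set {1..n}))"
  shows "(\<Sum>c\<in>stabilizer. \<omega> c) = of_nat (card (sortings I))"
proof -
  have ext: "u \<in> extensional {1..n}" using u by (simp add: words_def)
  have content: "image_mset u (mset_set {1..n}) = image_mset (block I) (mset_set {1..n})"
    using u by (simp add: words_def)
  show ?thesis
  proof (cases primitive)
    case True
    have "(\<Sum>c\<in>stabilizer. \<omega> c) = (\<Sum>c\<in>stabilizer. 1)"
      by (rule sum.cong [OF refl omega_stabilizer_primitive [OF True \<omega>]])
    also have "\<dots> = of_nat (card (sortings I))"
      using card_sortings [OF I sortings_nonempty [OF I True content] ext] by simp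
    finally show ?thesis .
  next
    case False
    obtain d where d: "d \<in> stabilizer" "\<omega> d \<noteq> 1"
      using omega_stabilizer_not_primitive [OF False \<omega> \<zeta> nz] by blast
    have dC: "d \<in> centralizer n \<pi>" and du: "u \<circ> d = u" using d(1) by (auto simp: stabilizer_def)
    have dS: "d \<in> Sym n" by (rule centralizer_Sym [OF dC])
    have "u \<circ> inv d = u \<circ> d \<circ> inv d" by (simp only: du)
    also have "\<dots> = u" by (simp add: Sym_inv_o [OF dS] flip: o_assoc)
    finally have diu: "u \<circ> inv d = u" .
    \<comment> \<open>Translation by \<open>d\<close> permutes the stabilizer and multiplies the sum
      by \<open>\<omega> d\<close>, which differs from 1.\<close>
    have "(\<Sum>c\<in>stabilizer. \<omega> c) = (\<Sum>c\<in>stabilizer. \<omega> (d \<circ> c))"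
    proof (rule sum.reindex_bij_witness [where i = "\<lambda>c. d \<circ> c" and j = "\<lambda>c. inv d \<circ> c"])
      fix c assume c: "c \<in> stabilizer"
      show "d \<circ> (inv d \<circ> c) = c" "inv d \<circ> (d \<circ> c) = c"
        by (simp_all add: o_assoc Sym_inv_o [OF dS])
      show "inv d \<circ> c \<in> stabilizer" "d \<circ> c \<in> stabilizer"
        using c centralizer_comp centralizer_inv dC du diu by (auto simp: stabilizer_def o_assoc)
      show "\<omega> (d \<circ> (inv d \<circ> c)) = \<omega> c" by (simp add: o_assoc Sym_inv_o [OF dS])
    qed
    also have "\<dots> = (\<Sum>c\<in>stabilizer. \<omega> d * \<omega> c)"
      using \<omega> dC by (intro sum.cong refl)
        (auto simp: omega_character_def linear_character_def stabilizer_def)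
    also have "\<dots> = \<omega> d * (\<Sum>c\<in>stabilizer. \<omega> c)" by (simp add: sum_distrib_left)
    finally have "(\<Sum>c\<in>stabilizer. \<omega> c) = 0" using d(2) by simp
    moreover have "sortings I = {}" using sortings_imp_primitive False by blast
    ultimately show ?thesis by simp
  qed
qed

text \<open>The theorem of Gessel and Reutenauer for complete homogeneous symmetric functions.\<close>

theorem mcoeff_higher_lie_character:
  assumes part: "partition_of n \<mu>" and lie: "higher_lie_character n \<mu> \<psi>" and I: "finite I"
  shows "mcoeff (frobenius_ch n \<psi>) (mon (image_mset (block I) (mset_set {1..n}))) =
    of_nat (card {\<sigma> \<in> conj_class n \<mu>. Des n \<sigma> \<subseteq> I})"
proof -
  obtain \<pi> a \<zeta> \<omega> where p: "\<pi> \<in> conj_class n \<mu>" and lab: "cycle_labelling n \<mu> \<pi> a"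
    and \<zeta>: "\<forall>i\<in>#\<mu>. faithful_character i (\<zeta> i)" and \<omega>: "omega_character n \<mu> \<pi> a \<zeta> \<omega>"
    and \<psi>: "\<psi> = induced_character (Sym n) (centralizer n \<pi>) \<omega>"
    using lie unfolding higher_lie_character_def by blast
  have nz: "0 \<notin># \<mu>" using part by (simp add: partition_of_def)
  have pS: "\<pi> \<in> Sym n" using p by (simp add: conj_class_def)
  interpret labelled_word n \<mu> \<pi> a u for u using pS lab by unfold_locales
  define M where "M = image_mset (block I) (mset_set {1..n})"
  have "centralizer n \<pi> \<subseteq> Sym n" by (auto simp: centralizer_def)
  from mcoeff_frobenius_ch_induced [OF this, of \<omega> M]
  have "mcoeff (frobenius_ch n \<psi>) (mon M) =
      (\<Sum>u\<in>words n M. \<Sum>c\<in>stabilizer u. \<omega> c) / of_nat (card (centralizer n \<pi>))"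
    by (simp add: \<psi> stabilizer_def)
  also have "(\<Sum>u\<in>words n M. \<Sum>c\<in>stabilizer u. \<omega> c) = (\<Sum>u\<in>words n M. of_nat (card (sortings u I)))"
    by (rule sum.cong [OF refl]) (simp add: M_def sum_omega_stabilizer [OF \<omega> \<zeta> nz I])
  also have "\<dots> = of_nat (\<Sum>u\<in>words n M. card (sortings u I))" by simp
  also have "(\<Sum>u\<in>words n M. card (sortings u I)) =
      card {\<sigma> \<in> conj_class n \<mu>. Des n \<sigma> \<subseteq> I} * card (centralizer n \<pi>)"
    unfolding M_def by (rule sum_card_sortings [OF I p])
  finally have "mcoeff (frobenius_ch n \<psi>) (mon M) = of_nat (card {\<sigma> \<in> conj_class n \<mu>. Des n \<sigma> \<subseteq> I}) *
      (of_nat (card (centralizer n \<pi>)) / of_nat (card (centralizer n \<pi>)))" by simp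
  moreover have "id \<in> centralizer n \<pi>" by (simp add: centralizer_def Sym_def permutes_id)
  then have "card (centralizer n \<pi>) \<noteq> 0" by (metis card_eq_0_iff empty_iff finite_centralizer)
  ultimately show ?thesis by (simp add: M_def)
qed


section \<open>Cyclic compositions and cyclic extensions\<close>

lemma sorted_list_of_set_image_Suc:
  assumes "finite K"
  shows "sorted_list_of_set (Suc ` K) = map Suc (sorted_list_of_set K)"
proof (rule sorted_distinct_set_unique)
  show "sorted (map Suc (sorted_list_of_set K))"
    by (simp add: sorted_map)
  show "distinct (map Suc (sorted_list_of_set K))"
    by (simp add: distinct_map)
qed (use assms in auto)

lemma cyclic_comp_image_Suc:
  assumes "finite K" "K \<noteq> {}"
  shows "cyclic_comp n (Suc ` K) = cyclic_comp n K"
proof -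
  define js where "js = sorted_list_of_set K"
  have ne: "js \<noteq> []" using assms by (simp add: js_def)
  have "map2 (-) (tl (map Suc js)) (map Suc js) = map2 (-) (tl js) js"
    by (rule nth_equalityI) (auto simp: nth_tl)
  then show ?thesis
    using ne by (simp add: cyclic_comp_def sorted_list_of_set_image_Suc [OF assms(1)] hd_map last_map Let_def
        flip: js_def)
qed

text \<open>For \<open>n \<in> K\<close> the part of \<open>cyclic_comp\<close> that wraps around
  equals the least element of \<open>K\<close>, the length of the first block; the differences are
  the lengths of the other blocks.\<close>

lemma mset_cyclic_comp_eq_mtype:
  assumes K: "K \<subseteq> {1..n}" "n \<in> K"
  shows "mset (cyclic_comp n K) = mtype (image_mset (block K) (mset_set {1..n}))"
proof -
  define js where "js = sorted_list_of_set K"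
  have fin: "finite K" using K(1) finite_subset by blast
  have set_js: "set js = K" and sorted: "sorted_wrt (<) js"
    using fin by (auto simp: js_def)
  have js_less: "js ! i < js ! j" if "i < j" "j < length js" for i j
    using sorted_wrt_nth_less [OF sorted that] .
  have js_le: "js ! i \<le> js ! j" if "i \<le> j" "j < length js" for i j
    using js_less [of i j] that by (cases "i = j") auto
  have ne: "js \<noteq> []" using set_js K(2) by auto
  define m where "m = length js - 1"
  have len: "length js = Suc m" using ne by (simp add: m_def)
  have js_m: "js ! m = n"
  proof -
    obtain i where i: "i < length js" "js ! i = n" using K(2) set_js by (metis in_set_conv_nth)
    have "js ! m \<in> K" using set_js len by (metis lessI nth_mem)
    then have "js ! m \<le> n" using K(1) by auto
    moreover have "n \<le> js ! m" using js_le [of i m] i len by simp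
    ultimately show ?thesis by simp
  qed
  \<comment> \<open>The right end of the preceding block, with 0 before the first one.\<close>
  define lo where "lo = (\<lambda>r. case r of 0 \<Rightarrow> 0 | Suc j \<Rightarrow> js ! j)"
  have block_eq: "block K x = r" if r: "r < length js" and x: "lo r < x" "x \<le> js ! r" for r x
  proof -
    have "{i \<in> K. i < x} = (!) js ` {..<r}"
    proof (intro equalityI subsetI)
      fix i assume "i \<in> {i \<in> K. i < x}"
      then obtain j where j: "j < length js" "i = js ! j" "js ! j < x"
        using set_js by (auto simp: in_set_conv_nth)
      have "j < r"
      proof (rule ccontr)
        assume "\<not> j < r"
        then show False using js_le [of r j] j x by simp
      qed
      then show "i \<in> (!) js ` {..<r}" using j by blast
    next
      fix i assume "i \<in> (!) js ` {..<r}"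
      then obtain j where j: "j < r" "i = js ! j" by blast
      then obtain q where q: "r = Suc q" by (cases r) auto
      have "js ! j \<le> js ! q" using js_le [of j q] j q r by simp
      then have "i < x" using x j q by (simp add: lo_def)
      moreover have "i \<in> K" using j r set_js nth_mem by fastforce
      ultimately show "i \<in> {i \<in> K. i < x}" by simp
    qed
    moreover have "inj_on ((!) js) {..<r}"
    proof (rule inj_onI)
      fix i j assume "i \<in> {..<r}" "j \<in> {..<r}" "js ! i = js ! j"
      then show "i = j" using js_less [of i j] js_less [of j i] r by (cases i j rule: linorder_cases) auto
    qed
    ultimately show ?thesis by (simp add: block_def card_image)
  qed
  have interval: "\<exists>r<length js. lo r < x \<and> x \<le> js ! r" if x: "x \<in> {1..n}" for x
  proof -
    define r where "r = (LEAST r. x \<le> js ! r)"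
    have ex: "x \<le> js ! m" using x js_m by simp
    have r: "x \<le> js ! r" "r \<le> m" unfolding r_def
      by (rule LeastI [where P = "\<lambda>r. x \<le> js ! r", OF ex], rule Least_le [where P = "\<lambda>r. x \<le> js ! r", OF ex])
    have "lo r < x"
    proof (cases r)
      case (Suc q)
      then have "\<not> x \<le> js ! q" unfolding r_def using not_less_Least by (metis lessI)
      then show ?thesis by (simp add: lo_def Suc)
    qed (use x in \<open>simp add: lo_def\<close>)
    moreover have "r < length js" using r(2) len by simp
    ultimately show ?thesis using r(1) by blast
  qed
  define M where "M = image_mset (block K) (mset_set {1..n})"
  have cnt: "count M r = js ! r - lo r" if r: "r < length js" for r
  proof -
    have "{x \<in> {1..n}. block K x = r} = {lo r<..js ! r}"
    proof (intro equalityI subsetI)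
      fix x assume x: "x \<in> {x \<in> {1..n}. block K x = r}"
      then obtain q where "q < length js" "lo q < x" "x \<le> js ! q" using interval by blast
      moreover from this have "q = r" using block_eq x by simp
      ultimately show "x \<in> {lo r<..js ! r}" by simp
    next
      fix x assume x: "x \<in> {lo r<..js ! r}"
      have "js ! r \<in> K" using set_js r by (metis nth_mem)
      then have "js ! r \<le> n" using K(1) by auto
      with x block_eq [OF r] show "x \<in> {x \<in> {1..n}. block K x = r}" by auto
    qed
    moreover have "count M r = card {x \<in> {1..n}. block K x = r}"
      unfolding M_def by (simp add: count_conv_size_mset filter_mset_image_mset)
    ultimately show ?thesis by simp
  qed
  have "set_mset M = {0..<length js}"
  proof (intro equalityI subsetI)
    fix r assume "r \<in># M"
    then obtain x where x: "x \<in> {1..n}" "r = block K x" by (auto simp: M_def)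
    then show "r \<in> {0..<length js}" using interval [OF x(1)] block_eq by auto
  next
    fix r assume "r \<in> {0..<length js}"
    then have r: "r < length js" by simp
    have "lo r < js ! r"
    proof (cases r)
      case 0
      have "js ! 0 \<in> K" using set_js len by (metis nth_mem zero_less_Suc)
      then show ?thesis using K(1) by (auto simp: lo_def 0)
    next
      case (Suc q)
      then show ?thesis using js_less [of q r] r by (simp add: lo_def)
    qed
    then have "count M r > 0" using cnt [OF r] by simp
    then show "r \<in># M" by simp
  qed
  then have "mtype M = image_mset (count M) (mset_set {0..<length js})" by (simp add: mtype_def)
  also have "\<dots> = image_mset (\<lambda>r. js ! r - lo r) (mset_set {0..<length js})"
    by (rule image_mset_cong) (simp add: cnt)
  also have "\<dots> = mset (map (\<lambda>r. js ! r - lo r) [0..<Suc m])"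
    by (simp add: len flip: mset_upt del: upt_Suc)
  also have "map (\<lambda>r. js ! r - lo r) [0..<Suc m] = js ! 0 # map (\<lambda>j. js ! Suc j - js ! j) [0..<m]"
    by (simp add: map_upt_Suc lo_def del: upt_Suc)
  also have "map (\<lambda>j. js ! Suc j - js ! j) [0..<m] = map2 (-) (tl js) js"
    by (rule nth_equalityI) (auto simp: len nth_tl)
  also have "mset (js ! 0 # map2 (-) (tl js) js) = mset (cyclic_comp n K)"
  proof -
    have "last js = n" using js_m ne by (simp add: last_conv_nth m_def)
    then show ?thesis using ne by (simp add: cyclic_comp_def Let_def hd_conv_nth flip: js_def)
  qed
  finally show ?thesis by (simp add: M_def)
qed

lemma minus_one_power_mult_eq_msmult: "(- 1) ^ k * f = msmult ((- 1) ^ k) f"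
proof (induction k)
  case 0
  show ?case by (rule mfps_eqI) simp
next
  case (Suc k)
  have "(- 1) ^ Suc k * f = - ((- 1) ^ k * f)" by simp
  also have "\<dots> = - msmult ((- 1) ^ k) f" by (simp only: Suc)
  also have "\<dots> = msmult ((- 1) ^ Suc k) f" by (rule mfps_eqI) (simp add: uminus_mfps_def)
  finally show ?case .
qed

lemma affine_ribbon_eq:
  "affine_ribbon n J = (\<Sum>I | I \<noteq> {} \<and> I \<subseteq> J.
     msmult ((- 1) ^ card (J - I)) (hom_sym_part (mset (cyclic_comp n I))))"
  unfolding affine_ribbon_def minus_one_power_mult_eq_msmult hom_sym_part_def
  by (simp flip: prod_mset_prod_list)

text \<open>Induction on the distance from \<open>n\<close> to an element of \<open>K\<close>. If
  \<open>n \<notin> K\<close>, adding 1 to all elements neither wraps around nor changes the cyclic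
  composition, and \<open>p\<close> carries the counted permutations along. The first conjunct
  supplies the positive parts that \<open>hall_sum_hom_sym_part\<close> demands.\<close>

lemma card_cyclic_descents_subset:
  assumes part: "partition_of n \<mu>" and lie: "higher_lie_character n \<mu> \<psi>"
    and ext: "cyclic_extension n (conj_class n \<mu>) (Des n) cDes p"
    and K: "K \<subseteq> {1..n}" "K \<noteq> {}"
  shows "0 \<notin># mset (cyclic_comp n K) \<and> of_nat (card {\<sigma> \<in> conj_class n \<mu>. cDes \<sigma> \<subseteq> K}) =
    basis_coeff mono_sym_part (frobenius_ch n \<psi>) (mset (cyclic_comp n K))"
proof -
  have top: "0 \<notin># mset (cyclic_comp n K) \<and> of_nat (card {\<sigma> \<in> conj_class n \<mu>. cDes \<sigma> \<subseteq> K}) =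
      basis_coeff mono_sym_part (frobenius_ch n \<psi>) (mset (cyclic_comp n K))"
    if K: "K \<subseteq> {1..n}" "n \<in> K" for K
  proof -
    have fin: "finite K" using K(1) finite_subset by blast
    have "cDes \<sigma> \<subseteq> K \<longleftrightarrow> Des n \<sigma> \<subseteq> K" if "\<sigma> \<in> conj_class n \<mu>" for \<sigma>
    proof -
      have "cDes \<sigma> \<inter> {1..<n} = Des n \<sigma>" "cDes \<sigma> \<subseteq> {1..n}"
        using ext that unfolding cyclic_extension_def by auto
      moreover have "{1..n} \<subseteq> insert n {1..<n}" by auto
      ultimately show ?thesis using K(2) by blast
    qed
    then have "{\<sigma> \<in> conj_class n \<mu>. cDes \<sigma> \<subseteq> K} = {\<sigma> \<in> conj_class n \<mu>. Des n \<sigma> \<subseteq> K}" by blast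
    then show ?thesis
      unfolding mset_cyclic_comp_eq_mtype [OF K] basis_coeff_frobenius_ch
        mcoeff_higher_lie_character [OF part lie fin] by simp
  qed
  have shifted: "0 \<notin># mset (cyclic_comp n K) \<and> of_nat (card {\<sigma> \<in> conj_class n \<mu>. cDes \<sigma> \<subseteq> K}) =
      basis_coeff mono_sym_part (frobenius_ch n \<psi>) (mset (cyclic_comp n K))"
    if "K \<subseteq> {1..n}" "n - d \<in> K" for d K
    using that
  proof (induction d arbitrary: K)
    case 0
    then show ?case using top by simp
  next
    case (Suc d)
    show ?case
    proof (cases "n \<in> K")
      case True
      then show ?thesis using top Suc.prems by blast
    next
      case False
      have lt: "K \<subseteq> {1..<n}"
      proof
        fix i assume "i \<in> K"
        then show "i \<in> {1..<n}" using Suc.prems(1) False by (cases "i = n") auto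
      qed
      have sh: "sh n K = Suc ` K"
        unfolding sh_def using lt by (intro image_cong) auto
      have inj: "inj_on (\<lambda>i. i mod n + 1) {1..n}"
      proof (rule inj_onI)
        fix i j assume ij: "i \<in> {1..n}" "j \<in> {1..n}" "i mod n + 1 = j mod n + 1"
        then show "i = j" by (cases "i = n"; cases "j = n") auto
      qed
      have fin: "finite K" "K \<noteq> {}" using Suc.prems finite_subset by auto
      have bij: "bij_betw p (conj_class n \<mu>) (conj_class n \<mu>)" using ext by (simp add: cyclic_extension_def)
      have p: "cDes (p \<sigma>) \<subseteq> Suc ` K \<longleftrightarrow> cDes \<sigma> \<subseteq> K" if "\<sigma> \<in> conj_class n \<mu>" for \<sigma>
      proof -
        have "cDes (p \<sigma>) = sh n (cDes \<sigma>)" "cDes \<sigma> \<subseteq> {1..n}"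
          using ext that unfolding cyclic_extension_def by auto
        moreover have "(\<lambda>i. i mod n + 1) ` X \<subseteq> (\<lambda>i. i mod n + 1) ` K \<longleftrightarrow> X \<subseteq> K" if "X \<subseteq> {1..n}" for X
          using inj_on_image_mem_iff [OF inj _ Suc.prems(1)] that by blast
        ultimately show ?thesis unfolding sh [symmetric] sh_def by simp
      qed
      have "{\<sigma> \<in> conj_class n \<mu>. cDes \<sigma> \<subseteq> Suc ` K} = p ` {\<sigma> \<in> conj_class n \<mu>. cDes \<sigma> \<subseteq> K}"
      proof (intro equalityI subsetI)
        fix \<sigma> assume \<sigma>: "\<sigma> \<in> {\<sigma> \<in> conj_class n \<mu>. cDes \<sigma> \<subseteq> Suc ` K}"
        then have "\<sigma> \<in> p ` conj_class n \<mu>" using bij by (simp add: bij_betw_def)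
        then obtain \<tau> where \<tau>: "\<tau> \<in> conj_class n \<mu>" "\<sigma> = p \<tau>" by blast
        then show "\<sigma> \<in> p ` {\<sigma> \<in> conj_class n \<mu>. cDes \<sigma> \<subseteq> K}" using \<sigma> p [OF \<tau>(1)] by blast
      next
        fix \<sigma> assume "\<sigma> \<in> p ` {\<sigma> \<in> conj_class n \<mu>. cDes \<sigma> \<subseteq> K}"
        then obtain \<tau> where \<tau>: "\<tau> \<in> conj_class n \<mu>" "cDes \<tau> \<subseteq> K" "\<sigma> = p \<tau>" by blast
        then show "\<sigma> \<in> {\<sigma> \<in> conj_class n \<mu>. cDes \<sigma> \<subseteq> Suc ` K}"
          using p [OF \<tau>(1)] bij_betwE [OF bij] by blast
      qed
      moreover have "inj_on p {\<sigma> \<in> conj_class n \<mu>. cDes \<sigma> \<subseteq> K}"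
        by (rule inj_on_subset [of p "conj_class n \<mu>"]) (use bij in \<open>auto simp: bij_betw_def\<close>)
      ultimately have card: "card {\<sigma> \<in> conj_class n \<mu>. cDes \<sigma> \<subseteq> Suc ` K} = card {\<sigma> \<in> conj_class n \<mu>. cDes \<sigma> \<subseteq> K}"
        by (simp add: card_image)
      have "n - Suc d < n" using Suc.prems(2) lt by auto
      then have "n - d = Suc (n - Suc d)" using Suc.prems lt by fastforce
      then have in_K: "n - d \<in> Suc ` K" using Suc.prems(2) by simp
      have "Suc ` K \<subseteq> {1..n}" using lt by auto
      from Suc.IH [OF this in_K] show ?thesis
        unfolding card cyclic_comp_image_Suc [OF fin] .
    qed
  qed
  obtain k where "k \<in> K" using K by blast
  moreover from this have "k \<le> n" using K(1) by auto
  ultimately have "n - (n - k) \<in> K" by simp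
  from shifted [OF K(1) this] show ?thesis .
qed

theorem theorem2p8:
  fixes n :: nat and \<mu> :: "nat multiset" and \<psi> :: "(nat \<Rightarrow> nat) \<Rightarrow> complex"
  assumes "partition_of n \<mu>"
    and "\<exists>cDes p. cyclic_extension n (conj_class n \<mu>) (Des n) cDes p"
    and "higher_lie_character n \<mu> \<psi>"
  shows "\<forall>cDes p J. cyclic_extension n (conj_class n \<mu>) (Des n) cDes p \<and> {} \<subset> J \<and> J \<subset> {1..n} \<longrightarrow>
    of_nat (card {\<pi> \<in> conj_class n \<mu>. cDes \<pi> = J}) = hall (affine_ribbon n J) (frobenius_ch n \<psi>)"
proof (intro allI impI, elim conjE)
  fix cDes p J
  assume ext: "cyclic_extension n (conj_class n \<mu>) (Des n) cDes p" and J: "{} \<subset> J" "J \<subset> {1..n}"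
  define A where "A = conj_class n \<mu>"
  define T where "T = {I. I \<noteq> {} \<and> I \<subseteq> J}"
  define F where "F = (\<lambda>K. complex_of_nat (card {\<pi> \<in> A. cDes \<pi> \<subseteq> K}))"
  have finJ: "finite J" using J(2) finite_subset by blast
  then have finT: "finite T" by (simp add: T_def)
  have finA: "finite A" by (rule finite_subset [of _ "Sym n"]) (auto simp: A_def conj_class_def)
  note coeff = card_cyclic_descents_subset [OF assms(1,3) ext]
  have "hall (affine_ribbon n J) (frobenius_ch n \<psi>) = (\<Sum>I\<in>T. (- 1) ^ card (J - I) *
      basis_coeff mono_sym_part (frobenius_ch n \<psi>) (mset (cyclic_comp n I)))"
    unfolding affine_ribbon_eq T_def [symmetric]
    by (rule hall_sum_hom_sym_part [OF finT]) (use coeff J(2) in \<open>auto simp: T_def\<close>)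
  \<comment> \<open>The sign is rewritten to the form in
    \<open>inclusion_exclusion_mobius\<close>.\<close>
  also have "\<dots> = (\<Sum>I\<in>T. (- 1) ^ (card J - card I) * F I)"
  proof (rule sum.cong [OF refl])
    fix I assume "I \<in> T"
    then have I: "I \<subseteq> J" "I \<subseteq> {1..n}" "I \<noteq> {}" using J(2) by (auto simp: T_def)
    have "card (J - I) = card J - card I" by (rule card_Diff_subset [OF finite_subset [OF I(1) finJ] I(1)])
    then show "(- 1) ^ card (J - I) * basis_coeff mono_sym_part (frobenius_ch n \<psi>) (mset (cyclic_comp n I)) =
        (- 1) ^ (card J - card I) * F I"
      using coeff [OF I(2,3)] by (simp add: F_def A_def)
  qed
  also have "\<dots> = (\<Sum>I\<in>Pow J. (- 1) ^ (card J - card I) * F I)"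
  proof (rule sum.mono_neutral_left)
    have "{\<pi> \<in> A. cDes \<pi> \<subseteq> {}} = {}" using ext by (auto simp: cyclic_extension_def A_def)
    then have "F {} = 0" unfolding F_def by (simp only: card.empty of_nat_0)
    then show "\<forall>I\<in>Pow J - T. (- 1) ^ (card J - card I) * F I = 0" by (auto simp: T_def)
  qed (auto simp: T_def finJ)
  also have "\<dots> = of_nat (card {\<pi> \<in> A. cDes \<pi> = J})"
  proof (rule inclusion_exclusion_mobius [symmetric, OF _ finJ])
    fix S :: "nat set" assume "finite S"
    have "{\<pi> \<in> A. cDes \<pi> \<subseteq> S} = (\<Union>K\<in>Pow S. {\<pi> \<in> A. cDes \<pi> = K})" by auto
    then have "card {\<pi> \<in> A. cDes \<pi> \<subseteq> S} = (\<Sum>K\<in>Pow S. card {\<pi> \<in> A. cDes \<pi> = K})"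
      using \<open>finite S\<close> finA by (simp only:) (intro card_UN_disjoint, auto)
    then show "F S = (\<Sum>K\<in>Pow S. of_nat (card {\<pi> \<in> A. cDes \<pi> = K}))" by (simp add: F_def)
  qed
  finally show "of_nat (card {\<pi> \<in> conj_class n \<mu>. cDes \<pi> = J}) = hall (affine_ribbon n J) (frobenius_ch n \<psi>)"
    by (simp add: A_def)
qed


end
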